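(* Let $m\ge 3$ and $\lambda\in\mathbb{R}$, and let $M^m$ be a connected pseudo-umbilical $\lambda$-biminimal submanifold in the Euclidean space $\mathbb{E}^{m+2}$, with mean curvature vector field $\mathbf{H}$. Then the mean curvature $|\mathbf{H}|$ is constant on $M$. Moreover, if $\lambda\ge 0$, then $M$ is minimal (i.e. $\mathbf{H}\equiv 0$). If $\lambda<0$ and $M$ is not minimal, then $|\mathbf{H}|^2=-\frac{\lambda}{m}$, and in this case there exists a point $c\in\mathbb{E}^{m+2}$ such that $M$ is contained, as a minimal submanifold, in the hypersphere $\mathbb{S}^{m+1}\big(c,\sqrt{-m/\lambda}\big)\subset\mathbb{E}^{m+2}$ with center $c$ and radius $\sqrt{-m/\lambda}$.
   Context: A submanifold $M^m$ of a Riemannian manifold $N$ means an $m$-dimensional smooth manifold with an isometric immersion $\mathbf{x}:(M^m,g)\to N$, where $g$ is the induced metric. $B$ is the second fundamental form, $A_\xi$ the Weingarten (shape) operator in the normal direction $\xi$ ($\langle B(X,Y),\xi\rangle=\langle A_\xi X,Y\rangle$), $\nabla^\perp$ the normal connection, and $\mathbf{H}=\frac1m\sum_{i=1}^m B(e_i,e_i)$ the mean curvature vector field, for a local orthonormal frame $\{e_1,\dots,e_m\}$ of $M$. $M$ is minimal if $\mathbf{H}\equiv0$. $\Delta^\perp=\sum_i\big(\nabla^\perp_{e_i}\nabla^\perp_{e_i}-\nabla^\perp_{\nabla_{e_i}e_i}\big)$ is the (non-positive) normal Laplacian. $M$ is pseudo-umbilical if $A_{\mathbf{H}}=|\mathbf{H}|^2\,\mathrm{Id}$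 everywhere on $M$ ($\mathbf{H}$ is allowed to vanish). For $\lambda\in\mathbb{R}$, a submanifold $M^m$ of a Riemannian manifold of constant sectional curvature $k$ is $\lambda$-biminimal if $\Delta^\perp\mathbf{H}-\sum_{i=1}^mB(A_{\mathbf{H}}e_i,e_i)+mk\,\mathbf{H}=\lambda\mathbf{H}$; for $\mathbb{E}^{m+2}$ one has $k=0$. *)

theory Defs
  imports "HOL-Analysis.Analysis"
begin

section \<open>Smooth maps between open subsets of normed spaces\<close>

text \<open>The notions below are used for open \<open>S\<close> in a finite-dimensional space, where
  \<open>C\<^sup>k\<^sup>+\<^sup>1\<close> means that \<open>f\<close> is differentiable and that all directional derivatives of \<open>f\<close> are \<open>C\<^sup>k\<close>.\<close>

primrec Ck_on :: "nat \<Rightarrow> 'c::real_normed_vector set \<Rightarrow> ('c \<Rightarrow> 'b::real_normed_vector) \<Rightarrow> bool" where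
  "Ck_on 0 S f \<longleftrightarrow> continuous_on S f"
| "Ck_on (Suc k) S f \<longleftrightarrow>
     (\<forall>u\<in>S. f differentiable at u) \<and> (\<forall>h. Ck_on k S (\<lambda>u. frechet_derivative f (at u) h))"

definition smooth_on :: "'c::real_normed_vector set \<Rightarrow> ('c \<Rightarrow> 'b::real_normed_vector) \<Rightarrow> bool" where
  "smooth_on S f \<longleftrightarrow> (\<forall>k. Ck_on k S f)"

section \<open>Immersed submanifolds\<close>

text \<open>A chart is a pair \<open>(U, \<phi>)\<close>. Only the values of \<open>\<phi>\<close> on \<open>U\<close> matter. The model space
  \<open>'c\<close> carries the dimension of the manifold.\<close>

type_synonym ('a, 'c) chart = "'a set \<times> ('a \<Rightarrow> 'c)"

record ('a, 'c, 'e) submfd =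
  mtop :: "'a topology"
  atlas :: "('a, 'c) chart set"
  imm :: "'a \<Rightarrow> 'e"

definition in_chart :: "('a, 'c) chart \<Rightarrow> ('a \<Rightarrow> 'b) \<Rightarrow> 'c \<Rightarrow> 'b" where
  "in_chart c F = F \<circ> inv_into (fst c) (snd c)"

definition smooth_manifold :: "'a topology \<Rightarrow> ('a, 'c::euclidean_space) chart set \<Rightarrow> bool" where
  "smooth_manifold X A \<longleftrightarrow>
     Hausdorff_space X \<and> second_countable X \<and>
     (\<Union>c\<in>A. fst c) = topspace X \<and>
     (\<forall>(U, \<phi>)\<in>A. openin X U \<and> open (\<phi> ` U) \<and>
        homeomorphic_map (subtopology X U) (top_of_set (\<phi> ` U)) \<phi>) \<and>
     (\<forall>(U, \<phi>)\<in>A. \<forall>(V, \<psi>)\<in>A. smooth_on (\<phi> ` (U \<inter> V)) (in_chart (U, \<phi>) \<psi>))"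

definition smooth_map_on ::
    "('a, 'c::euclidean_space, 'e) submfd \<Rightarrow> 'a set \<Rightarrow> ('a \<Rightarrow> 'b::real_normed_vector) \<Rightarrow> bool" where
  "smooth_map_on M W F \<longleftrightarrow> (\<forall>(U, \<phi>)\<in>atlas M. smooth_on (\<phi> ` (U \<inter> W)) (in_chart (U, \<phi>) F))"

definition immersed_submanifold :: "('a, 'c::euclidean_space, 'e::euclidean_space) submfd \<Rightarrow> bool" where
  "immersed_submanifold M \<longleftrightarrow>
     smooth_manifold (mtop M) (atlas M) \<and>
     smooth_map_on M (topspace (mtop M)) (imm M) \<and>
     (\<forall>(U, \<phi>)\<in>atlas M. \<forall>p\<in>U. inj (frechet_derivative (in_chart (U, \<phi>) (imm M)) (at (\<phi> p))))"

section \<open>Tangent vectors and differentiation\<close>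

definition chart_around :: "('a, 'c, 'e) submfd \<Rightarrow> 'a \<Rightarrow> ('a, 'c) chart" where
  "chart_around M p = (SOME c. c \<in> atlas M \<and> p \<in> fst c)"

definition differential ::
    "('a, 'c::euclidean_space, 'e) submfd \<Rightarrow> ('a \<Rightarrow> 'b::real_normed_vector) \<Rightarrow> 'a \<Rightarrow> 'c \<Rightarrow> 'b" where
  "differential M F p =
     frechet_derivative (in_chart (chart_around M p) F) (at (snd (chart_around M p) p))"

text \<open>The tangent space of \<open>M\<close> at \<open>p\<close> is identified with its image under the (injective)
  differential of the immersion. Under this identification the induced metric is the
  restriction of the ambient inner product, and a vector field is a map into the ambient space.
  The tangent vector \<open>v\<close> acts on a vector-valued map \<open>F\<close> by \<open>dderiv M v F\<close>; by the chain rule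
  neither notion depends on the chosen chart.\<close>

definition tangent_space :: "('a, 'c::euclidean_space, 'e::euclidean_space) submfd \<Rightarrow> 'a \<Rightarrow> 'e set" where
  "tangent_space M p = range (differential M (imm M) p)"

definition dderiv ::
    "('a, 'c::euclidean_space, 'e::euclidean_space) submfd \<Rightarrow> 'e \<Rightarrow> ('a \<Rightarrow> 'b::real_normed_vector) \<Rightarrow> 'a \<Rightarrow> 'b" where
  "dderiv M v F p = differential M F p (inv (differential M (imm M) p) v)"

definition tangent_field ::
    "('a, 'c::euclidean_space, 'e::euclidean_space) submfd \<Rightarrow> 'a set \<Rightarrow> ('a \<Rightarrow> 'e) \<Rightarrow> bool" where
  "tangent_field M W Y \<longleftrightarrow> smooth_map_on M W Y \<and> (\<forall>q\<in>W. Y q \<in> tangent_space M q)"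

definition orth_proj :: "'e::euclidean_space set \<Rightarrow> 'e \<Rightarrow> 'e" where
  "orth_proj S v = (THE w. w \<in> S \<and> v - w \<in> S\<^sup>\<bottom>)"

section \<open>Submanifolds of a Riemannian manifold\<close>

text \<open>The ambient Riemannian manifold \<open>N\<close> is an embedded submanifold of a Euclidean space. It enters
  through its tangent spaces \<open>TN q\<close> for \<open>q \<in> N\<close>; the Levi-Civita connection of \<open>N\<close> is the
  orthogonal projection to \<open>TN\<close> of the Euclidean directional derivative. Two cases are
  needed: the whole Euclidean space, and a hypersphere with centre \<open>c\<close>, whose tangent space at
  \<open>q\<close> is the orthogonal complement of \<open>q - c\<close>.\<close>

definition euclidean_tangent :: "'e::euclidean_space \<Rightarrow> 'e set" where
  "euclidean_tangent q = UNIV"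

definition sphere_tangent :: "'e::euclidean_space \<Rightarrow> 'e \<Rightarrow> 'e set" where
  "sphere_tangent c q = {q - c}\<^sup>\<bottom>"

context
  fixes TN :: "'e::euclidean_space \<Rightarrow> 'e set"
    and M :: "('a, 'c::euclidean_space, 'e) submfd"
begin

definition normal_space :: "'a \<Rightarrow> 'e set" where
  "normal_space p = TN (imm M p) \<inter> (tangent_space M p)\<^sup>\<bottom>"

definition ambient_conn :: "'e \<Rightarrow> ('a \<Rightarrow> 'e) \<Rightarrow> 'a \<Rightarrow> 'e" where
  "ambient_conn v F p = orth_proj (TN (imm M p)) (dderiv M v F p)"

definition tangent_conn :: "'e \<Rightarrow> ('a \<Rightarrow> 'e) \<Rightarrow> 'a \<Rightarrow> 'e" where
  "tangent_conn v Y p = orth_proj (tangent_space M p) (ambient_conn v Y p)"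

definition normal_conn :: "'e \<Rightarrow> ('a \<Rightarrow> 'e) \<Rightarrow> 'a \<Rightarrow> 'e" where
  "normal_conn v \<xi> p = orth_proj (normal_space p) (ambient_conn v \<xi> p)"

text \<open>The second fundamental form \<open>B(v, w)\<close> at \<open>p\<close> is the normal part of the derivative in the
  direction \<open>v\<close> of a local tangent vector field extending \<open>w\<close>; it does not depend on the
  extension.\<close>

definition extension :: "'a \<Rightarrow> 'e \<Rightarrow> 'a \<Rightarrow> 'e" where
  "extension p w = (SOME Y. \<exists>W. openin (mtop M) W \<and> p \<in> W \<and> tangent_field M W Y \<and> Y p = w)"

definition second_ff :: "'a \<Rightarrow> 'e \<Rightarrow> 'e \<Rightarrow> 'e" where
  "second_ff p v w = orth_proj (normal_space p) (ambient_conn v (extension p w) p)"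

definition shape_op :: "'a \<Rightarrow> 'e \<Rightarrow> 'e \<Rightarrow> 'e" where
  "shape_op p \<xi> v =
     (THE a. a \<in> tangent_space M p \<and> (\<forall>w\<in>tangent_space M p. second_ff p v w \<bullet> \<xi> = a \<bullet> w))"

definition local_orthonormal_frame :: "'a set \<Rightarrow> (nat \<Rightarrow> 'a \<Rightarrow> 'e) \<Rightarrow> bool" where
  "local_orthonormal_frame W e \<longleftrightarrow>
     (\<forall>i\<in>{1..DIM('c)}. tangent_field M W (e i)) \<and>
     (\<forall>q\<in>W. \<forall>i\<in>{1..DIM('c)}. \<forall>j\<in>{1..DIM('c)}. e i q \<bullet> e j q = (if i = j then 1 else 0))"

text \<open>None of the traces below depends on the choice of the frame.\<close>

definition frame_around :: "'a \<Rightarrow> nat \<Rightarrow> 'a \<Rightarrow> 'e" where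
  "frame_around p = (SOME e. \<exists>W. openin (mtop M) W \<and> p \<in> W \<and> local_orthonormal_frame W e)"

definition mean_curvature :: "'a \<Rightarrow> 'e" where
  "mean_curvature p =
     (let e = frame_around p in
        (1 / real DIM('c)) *\<^sub>R (\<Sum>i=1..DIM('c). second_ff p (e i p) (e i p)))"

definition normal_laplacian :: "('a \<Rightarrow> 'e) \<Rightarrow> 'a \<Rightarrow> 'e" where
  "normal_laplacian \<xi> p =
     (let e = frame_around p in
        \<Sum>i=1..DIM('c).
          normal_conn (e i p) (\<lambda>q. normal_conn (e i q) \<xi> q) p
          - normal_conn (tangent_conn (e i p) (e i) p) \<xi> p)"

definition minimal :: bool where
  "minimal \<longleftrightarrow> (\<forall>p\<in>topspace (mtop M). mean_curvature p = 0)"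

definition pseudo_umbilical :: bool where
  "pseudo_umbilical \<longleftrightarrow>
     (\<forall>p\<in>topspace (mtop M). \<forall>v\<in>tangent_space M p.
        shape_op p (mean_curvature p) v = (norm (mean_curvature p))\<^sup>2 *\<^sub>R v)"

text \<open>Here \<open>k\<close> is the constant sectional curvature of the ambient manifold.\<close>

definition biminimal :: "real \<Rightarrow> real \<Rightarrow> bool" where
  "biminimal k lam \<longleftrightarrow>
     (\<forall>p\<in>topspace (mtop M).
        let H = mean_curvature; e = frame_around p in
          normal_laplacian H p
          - (\<Sum>i=1..DIM('c). second_ff p (shape_op p (H p) (e i p)) (e i p))
          + (real DIM('c) * k) *\<^sub>R H p
          = lam *\<^sub>R H p)"

end

definition minimal_in_sphere ::
    "'e \<Rightarrow> real \<Rightarrow> ('a, 'c::euclidean_space, 'e::euclidean_space) submfd \<Rightarrow> bool" where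
  "minimal_in_sphere c r M \<longleftrightarrow>
     imm M ` topspace (mtop M) \<subseteq> sphere c r \<and> minimal (sphere_tangent c) M"

end

theory Submission
  imports Defs
begin

text \<open>Where \<open>H \<noteq> 0\<close>, write \<open>H = h \<nu>\<close> and let \<open>\<eta>\<close> complete \<open>\<nu>\<close> to an orthonormal frame of the normal plane,
  with connection form \<open>\<omega>(u) = \<langle>d\<nu>(u), \<eta>\<rangle>\<close>. Pseudo-umbilicity turns the Codazzi equation of \<open>\<nu>\<close> into
  \<open>dh(u) v - dh(v) u = \<omega>(u) A\<^sub>\<eta> v - \<omega>(v) A\<^sub>\<eta> u\<close>. If \<open>dh \<noteq> 0\<close> at a point, \<open>m \<ge> 3\<close> makes \<open>\<omega> = a \<theta>\<close> and \<open>dh = \<mu> a \<theta>\<close>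
  for the unit covector \<open>\<theta>\<close> dual to \<open>w = grad h/|grad h|\<close>, and \<open>A\<^sub>\<eta>\<close> has the eigenvalue \<open>\<mu>\<close> on the complement
  of \<open>w\<close> and \<open>-(m - 1) \<mu>\<close> on \<open>w\<close>. The Codazzi, Ricci and Gauss equations and the two components of the
  biminimal equation then become an overdetermined system of ordinary differential equations along \<open>w\<close>
  for \<open>h\<close>, \<open>\<mu>\<close>, \<open>a\<close> and the principal curvature \<open>\<kappa>\<close> of the level sets of \<open>h\<close>, which elimination shows to
  be inconsistent. So \<open>h\<close> is locally constant where \<open>H \<noteq> 0\<close>; then \<open>\<omega> = 0\<close>, the biminimal equation reduces to
  \<open>m h\<^sup>2 = -\<lambda>\<close>, the point \<open>X + H/h\<^sup>2\<close> does not move, and connectedness makes these statements global.\<close>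

section \<open>Calculus of smooth maps\<close>

text \<open>The frame \<open>\<nu>\<close>, \<open>\<eta>\<close> exists only where \<open>H\<close>
  does not vanish, so the local analysis is confined to such open sets and the zeros of
  \<open>H\<close> need their own argument: |H|^2 takes no value besides 0 and
  -\<open>lam\<close>/m, and this gap makes the zero set open by continuity, so \<open>H\<close>
  vanishes everywhere or nowhere. The condition m \<ge> 3 acts through one piece of linear algebra:
  two linear functionals have a common nonzero kernel vector. For given u it yields v orthogonal to
  u with om(v) = 0, and the Codazzi equation tested on u, v, v gives dh(u) = 0 whenever om(u) = 0.
  The elimination is a count of unknowns. Scale-invariant ratios reduce the unknowns, with
  \<open>lam\<close>, to four, bound by one algebraic relation. That relation and its first
  derivative remove \<open>lam\<close> and determine one more ratio; the next two derivatives give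
  two polynomial equations in the remaining two, so one ratio is a root of a fixed nonzero
  polynomial. Nothing is integrated.\<close>

abbreviation D :: "('c::real_normed_vector \<Rightarrow> 'b::real_normed_vector) \<Rightarrow> 'c \<Rightarrow> 'c \<Rightarrow> 'b" where
  "D f q \<equiv> frechet_derivative f (at q)"

lemma D_eqI: "(f has_derivative f') (at q) \<Longrightarrow> D f q = f'"
  using frechet_derivative_at by metis

lemma D_works: "f differentiable at q \<Longrightarrow> (f has_derivative D f q) (at q)"
  by (simp add: frechet_derivative_works)

lemma D_cong:
  assumes "f differentiable at q" "open S" "q \<in> S" "\<And>x. x \<in> S \<Longrightarrow> f x = g x"
  shows "g differentiable at q" "D g q = D f q"
proof -
  have "(g has_derivative D f q) (at q)"
    by (rule has_derivative_transform_within_open[OF D_works[OF assms(1)] assms(2,3,4)])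
  then show "g differentiable at q" "D g q = D f q"
    by (auto simp: differentiable_def D_eqI)
qed

lemma D_linear: "f differentiable at q \<Longrightarrow> linear (D f q)"
  by (rule linear_frechet_derivative)

lemma Ck_on_cong:
  assumes "open S" "Ck_on k S f" "\<And>x. x \<in> S \<Longrightarrow> f x = g x"
  shows "Ck_on k S g"
  using assms
proof (induction k arbitrary: f g)
  case 0
  then show ?case by (simp cong: continuous_on_cong)
next
  case (Suc k)
  note c = D_cong[OF _ Suc.prems(1) _ Suc.prems(3)]
  have "Ck_on k S (\<lambda>u. D g u h)" for h
  proof (rule Suc.IH)
    show "Ck_on k S (\<lambda>u. D f u h)" using Suc.prems by simp
  qed (use Suc.prems c in auto)
  then show ?case
    using Suc.prems c by auto
qed

lemma Ck_on_subset: "Ck_on k S f \<Longrightarrow> T \<subseteq> S \<Longrightarrow> Ck_on k T f"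
  by (induction k arbitrary: f) (auto intro: continuous_on_subset)

lemma Ck_on_Suc: "Ck_on (Suc k) S f \<Longrightarrow> Ck_on k S f"
proof (induction k arbitrary: f)
  case 0
  then show ?case
    by (auto intro!: continuous_at_imp_continuous_on differentiable_imp_continuous_within)
next
  case (Suc k)
  then show ?case by (subst Ck_on.simps(2)) auto
qed

lemma Ck_on_differentiable: "Ck_on (Suc k) S f \<Longrightarrow> q \<in> S \<Longrightarrow> f differentiable at q"
  by simp

lemma Ck_on_const: "Ck_on k S (\<lambda>x. c)"
  by (induction k arbitrary: c) auto

lemma Ck_on_add:
  assumes "open S" "Ck_on k S f" "Ck_on k S g"
  shows "Ck_on k S (\<lambda>x. f x + g x)"
  using assms
proof (induction k arbitrary: f g)
  case 0
  then show ?case by (simp add: continuous_on_add)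
next
  case (Suc k)
  have d: "f differentiable at q" "g differentiable at q" if "q \<in> S" for q
    using Suc.prems that by auto
  have "D (\<lambda>x. f x + g x) q = (\<lambda>h. D f q h + D g q h)" if "q \<in> S" for q
    by (rule D_eqI) (rule has_derivative_add[OF D_works[OF d(1)[OF that]] D_works[OF d(2)[OF that]]])
  moreover have "Ck_on k S (\<lambda>q. D f q h + D g q h)" for h
    using Suc by auto
  ultimately have "Ck_on k S (\<lambda>q. D (\<lambda>x. f x + g x) q h)" for h
    by (rule_tac Ck_on_cong[OF Suc.prems(1)]) auto
  then show ?case
    using d by auto
qed

lemma Ck_on_bilinear:
  fixes prod (infixl \<open>\<star>\<close> 70)
  assumes "bounded_bilinear prod" "open S" "Ck_on k S f" "Ck_on k S g"
  shows "Ck_on k S (\<lambda>x. f x \<star> g x)"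
  using assms(3,4)
proof (induction k arbitrary: f g)
  case 0
  then show ?case using bounded_bilinear.continuous_on[OF assms(1)] by simp
next
  case (Suc k)
  have d: "f differentiable at q" "g differentiable at q" if "q \<in> S" for q
    using Suc.prems that by auto
  have h: "((\<lambda>x. f x \<star> g x) has_derivative (\<lambda>h. f q \<star> D g q h + D f q h \<star> g q)) (at q)" if "q \<in> S" for q
    by (rule bounded_bilinear.FDERIV[OF assms(1) D_works[OF d(1)[OF that]] D_works[OF d(2)[OF that]]])
  then have "D (\<lambda>x. f x \<star> g x) q = (\<lambda>h. f q \<star> D g q h + D f q h \<star> g q)" if "q \<in> S" for q
    using D_eqI that by blast
  moreover have "Ck_on k S (\<lambda>q. f q \<star> D g q h + D f q h \<star> g q)" for h
    using Suc.prems Ck_on_Suc[OF Suc.prems(1)] Ck_on_Suc[OF Suc.prems(2)]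
    by (intro Ck_on_add assms(2) Suc.IH) auto
  ultimately have "Ck_on k S (\<lambda>q. D (\<lambda>x. f x \<star> g x) q h)" for h
    by (rule_tac Ck_on_cong[OF assms(2)]) auto
  then show ?case
    using h by (auto simp: differentiable_def)
qed

lemma Ck_on_sum: "open S \<Longrightarrow> (\<And>i. i \<in> I \<Longrightarrow> Ck_on k S (f i)) \<Longrightarrow> Ck_on k S (\<lambda>x. \<Sum>i\<in>I. f i x)"
  by (induction I rule: infinite_finite_induct) (auto simp: Ck_on_const Ck_on_add)

text \<open>\<open>Ck_on\<close> speaks of derivatives in constant directions; this expansion turns
  a derivative along a moving vector into finitely many of those.\<close>

lemma linear_expand_Basis:
  fixes L :: "'d::euclidean_space \<Rightarrow> 'b::real_vector"
  assumes "linear L"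
  shows "L h = (\<Sum>b\<in>Basis. (h \<bullet> b) *\<^sub>R L b)"
proof -
  have "L h = L (\<Sum>b\<in>Basis. (h \<bullet> b) *\<^sub>R b)"
    by (simp add: euclidean_representation)
  then show ?thesis
    by (simp add: linear_sum[OF assms] linear_cmul[OF assms])
qed

lemma Ck_on_compose:
  fixes f :: "'c::real_normed_vector \<Rightarrow> 'd::euclidean_space"
  assumes "open S" "open T" "f ` S \<subseteq> T" "Ck_on k T g" "Ck_on k S f"
  shows "Ck_on k S (\<lambda>x. g (f x))"
  using assms(4,5)
proof (induction k arbitrary: g)
  case 0
  then show ?case using assms(3) continuous_on_compose2[of T g S f] by simp
next
  case (Suc k)
  have d: "f differentiable at q" "g differentiable at (f q)" if "q \<in> S" for q
    using Suc.prems that assms(3) by auto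
  have h: "((\<lambda>x. g (f x)) has_derivative (\<lambda>h. D g (f q) (D f q h))) (at q)" if "q \<in> S" for q
    by (rule has_derivative_compose[OF D_works[OF d(1)[OF that]] D_works[OF d(2)[OF that]]])
  have "D (\<lambda>x. g (f x)) q h = (\<Sum>b\<in>Basis. (D f q h \<bullet> b) *\<^sub>R D g (f q) b)" if "q \<in> S" for q h
    unfolding D_eqI[OF h[OF that]] by (rule linear_expand_Basis[OF D_linear[OF d(2)[OF that]]])
  moreover have "Ck_on k S (\<lambda>q. \<Sum>b\<in>Basis. (D f q h \<bullet> b) *\<^sub>R D g (f q) b)" for h
  proof (intro Ck_on_sum assms(1) Ck_on_bilinear[OF bounded_bilinear_scaleR] Ck_on_bilinear[OF bounded_bilinear_inner] Ck_on_const)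
    fix b
    have "Ck_on k T (\<lambda>y. D g y b)" using Suc.prems by simp
    moreover have "Ck_on k S f" using Ck_on_Suc Suc.prems by blast
    ultimately show "Ck_on k S (\<lambda>q. D g (f q) b)" by (rule Suc.IH)
  qed (use Suc.prems in auto)
  ultimately have "Ck_on k S (\<lambda>q. D (\<lambda>x. g (f x)) q h)" for h
    by (rule_tac Ck_on_cong[OF assms(1)]) (assumption, rule sym, assumption)
  then show ?case
    using h by (auto simp: differentiable_def)
qed

text \<open>The exponent stays arbitrary because each differentiation lowers it by one.\<close>

lemma Ck_on_powr: "Ck_on k {0<..} (\<lambda>x::real. x powr s)"
proof (induction k arbitrary: s)
  case 0
  then show ?case by (auto intro!: continuous_intros)
next
  case (Suc k)
  have h: "((\<lambda>x. x powr s) has_derivative (\<lambda>h. h * (s * q powr (s - 1)))) (at q)" if "q > 0" for q :: real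
    using has_real_derivative_powr[OF that, of s] unfolding has_field_derivative_def
    by (subst mult.commute)
  then have "D (\<lambda>x. x powr s) q = (\<lambda>h. h * (s * q powr (s - 1)))" if "q > 0" for q :: real
    using D_eqI that by blast
  moreover have "Ck_on k {0<..} (\<lambda>q::real. h * (s * q powr (s - 1)))" for h
    by (intro Ck_on_bilinear[OF bounded_bilinear_mult] Ck_on_const Suc) auto
  ultimately have "Ck_on k {0<..} (\<lambda>q. D (\<lambda>x. x powr s) q h)" for h
    by (rule_tac Ck_on_cong[of "{0<..}"]) auto
  then show ?case
    using h by (auto simp: differentiable_def)
qed

lemma smooth_on_cong: "open S \<Longrightarrow> smooth_on S f \<Longrightarrow> (\<And>x. x \<in> S \<Longrightarrow> f x = g x) \<Longrightarrow> smooth_on S g"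
  unfolding smooth_on_def using Ck_on_cong by blast

lemma smooth_on_subset: "smooth_on S f \<Longrightarrow> T \<subseteq> S \<Longrightarrow> smooth_on T f"
  unfolding smooth_on_def using Ck_on_subset by blast

lemma smooth_on_differentiable: "smooth_on S f \<Longrightarrow> q \<in> S \<Longrightarrow> f differentiable at q"
  unfolding smooth_on_def using Ck_on_differentiable by blast

lemma smooth_on_continuous: "smooth_on S f \<Longrightarrow> continuous_on S f"
  unfolding smooth_on_def by (metis Ck_on.simps(1))

lemma smooth_on_const: "smooth_on S (\<lambda>x. c)"
  by (simp add: smooth_on_def Ck_on_const)

lemma smooth_on_add: "open S \<Longrightarrow> smooth_on S f \<Longrightarrow> smooth_on S g \<Longrightarrow> smooth_on S (\<lambda>x. f x + g x)"
  by (simp add: smooth_on_def Ck_on_add)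

lemma smooth_on_scaleR: "open S \<Longrightarrow> smooth_on S f \<Longrightarrow> smooth_on S g \<Longrightarrow> smooth_on S (\<lambda>x. f x *\<^sub>R g x)"
  by (simp add: smooth_on_def Ck_on_bilinear[OF bounded_bilinear_scaleR])

lemma smooth_on_inner: "open S \<Longrightarrow> smooth_on S f \<Longrightarrow> smooth_on S g \<Longrightarrow> smooth_on S (\<lambda>x. f x \<bullet> g x)"
  by (simp add: smooth_on_def Ck_on_bilinear[OF bounded_bilinear_inner])

lemma smooth_on_mult:
  fixes f g :: "'c::real_normed_vector \<Rightarrow> real"
  shows "open S \<Longrightarrow> smooth_on S f \<Longrightarrow> smooth_on S g \<Longrightarrow> smooth_on S (\<lambda>x. f x * g x)"
  by (simp add: smooth_on_def Ck_on_bilinear[OF bounded_bilinear_mult])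

lemma smooth_on_minus: "open S \<Longrightarrow> smooth_on S f \<Longrightarrow> smooth_on S (\<lambda>x. - f x)"
  using smooth_on_scaleR[of S "\<lambda>x. -1" f] by (simp add: smooth_on_const)

lemma smooth_on_diff: "open S \<Longrightarrow> smooth_on S f \<Longrightarrow> smooth_on S g \<Longrightarrow> smooth_on S (\<lambda>x. f x - g x)"
  using smooth_on_add[of S f "\<lambda>x. - g x"] by (simp add: smooth_on_minus)

lemma smooth_on_sum: "open S \<Longrightarrow> (\<And>i. i \<in> I \<Longrightarrow> smooth_on S (f i)) \<Longrightarrow> smooth_on S (\<lambda>x. \<Sum>i\<in>I. f i x)"
  by (simp add: smooth_on_def Ck_on_sum)

lemma smooth_on_compose:
  fixes f :: "'c::real_normed_vector \<Rightarrow> 'd::euclidean_space"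
  assumes "open S" "open T" "f ` S \<subseteq> T" "smooth_on T g" "smooth_on S f"
  shows "smooth_on S (\<lambda>x. g (f x))"
  using assms by (simp add: smooth_on_def Ck_on_compose)

lemma smooth_on_powr:
  fixes f :: "'c::real_normed_vector \<Rightarrow> real"
  assumes "open S" "smooth_on S f" "\<And>x. x \<in> S \<Longrightarrow> f x > 0"
  shows "smooth_on S (\<lambda>x. f x powr s)"
proof (rule smooth_on_compose[where T = "{0<..}" and f = f and g = "\<lambda>x. x powr s", OF assms(1)])
  show "smooth_on {0<..} (\<lambda>x::real. x powr s)" by (simp add: smooth_on_def Ck_on_powr)
qed (use assms in auto)

lemma smooth_on_inverse:
  fixes f :: "'c::real_normed_vector \<Rightarrow> real"
  assumes S: "open S" and f: "smooth_on S f" and n: "\<And>x. x \<in> S \<Longrightarrow> f x \<noteq> 0"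
  shows "smooth_on S (\<lambda>x. inverse (f x))"
proof (rule smooth_on_cong[OF S])
  \<comment> \<open>Squaring makes the base of \<open>powr\<close> positive whatever the sign of
    \<open>f\<close>.\<close>
  show "smooth_on S (\<lambda>x. f x * (f x * f x) powr (-1))"
    using n by (intro smooth_on_mult smooth_on_powr S f) (use not_real_square_gt_zero in blast)
  fix x assume "x \<in> S"
  then have "f x * f x > 0" using n[of x] not_real_square_gt_zero by blast
  then have "(f x * f x) powr (-1) = inverse (f x * f x)"
    by (simp add: powr_minus)
  then show "f x * (f x * f x) powr (-1) = inverse (f x)"
    using n[OF \<open>x \<in> S\<close>] by (simp add: field_simps)
qed

lemma smooth_on_divide:
  fixes f g :: "'c::real_normed_vector \<Rightarrow> real"
  assumes "open S" "smooth_on S f" "smooth_on S g" "\<And>x. x \<in> S \<Longrightarrow> g x \<noteq> 0"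
  shows "smooth_on S (\<lambda>x. f x / g x)"
  unfolding divide_inverse using assms by (intro smooth_on_mult smooth_on_inverse)

lemma smooth_on_norm:
  fixes f :: "'c::real_normed_vector \<Rightarrow> 'b::real_inner"
  assumes S: "open S" and f: "smooth_on S f" and n: "\<And>x. x \<in> S \<Longrightarrow> f x \<noteq> 0"
  shows "smooth_on S (\<lambda>x. norm (f x))"
proof (rule smooth_on_cong[OF S])
  show "smooth_on S (\<lambda>x. (f x \<bullet> f x) powr (1/2))"
    using n by (intro smooth_on_inner smooth_on_powr S f) simp
qed (simp add: norm_eq_sqrt_inner powr_half_sqrt)

lemma smooth_on_D_const: "smooth_on S f \<Longrightarrow> smooth_on S (\<lambda>u. D f u h)"
  unfolding smooth_on_def by (metis Ck_on.simps(2))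

lemma smooth_on_D:
  fixes f :: "'c::euclidean_space \<Rightarrow> 'b::real_normed_vector"
  assumes S: "open S" and f: "smooth_on S f" and V: "smooth_on S V"
  shows "smooth_on S (\<lambda>u. D f u (V u))"
proof (rule smooth_on_cong[OF S])
  show "smooth_on S (\<lambda>u. \<Sum>b\<in>Basis. (V u \<bullet> b) *\<^sub>R D f u b)"
    by (intro smooth_on_sum S smooth_on_scaleR smooth_on_inner V smooth_on_const smooth_on_D_const f)
  fix u assume "u \<in> S"
  then have "linear (D f u)" using smooth_on_differentiable[OF f] D_linear by blast
  then show "(\<Sum>b\<in>Basis. (V u \<bullet> b) *\<^sub>R D f u b) = D f u (V u)"
    using linear_expand_Basis by metis
qed

lemma D_inner: "f differentiable at q \<Longrightarrow> g differentiable at q \<Longrightarrow>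
    D (\<lambda>x. f x \<bullet> g x) q u = f q \<bullet> D g q u + D f q u \<bullet> g q"
  by (subst D_eqI[OF has_derivative_inner[OF D_works D_works]]) auto

lemma D_locally_const:
  assumes "open S" "q \<in> S" "\<And>x. x \<in> S \<Longrightarrow> f x = c"
  shows "D f q u = 0"
proof -
  have "D f q = D (\<lambda>x. c) q"
    by (rule D_cong(2)[OF _ assms(1,2)]) (simp_all add: assms(3))
  then show ?thesis by simp
qed

section \<open>Symmetry of the second derivative\<close>

lemma has_real_derivative_line:
  assumes "f differentiable at (w + \<sigma> *\<^sub>R u)"
  shows "((\<lambda>\<sigma>. f (w + \<sigma> *\<^sub>R u)) has_real_derivative D f (w + \<sigma> *\<^sub>R u) u) (at \<sigma>)"
proof -
  have l: "((\<lambda>\<sigma>. w + \<sigma> *\<^sub>R u) has_derivative (\<lambda>t. t *\<^sub>R u)) (at \<sigma>)"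
    by (auto intro!: derivative_eq_intros)
  have "((\<lambda>\<sigma>. f (w + \<sigma> *\<^sub>R u)) has_derivative (\<lambda>t. D f (w + \<sigma> *\<^sub>R u) (t *\<^sub>R u))) (at \<sigma>)"
    by (rule has_derivative_compose[OF l D_works[OF assms]])
  then show ?thesis
    unfolding has_field_derivative_def
    by (simp add: linear_cmul[OF D_linear[OF assms]] mult.commute[of _ "D f (w + \<sigma> *\<^sub>R u) u"])
qed

text \<open>The mean value theorem is applied twice: to the increment in direction \<open>v\<close>
  as a function of the step along \<open>u\<close>, then to the resulting difference of derivatives.
  The left side is symmetric in \<open>u\<close> and \<open>v\<close>.\<close>

lemma second_difference:
  fixes f :: "'c::real_normed_vector \<Rightarrow> real"
  assumes f: "Ck_on 2 S f" and s: "s > 0"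
    and box: "\<And>\<sigma> \<tau>. 0 \<le> \<sigma> \<Longrightarrow> \<sigma> \<le> s \<Longrightarrow> 0 \<le> \<tau> \<Longrightarrow> \<tau> \<le> s \<Longrightarrow> q + \<sigma> *\<^sub>R u + \<tau> *\<^sub>R v \<in> S"
  obtains \<xi> \<tau> where "0 < \<xi>" "\<xi> < s" "0 < \<tau>" "\<tau> < s"
    "f (q + s *\<^sub>R u + s *\<^sub>R v) - f (q + s *\<^sub>R u) - f (q + s *\<^sub>R v) + f q
      = s * s * D (\<lambda>p. D f p u) (q + \<xi> *\<^sub>R u + \<tau> *\<^sub>R v) v"
proof -
  have f1: "f differentiable at p" "(\<lambda>p. D f p u) differentiable at p" if "p \<in> S" for p
    using f that by (auto simp: numeral_2_eq_2)
  have "\<exists>\<xi>>0. \<xi> < s \<and> (f ((q + s *\<^sub>R v) + s *\<^sub>R u) - f (q + s *\<^sub>R u)) - (f ((q + s *\<^sub>R v) + 0 *\<^sub>R u) - f (q + 0 *\<^sub>R u))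
      = (s - 0) * (D f ((q + s *\<^sub>R v) + \<xi> *\<^sub>R u) u - D f (q + \<xi> *\<^sub>R u) u)"
  proof (rule MVT2[OF s])
    fix \<sigma> assume \<sigma>: "0 \<le> \<sigma>" "\<sigma> \<le> s"
    have 1: "q + s *\<^sub>R v + \<sigma> *\<^sub>R u \<in> S"
      using box[of \<sigma> s] \<sigma> s by (simp add: algebra_simps)
    have 2: "q + \<sigma> *\<^sub>R u \<in> S"
      using box[of \<sigma> 0] \<sigma> s by simp
    show "((\<lambda>\<sigma>. f ((q + s *\<^sub>R v) + \<sigma> *\<^sub>R u) - f (q + \<sigma> *\<^sub>R u)) has_real_derivative
       (D f ((q + s *\<^sub>R v) + \<sigma> *\<^sub>R u) u - D f (q + \<sigma> *\<^sub>R u) u)) (at \<sigma>)"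
      by (intro DERIV_diff has_real_derivative_line f1 1 2)
  qed
  then obtain \<xi> where \<xi>: "\<xi> > 0" "\<xi> < s" and
    e1: "f (q + s *\<^sub>R u + s *\<^sub>R v) - f (q + s *\<^sub>R u) - f (q + s *\<^sub>R v) + f q
      = s * (D f ((q + \<xi> *\<^sub>R u) + s *\<^sub>R v) u - D f ((q + \<xi> *\<^sub>R u) + 0 *\<^sub>R v) u)"
    by (auto simp: algebra_simps)
  have "\<exists>\<tau>>0. \<tau> < s \<and> D f ((q + \<xi> *\<^sub>R u) + s *\<^sub>R v) u - D f ((q + \<xi> *\<^sub>R u) + 0 *\<^sub>R v) u
     = (s - 0) * D (\<lambda>p. D f p u) ((q + \<xi> *\<^sub>R u) + \<tau> *\<^sub>R v) v"
  proof (rule MVT2[OF s])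
    fix \<tau> assume \<tau>: "0 \<le> \<tau>" "\<tau> \<le> s"
    show "((\<lambda>\<tau>. D f ((q + \<xi> *\<^sub>R u) + \<tau> *\<^sub>R v) u) has_real_derivative
       D (\<lambda>p. D f p u) ((q + \<xi> *\<^sub>R u) + \<tau> *\<^sub>R v) v) (at \<tau>)"
      using box[of \<xi> \<tau>] \<xi> \<tau> by (intro has_real_derivative_line[of "\<lambda>p. D f p u"] f1) auto
  qed
  then obtain \<tau> where "\<tau> > 0" "\<tau> < s" and
    e2: "D f ((q + \<xi> *\<^sub>R u) + s *\<^sub>R v) u - D f ((q + \<xi> *\<^sub>R u) + 0 *\<^sub>R v) u
     = s * D (\<lambda>p. D f p u) ((q + \<xi> *\<^sub>R u) + \<tau> *\<^sub>R v) v"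
    by auto
  with \<xi> e1 show thesis
    by (intro that[of \<xi> \<tau>]) (simp_all add: mult.assoc)
qed

lemma second_derivative_symmetric_real:
  fixes f :: "'c::real_normed_vector \<Rightarrow> real"
  assumes f: "Ck_on 2 S f" and S: "open S" "q \<in> S"
  shows "D (\<lambda>p. D f p u) q v = D (\<lambda>p. D f p v) q u"
proof (rule ccontr)
  assume ne: "D (\<lambda>p. D f p u) q v \<noteq> D (\<lambda>p. D f p v) q u"
  define e where "e = \<bar>D (\<lambda>p. D f p u) q v - D (\<lambda>p. D f p v) q u\<bar> / 2"
  have e: "e > 0" using ne by (simp add: e_def)
  have c: "continuous_on S (\<lambda>p. D (\<lambda>p. D f p u) p v)" for u v
    using f by (simp add: numeral_2_eq_2)
  obtain d1 where d1: "d1 > 0" "\<And>p. p \<in> S \<Longrightarrow> dist p q < d1 \<Longrightarrow> \<bar>D (\<lambda>p. D f p u) p v - D (\<lambda>p. D f p u) q v\<bar> < e"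
    using c[of u v] S(2) e unfolding continuous_on_iff dist_real_def by metis
  obtain d2 where d2: "d2 > 0" "\<And>p. p \<in> S \<Longrightarrow> dist p q < d2 \<Longrightarrow> \<bar>D (\<lambda>p. D f p v) p u - D (\<lambda>p. D f p v) q u\<bar> < e"
    using c[of v u] S(2) e unfolding continuous_on_iff dist_real_def by metis
  obtain d3 where d3: "d3 > 0" "ball q d3 \<subseteq> S"
    using S openE by blast
  define d where "d = min d1 (min d2 d3)"
  have d: "d > 0" using d1 d2 d3 by (simp add: d_def)
  \<comment> \<open>This keeps the whole parallelogram within distance \<open>d\<close> of
    \<open>q\<close>; the summand 1 covers \<open>u\<close> = \<open>v\<close> = 0.\<close>
  define s where "s = d / (2 * (norm u + norm v + 1))"
  have s: "s > 0"
    using d by (auto simp: s_def intro!: divide_pos_pos add_nonneg_pos)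
  have near: "dist (q + \<sigma> *\<^sub>R u + \<tau> *\<^sub>R v) q < d" if "0 \<le> \<sigma>" "\<sigma> \<le> s" "0 \<le> \<tau>" "\<tau> \<le> s" for \<sigma> \<tau>
  proof -
    have "dist (q + \<sigma> *\<^sub>R u + \<tau> *\<^sub>R v) q = norm (\<sigma> *\<^sub>R u + \<tau> *\<^sub>R v)"
      by (simp add: dist_norm)
    also have "\<dots> \<le> \<sigma> * norm u + \<tau> * norm v"
      using norm_triangle_ineq[of "\<sigma> *\<^sub>R u" "\<tau> *\<^sub>R v"] that by simp
    also have "\<dots> \<le> s * norm u + s * norm v"
      using that by (intro add_mono mult_right_mono) auto
    also have "\<dots> < s * (2 * (norm u + norm v + 1))"
    proof -
      have "s * norm u \<ge> 0" "s * norm v \<ge> 0" using s by auto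
      then show ?thesis using s by (simp add: algebra_simps add_nonneg_pos)
    qed
    also have "\<dots> = d"
    proof -
      have "2 * (norm u + norm v + 1) > 0" by (simp add: add_nonneg_pos)
      then show ?thesis unfolding s_def by (metis less_irrefl nonzero_eq_divide_eq)
    qed
    finally show ?thesis .
  qed
  then have inS: "q + \<sigma> *\<^sub>R u + \<tau> *\<^sub>R v \<in> S" if "0 \<le> \<sigma>" "\<sigma> \<le> s" "0 \<le> \<tau>" "\<tau> \<le> s" for \<sigma> \<tau>
  proof -
    have "q + \<sigma> *\<^sub>R u + \<tau> *\<^sub>R v \<in> ball q d3"
      using near[OF that] d_def by (simp add: dist_commute)
    then show ?thesis using d3 by blast
  qed
  have inS': "q + \<sigma> *\<^sub>R v + \<tau> *\<^sub>R u \<in> S" if "0 \<le> \<sigma>" "\<sigma> \<le> s" "0 \<le> \<tau>" "\<tau> \<le> s" for \<sigma> \<tau>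
    using inS[of \<tau> \<sigma>] that by (simp add: algebra_simps)
  obtain \<xi> \<tau> where 1: "0 < \<xi>" "\<xi> < s" "0 < \<tau>" "\<tau> < s"
    "f (q + s *\<^sub>R u + s *\<^sub>R v) - f (q + s *\<^sub>R u) - f (q + s *\<^sub>R v) + f q
      = s * s * D (\<lambda>p. D f p u) (q + \<xi> *\<^sub>R u + \<tau> *\<^sub>R v) v"
    using second_difference[OF f s, of q u v] inS by blast
  obtain \<xi>' \<tau>' where 2: "0 < \<xi>'" "\<xi>' < s" "0 < \<tau>'" "\<tau>' < s"
    "f (q + s *\<^sub>R v + s *\<^sub>R u) - f (q + s *\<^sub>R v) - f (q + s *\<^sub>R u) + f q
      = s * s * D (\<lambda>p. D f p v) (q + \<xi>' *\<^sub>R v + \<tau>' *\<^sub>R u) u"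
    using second_difference[OF f s, of q v u] inS' by blast
  \<comment> \<open>One second difference, evaluated in both orders: the two mixed derivatives
    agree, though at different points near \<open>q\<close>. Continuity at \<open>q\<close> does the
    rest.\<close>
  have "s * s * D (\<lambda>p. D f p u) (q + \<xi> *\<^sub>R u + \<tau> *\<^sub>R v) v = s * s * D (\<lambda>p. D f p v) (q + \<xi>' *\<^sub>R v + \<tau>' *\<^sub>R u) u"
    unfolding 1(5)[symmetric] 2(5)[symmetric] by (simp add: add.commute add.left_commute)
  then have eq: "D (\<lambda>p. D f p u) (q + \<xi> *\<^sub>R u + \<tau> *\<^sub>R v) v = D (\<lambda>p. D f p v) (q + \<xi>' *\<^sub>R v + \<tau>' *\<^sub>R u) u"
    using s by simp
  have "dist (q + \<xi>' *\<^sub>R v + \<tau>' *\<^sub>R u) q < d"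
    using near[of \<tau>' \<xi>'] 2 by (simp add: algebra_simps)
  then have "\<bar>D (\<lambda>p. D f p v) (q + \<xi>' *\<^sub>R v + \<tau>' *\<^sub>R u) u - D (\<lambda>p. D f p v) q u\<bar> < e"
    using 2 inS' d_def by (intro d2(2)) auto
  moreover have "\<bar>D (\<lambda>p. D f p u) (q + \<xi> *\<^sub>R u + \<tau> *\<^sub>R v) v - D (\<lambda>p. D f p u) q v\<bar> < e"
    using 1 inS near[of \<xi> \<tau>] d_def by (intro d1(2)) auto
  moreover have False if "\<bar>X - B\<bar> < \<bar>A - B\<bar> / 2" "\<bar>X - A\<bar> < \<bar>A - B\<bar> / 2" for A B X :: real
    using that abs_triangle_ineq4[of "X - B" "X - A"] by simp
  ultimately show False
    unfolding eq e_def by blast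
qed

text \<open>Pairing with constant vectors reduces this to real functions. Applied to
  \<open>\<nu>\<close>, \<open>\<eta>\<close> and \<open>w\<close> it is the source of the Codazzi,
  Ricci and Gauss equations, so no curvature tensor is ever introduced.\<close>

lemma second_derivative_symmetric:
  fixes f :: "'c::real_normed_vector \<Rightarrow> 'b::real_inner"
  assumes f: "smooth_on S f" and S: "open S" "q \<in> S"
  shows "D (\<lambda>p. D f p u) q v = D (\<lambda>p. D f p v) q u"
proof -
  have "D (\<lambda>p. D f p u) q v \<bullet> z = D (\<lambda>p. D f p v) q u \<bullet> z" for z
  proof -
    have g: "smooth_on S (\<lambda>p. f p \<bullet> z)"
      by (intro smooth_on_inner S f smooth_on_const)
    have d1: "D (\<lambda>p. f p \<bullet> z) p u = D f p u \<bullet> z" if "p \<in> S" for p u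
      using D_inner[of f p "\<lambda>_. z"] smooth_on_differentiable[OF f that] by simp
    have d2: "D (\<lambda>p. D (\<lambda>p. f p \<bullet> z) p u) q v = D (\<lambda>p. D f p u) q v \<bullet> z" for u v
    proof -
      have df: "(\<lambda>p. D f p u) differentiable at q"
        using smooth_on_differentiable[OF smooth_on_D_const[OF f] S(2)] .
      have "D (\<lambda>p. D (\<lambda>p. f p \<bullet> z) p u) q = D (\<lambda>p. D f p u \<bullet> z) q"
        by (rule D_cong(2)[OF _ S]) (use df d1 in auto)
      then show ?thesis
        using D_inner[OF df, of "\<lambda>_. z"] by simp
    qed
    show ?thesis
      using second_derivative_symmetric_real[of S "\<lambda>p. f p \<bullet> z", OF _ S] g
      unfolding d2[symmetric] smooth_on_def by blast
  qed
  then have "(D (\<lambda>p. D f p u) q v - D (\<lambda>p. D f p v) q u) \<bullet> z = 0" for z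
    by (simp add: inner_diff_left)
  then show ?thesis
    by (metis eq_iff_diff_eq_0 inner_eq_zero_iff)
qed

section \<open>Rates of change along a vector field\<close>

text \<open>Full differentiability is bundled with the derivative in one direction, so that the rate
  of a compound expression is assembled by resolution with the rules below and simplified only at
  the end.\<close>

definition has_rate :: "('c::real_normed_vector \<Rightarrow> 'b::real_normed_vector) \<Rightarrow> 'c \<Rightarrow> 'c \<Rightarrow> 'b \<Rightarrow> bool" where
  "has_rate f q s r \<longleftrightarrow> (\<exists>f'. (f has_derivative f') (at q) \<and> f' s = r)"

lemma has_rate_const: "has_rate (\<lambda>q. c) q s 0"
  unfolding has_rate_def by (rule exI[of _ "\<lambda>_. 0"]) simp

lemma has_rate_add: "has_rate f q s a \<Longrightarrow> has_rate g q s b \<Longrightarrow> has_rate (\<lambda>q. f q + g q) q s (a + b)"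
  unfolding has_rate_def by (elim exE conjE, rule exI, rule conjI, erule (1) has_derivative_add) simp

lemma has_rate_diff: "has_rate f q s a \<Longrightarrow> has_rate g q s b \<Longrightarrow> has_rate (\<lambda>q. f q - g q) q s (a - b)"
  unfolding has_rate_def by (elim exE conjE, rule exI, rule conjI, erule (1) has_derivative_diff) simp

lemma has_rate_mult:
  fixes f g :: "'c::real_normed_vector \<Rightarrow> real"
  assumes "has_rate f q s a" "has_rate g q s b"
  shows "has_rate (\<lambda>q. f q * g q) q s (a * g q + f q * b)"
proof -
  obtain f' g' where "(f has_derivative f') (at q)" "f' s = a" "(g has_derivative g') (at q)" "g' s = b"
    using assms unfolding has_rate_def by blast
  then show ?thesis
    unfolding has_rate_def
    by (intro exI[of _ "\<lambda>h. f q * g' h + f' h * g q"] conjI has_derivative_mult) simp_all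
qed

lemma has_rate_chain:
  fixes f :: "'c::real_normed_vector \<Rightarrow> real"
  assumes "has_rate f q s a" "(g has_real_derivative g') (at (f q))"
  shows "has_rate (\<lambda>q. g (f q)) q s (g' * a)"
proof -
  obtain f' where f: "(f has_derivative f') (at q)" "f' s = a"
    using assms unfolding has_rate_def by blast
  have "((\<lambda>q. g (f q)) has_derivative (\<lambda>h. g' * f' h)) (at q)"
    using has_derivative_compose[OF f(1), of g "(*) g'"] assms(2)
    by (simp add: has_field_derivative_def)
  with f show ?thesis
    unfolding has_rate_def by blast
qed

lemma has_rate_eq_rhs: "has_rate f q s a \<Longrightarrow> a = b \<Longrightarrow> has_rate f q s b"
  by simp

text \<open>This is how relations are differentiated: an expression that is constant on an open set
  has rate 0, whatever form the rules gave to that rate.\<close>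

lemma has_rate_unique_0:
  assumes "has_rate f q s a" "open S" "q \<in> S" "\<And>q. q \<in> S \<Longrightarrow> f q = c"
  shows "a = 0"
proof -
  obtain f' where f: "(f has_derivative f') (at q)" "f' s = a"
    using assms unfolding has_rate_def by blast
  have "((\<lambda>q. c) has_derivative f') (at q)"
    by (rule has_derivative_transform_within_open[OF f(1) assms(2,3) assms(4)])
  then have "f' = (\<lambda>_. 0)"
    by (rule has_derivative_unique[OF _ has_derivative_const])
  with f show ?thesis by simp
qed

lemma has_rate_continuous: "has_rate f q s a \<Longrightarrow> isCont f q"
  unfolding has_rate_def by (elim exE conjE) (rule has_derivative_continuous)

lemma has_rate_divide:
  fixes f f' :: "'c::real_normed_vector \<Rightarrow> real"
  assumes "has_rate f q s b" "has_rate f' q s b'" "f' q \<noteq> 0"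
  shows "has_rate (\<lambda>q. f q / f' q) q s ((b * f' q - f q * b') / (f' q * f' q))"
proof -
  have "has_rate (\<lambda>q. inverse (f' q)) q s (- (inverse (f' q) ^ Suc (Suc 0)) * b')"
    by (rule has_rate_chain[OF assms(2) DERIV_inverse[OF assms(3)]])
  from has_rate_mult[OF assms(1) this] show ?thesis
    unfolding divide_inverse[of "f _"] by (rule has_rate_eq_rhs) (use assms(3) in \<open>simp add: field_simps\<close>)
qed

lemma has_rate_D: "f differentiable at q \<Longrightarrow> has_rate f q u (D f q u)"
  unfolding has_rate_def using D_works by blast

lemma has_rate_smooth: "smooth_on S f \<Longrightarrow> q \<in> S \<Longrightarrow> has_rate f q u (D f q u)"
  by (intro has_rate_D smooth_on_differentiable)

lemma D_has_rate: "has_rate f q u r \<Longrightarrow> D f q u = r"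
  unfolding has_rate_def using D_eqI by blast

lemma has_rate_minus: "has_rate f q u r \<Longrightarrow> has_rate (\<lambda>p. - f p) q u (- r)"
  unfolding has_rate_def by (elim exE conjE, rule exI, rule conjI, erule has_derivative_minus) simp

lemma has_rate_scaleR:
  assumes "has_rate f q s a" "has_rate g q s b"
  shows "has_rate (\<lambda>q. f q *\<^sub>R g q) q s (a *\<^sub>R g q + f q *\<^sub>R b)"
proof -
  obtain f' g' where "(f has_derivative f') (at q)" "f' s = a" "(g has_derivative g') (at q)" "g' s = b"
    using assms unfolding has_rate_def by auto
  then show ?thesis
    unfolding has_rate_def
    by (intro exI[of _ "\<lambda>h. f q *\<^sub>R g' h + f' h *\<^sub>R g q"] conjI has_derivative_scaleR) simp_all
qed

lemma has_rate_inner: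
  assumes "has_rate f q s a" "has_rate g q s b"
  shows "has_rate (\<lambda>q. f q \<bullet> g q) q s (a \<bullet> g q + f q \<bullet> b)"
proof -
  obtain f' g' where "(f has_derivative f') (at q)" "f' s = a" "(g has_derivative g') (at q)" "g' s = b"
    using assms unfolding has_rate_def by auto
  then show ?thesis
    unfolding has_rate_def
    by (intro exI[of _ "\<lambda>h. f q \<bullet> g' h + f' h \<bullet> g q"] conjI has_derivative_inner) simp_all
qed

lemma has_rate_unique:
  assumes f: "has_rate f q s a" and g: "has_rate g q s b"
    and S: "open S" "q \<in> S" and eq: "\<And>q. q \<in> S \<Longrightarrow> f q = g q"
  shows "a = b"
  using has_rate_unique_0[OF has_rate_diff[OF f g] S, of 0] eq by simp

lemma has_rate_differentiable: "has_rate f q s a \<Longrightarrow> f differentiable at q"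
  unfolding has_rate_def differentiable_def by blast

section \<open>Elimination\<close>

text \<open>This is r2^2 times the resultant in x of g3 x^3 + g2 x^2 + g1 x + g0 and r2 x^2 + r1 x +
  r0; \<open>a2\<close>, \<open>a1\<close>, \<open>a0\<close> and \<open>l1\<close>,
  \<open>l0\<close> are successive pseudo-remainders, which avoid dividing by leading coefficients
  that may vanish. Over a commutative ring the same expression serves for polynomials and for their
  values.\<close>

definition cubic_quad_res :: "'a::comm_ring_1 \<Rightarrow> 'a \<Rightarrow> 'a \<Rightarrow> 'a \<Rightarrow> 'a \<Rightarrow> 'a \<Rightarrow> 'a \<Rightarrow> 'a" where
  "cubic_quad_res g3 g2 g1 g0 r2 r1 r0 =
    (let a2 = r2*g2 - g3*r1; a1 = r2*g1 - g3*r0; a0 = r2*g0;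
         l1 = r2*a1 - a2*r1; l0 = r2*a0 - a2*r0
     in r2*l0^2 - r1*l0*l1 + r0*l1^2)"

lemma cubic_quad_res_eq_0:
  assumes G: "g3*x^3 + g2*x^2 + g1*x + g0 = 0" and R: "r2*x^2 + r1*x + r0 = 0"
  shows "cubic_quad_res g3 g2 g1 g0 r2 r1 r0 = 0"
proof -
  define a2 a1 a0 where "a2 = r2*g2 - g3*r1" and "a1 = r2*g1 - g3*r0" and "a0 = r2*g0"
  define l1 l0 where "l1 = r2*a1 - a2*r1" and "l0 = r2*a0 - a2*r0"
  have A: "a2*x^2 + a1*x + a0 = 0"
  proof -
    have "a2*x^2 + a1*x + a0 = r2*(g3*x^3 + g2*x^2 + g1*x + g0) - g3*x*(r2*x^2 + r1*x + r0)"
      unfolding a2_def a1_def a0_def by (simp add: algebra_simps power2_eq_square power3_eq_cube)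
    then show ?thesis by (simp add: G R)
  qed
  have L: "l1*x + l0 = 0"
  proof -
    have "l1*x + l0 = r2*(a2*x^2 + a1*x + a0) - a2*(r2*x^2 + r1*x + r0)"
      unfolding l1_def l0_def by (simp add: algebra_simps power2_eq_square)
    then show ?thesis by (simp add: A R)
  qed
  have "r2*l0^2 - r1*l0*l1 + r0*l1^2 = 0"
  proof -
    have "r2*l0^2 - r1*l0*l1 + r0*l1^2
        = l1^2*(r2*x^2 + r1*x + r0) + (l1*x + l0)*(r2*(l0 - l1*x) - r1*l1)"
      by (simp add: algebra_simps power2_eq_square)
    then show ?thesis by (simp add: L R)
  qed
  then show ?thesis
    unfolding cubic_quad_res_def a2_def a1_def a0_def l1_def l0_def by (simp add: Let_def)
qed

lemma poly_cubic_quad_res: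
  "poly (cubic_quad_res g3 g2 g1 g0 r2 r1 r0) v =
   cubic_quad_res (poly g3 v) (poly g2 v) (poly g1 v) (poly g0 v) (poly r2 v) (poly r1 v) (poly r0 v)"
  by (simp add: cubic_quad_res_def Let_def)

text \<open>Pseudo-division of the quartic, multiplied by g3^2, by the cubic; the quadratic
  remainder has the degree that \<open>cubic_quad_res\<close> handles.\<close>

lemma quartic_mod_cubic:
  fixes x :: "'a::comm_ring_1"
  assumes "g3*x^3 + g2*x^2 + g1*x + g0 = 0"
    and "h4*x^4 + h3*x^3 + h2*x^2 + h1*x + h0 = 0"
  shows "(g3*(g3*h2 - h4*g1) - (g3*h3 - h4*g2)*g2)*x^2
       + (g3*(g3*h1 - h4*g0) - (g3*h3 - h4*g2)*g1)*x
       + (g3*(g3*h0) - (g3*h3 - h4*g2)*g0) = 0"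
proof -
  have "(g3*(g3*h2 - h4*g1) - (g3*h3 - h4*g2)*g2)*x^2
       + (g3*(g3*h1 - h4*g0) - (g3*h3 - h4*g2)*g1)*x
       + (g3*(g3*h0) - (g3*h3 - h4*g2)*g0)
     = g3*g3*(h4*x^4 + h3*x^3 + h2*x^2 + h1*x + h0)
       - (g3*h4*x + (g3*h3 - h4*g2))*(g3*x^3 + g2*x^2 + g1*x + g0)"
    by (simp add: algebra_simps power2_eq_square power3_eq_cube power4_eq_xxxx)
  then show ?thesis by (simp add: assms)
qed

text \<open>The \<open>g\<^sub>i\<close> and \<open>h\<^sub>i\<close> are the coefficients at \<open>v = 1\<close> of the two polynomials in \<open>x\<close> that occur in the
  proof of \<open>rate_system_inconsistent\<close>; \<open>S\<close> is the cofactor of \<open>m\<^sup>5\<^sup>2 (m - 2)\<^sup>4 (m - 4)\<close> in their resultant, and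
  its expansion at \<open>m = 5\<close> has positive coefficients.\<close>

lemma resultant_at_one:
  fixes m :: real
  assumes "m = 3 \<or> m \<ge> 5"
  defines "g3 \<equiv> -12*m^5 + 24*m^4" and "g2 \<equiv> -110*m^4 + 288*m^3 - 112*m^2"
    and "g1 \<equiv> -316*m^3 + 1024*m^2 - 608*m + 128" and "g0 \<equiv> -288*m^2 + 1056*m - 384"
    and "h4 \<equiv> -48*m^8 + 328*m^7 - 424*m^6"
    and "h3 \<equiv> -616*m^7 + 4304*m^6 - 7120*m^5 + 2496*m^4"
    and "h2 \<equiv> -2904*m^6 + 20280*m^5 - 38560*m^4 + 21696*m^3 - 4352*m^2"
    and "h1 \<equiv> -5840*m^5 + 40448*m^4 - 82944*m^3 + 52736*m^2 - 14848*m + 2048"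
    and "h0 \<equiv> -4224*m^4 + 28800*m^3 - 59904*m^2 + 32256*m - 6144"
  shows "cubic_quad_res g3 g2 g1 g0
      (g3*(g3*h2 - h4*g1) - (g3*h3 - h4*g2)*g2)
      (g3*(g3*h1 - h4*g0) - (g3*h3 - h4*g2)*g1)
      (g3*(g3*h0) - (g3*h3 - h4*g2)*g0) \<noteq> 0"
proof -
  define S where "S =
    ((((((((((((((((((((((((((43200000)*m - 536760000)*m - 14748039000)*m + 299198699575)*m -
    164605039830)*m - 34505158831356)*m + 337792837447986)*m - 1183699121394971)*m -
    1716559721507492)*m + 33150454141408512)*m - 139405281443947296)*m + 252548399130098400)*m
    + 173453039005356288)*m - 2344862998655076864)*m + 7220462853550977024)*m -
    13677030335634487296)*m + 18157912812123881472)*m - 17544551552472416256)*m +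
    12413441957379047424)*m - 6351187385523240960)*m + 2276788292136468480)*m -
    535291286637248512)*m + 68593780223115264)*m - 267538906742784)*m - 1357450385031168)*m +
    190254568964096)*m - 8891656044544"
  have "S \<noteq> 0"
  proof (cases "m = 3")
    case True
    show ?thesis unfolding S_def True by simp
  next
    case False
    then obtain n where n: "m = n + 5" "n \<ge> 0"
      using assms(1) by (metis add.commute diff_add_cancel diff_ge_0_iff_ge)
    have "S = 
    ((((((((((((((((((((((((((43200000)*n + 5079240000)*n + 269156961000)*n + 8543734019575)*n
    + 181813276311295)*n + 2745107444599219)*n + 30340171414802981)*n + 251485990876900254)*n
    + 1652478728748109388)*n + 10342464776490466332)*n + 82132630026337866324)*n +
    782105245441152367770)*n + 6790624235047599549538)*n + 47813380168632936649546)*n +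
    268453803765406492479814)*n + 1210004304576215931078344)*n + 4412574808804494504149292)*n
    + 13073532794460144352672844)*n + 31461382442950121727829404)*n +
    61195234200009330516189975)*n + 95242079918378805445628055)*n +
    116659928149933461981356763)*n + 109619229545442811428710589)*n +
    75937159181772500801365746)*n + 36329180380512016308726672)*n +
    10633563801870662162975616)*n + 1417409567929617785588736" 
      unfolding S_def n by algebra
    also have "\<dots> > 0"
      using n by (intro add_nonneg_pos mult_nonneg_nonneg add_nonneg_nonneg) auto
    finally show ?thesis by simp
  qed
  have "cubic_quad_res g3 g2 g1 g0
      (g3*(g3*h2 - h4*g1) - (g3*h3 - h4*g2)*g2)
      (g3*(g3*h1 - h4*g0) - (g3*h3 - h4*g2)*g1)
      (g3*(g3*h0) - (g3*h3 - h4*g2)*g0) = -66795331387392 * (m-4)*(m-2)^4*m^52*S"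
    unfolding cubic_quad_res_def Let_def unfolding assms(2-) S_def by algebra
  with \<open>S \<noteq> 0\<close> assms(1) show ?thesis
    by auto
qed


lemma has_rate_cubic:
  fixes v x :: "'c::real_normed_vector \<Rightarrow> real"
  assumes v: "has_rate v q s v'" and x: "has_rate x q s x'"
  shows "has_rate (\<lambda>q. poly g3 (v q) * x q ^ 3 + poly g2 (v q) * x q ^ 2 + poly g1 (v q) * x q + poly g0 (v q)) q s
    ((poly (pderiv g3) (v q) * x q ^ 3 + poly (pderiv g2) (v q) * x q ^ 2
        + poly (pderiv g1) (v q) * x q + poly (pderiv g0) (v q)) * v'
      + (3 * poly g3 (v q) * x q ^ 2 + 2 * poly g2 (v q) * x q + poly g1 (v q)) * x')"
    (is "has_rate _ _ _ ?r")
proof -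
  have p: "has_rate (\<lambda>q. poly g (v q)) q s (poly (pderiv g) (v q) * v')" for g
    by (rule has_rate_chain[OF v poly_DERIV])
  have x2: "has_rate (\<lambda>q. x q ^ 2) q s (2 * x q * x')"
    by (rule has_rate_chain[OF x]) (auto intro!: derivative_eq_intros)
  have x3: "has_rate (\<lambda>q. x q ^ 3) q s (3 * x q ^ 2 * x')"
    by (rule has_rate_chain[OF x]) (auto intro!: derivative_eq_intros)
  show ?thesis
    by (rule has_rate_eq_rhs, (rule has_rate_add p x2 x3 x has_rate_mult)+, algebra)
qed

text \<open>The rates of \<open>v\<close> and \<open>x\<close> become polynomial only after
  multiplication by a common denominator \<open>d\<close>. The term of \<open>x'\<close> that is
  quadratic in \<open>x\<close> raises the degree from three to four.\<close>

lemma cubic_derivative_eq_0: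
  fixes v x :: "'c::real_normed_vector \<Rightarrow> real"
  assumes S: "open S" "q \<in> S"
    and zero: "\<And>q. q \<in> S \<Longrightarrow>
      poly g3 (v q) * x q ^ 3 + poly g2 (v q) * x q ^ 2 + poly g1 (v q) * x q + poly g0 (v q) = 0"
    and v: "has_rate v q s v'" and x: "has_rate x q s x'"
    and v': "d * v' = poly V0 (v q) + poly V1 (v q) * x q"
    and x': "d * x' = poly X0 (v q) + poly X1 (v q) * x q + poly X2 (v q) * x q ^ 2"
  shows "poly (pderiv g3 * V1 + 3 * g3 * X2) (v q) * x q ^ 4
    + poly (pderiv g3 * V0 + pderiv g2 * V1 + 3 * g3 * X1 + 2 * g2 * X2) (v q) * x q ^ 3
    + poly (pderiv g2 * V0 + pderiv g1 * V1 + 3 * g3 * X0 + 2 * g2 * X1 + g1 * X2) (v q) * x q ^ 2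
    + poly (pderiv g1 * V0 + pderiv g0 * V1 + 2 * g2 * X0 + g1 * X1) (v q) * x q
    + poly (pderiv g0 * V0 + g1 * X0) (v q) = 0"
proof -
  have "(poly (pderiv g3) (v q) * x q ^ 3 + poly (pderiv g2) (v q) * x q ^ 2
        + poly (pderiv g1) (v q) * x q + poly (pderiv g0) (v q)) * v'
      + (3 * poly g3 (v q) * x q ^ 2 + 2 * poly g2 (v q) * x q + poly g1 (v q)) * x' = 0" (is "?A * v' + ?B * x' = 0")
    using has_rate_unique_0[OF has_rate_cubic[OF v x] S zero] by blast
  then have "?A * (d * v') + ?B * (d * x') = 0"
    by algebra
  moreover have "poly (pderiv g3 * V1 + 3 * g3 * X2) (v q) * x q ^ 4
    + poly (pderiv g3 * V0 + pderiv g2 * V1 + 3 * g3 * X1 + 2 * g2 * X2) (v q) * x q ^ 3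
    + poly (pderiv g2 * V0 + pderiv g1 * V1 + 3 * g3 * X0 + 2 * g2 * X1 + g1 * X2) (v q) * x q ^ 2
    + poly (pderiv g1 * V0 + pderiv g0 * V1 + 2 * g2 * X0 + g1 * X1) (v q) * x q
    + poly (pderiv g0 * V0 + g1 * X0) (v q) = ?A * (d * v') + ?B * (d * x')"
    unfolding v' x' poly_add poly_mult poly_numeral by algebra
  ultimately show ?thesis by simp
qed

text \<open>The unknowns are \<open>v = (\<mu>/h)\<^sup>2\<close>, \<open>x = \<mu>\<kappa>/(ha)\<close>, \<open>b = (h/a)\<^sup>2\<close> and \<open>l = \<lambda>/a\<^sup>2\<close>, differentiated
  along \<open>(\<mu>/(ha)) w\<close>. Differentiating the constraint expresses \<open>b\<close> through \<open>v\<close> and \<open>x\<close>; the next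
  two derivatives give two polynomial equations in \<open>v\<close> and \<open>x\<close>, whose resultant forces \<open>v\<close> to be locally
  constant. For \<open>m = 4\<close> the two polynomials have the common factor \<open>2x + 1 + v\<close>, which vanishes only
  where \<open>b = 0\<close>.\<close>

lemma rate_system_inconsistent:
  fixes v x b l :: "'c::real_normed_vector \<Rightarrow> real" and s :: "'c \<Rightarrow> 'c" and S :: "'c set" and n :: nat and m :: real
  assumes n: "n \<ge> 3" and S: "open S" "S \<noteq> {}" and m: "m = real n"
    and v: "\<And>q. q \<in> S \<Longrightarrow> has_rate v q (s q) (- 2 * v q * (1 + v q + m * x q))"
    and x: "\<And>q. q \<in> S \<Longrightarrow>
      has_rate x q (s q) (- x q + v q * x q - 2 * (x q)^2 - v q * b q * (1 - (m - 1) * v q))"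
    and b: "\<And>q. q \<in> S \<Longrightarrow> has_rate b q (s q) (b q * (2 * (m - 1) * x q + 6 * v q))"
    and l: "\<And>q. q \<in> S \<Longrightarrow> has_rate l q (s q) (l q * (2 * (m - 1) * x q + 4 * v q))"
    and E: "\<And>q. q \<in> S \<Longrightarrow> 2 + 2 * v q + m * x q + m * b q + l q = 0"
    and pos: "\<And>q. q \<in> S \<Longrightarrow> v q > 0" "\<And>q. q \<in> S \<Longrightarrow> b q > 0"
  shows False
proof -
  have m3: "m \<ge> 3" unfolding m using n by simp
  have den: "1 + (m - 1) * v q > 0" if "q \<in> S" for q
  proof -
    have "(m - 1) * v q \<ge> 0"
      by (rule mult_nonneg_nonneg) (use pos(1)[OF that] m3 in linarith)+
    then show ?thesis by linarith
  qed
  define Q where "Q = (\<lambda>q. 12* v q + 12* v q^2 + ((11*m-4)* v q + (5*m-4))*x q + 2*m^2*x q^2)"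
  have P: "m * v q * (1 + (m - 1) * v q) * b q = Q q" if q: "q \<in> S" for q
  proof -
    have "has_rate (\<lambda>q. 2 + 2 * v q + m * x q + m * b q + l q) q (s q)
      (0 + (0 * v q + 2 * (- 2 * v q * (1 + v q + m * x q)))
         + (0 * x q + m * (- x q + v q * x q - 2 * (x q)^2 - v q * b q * (1 - (m - 1) * v q)))
         + (0 * b q + m * (b q * (2 * (m - 1) * x q + 6 * v q)))
         + l q * (2 * (m - 1) * x q + 4 * v q))" (is "has_rate _ _ _ ?r")
      by (rule has_rate_eq_rhs, (rule has_rate_add has_rate_mult has_rate_const v[OF q] x[OF q] b[OF q] l[OF q])+, simp)
    from has_rate_unique_0[OF this S(1) q E] have "?r = 0" .
    \<comment> \<open>The multiplier is the logarithmic rate of \<open>l\<close>, so subtracting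
      this multiple of the constraint removes \<open>l\<close>; what remains is linear in
      \<open>b\<close>.\<close>
    then have "?r - (2 * (m - 1) * x q + 4 * v q) * (2 + 2 * v q + m * x q + m * b q + l q) = 0"
      using E[OF q] by simp
    moreover have "?r - (2 * (m - 1) * x q + 4 * v q) * (2 + 2 * v q + m * x q + m * b q + l q)
      = m * v q * (1 + (m - 1) * v q) * b q - Q q"
      unfolding Q_def by (simp add: algebra_simps power2_eq_square)
    ultimately show ?thesis by simp
  qed
  define g0 where "g0 = [:0, 60*m - 48, - 84*m^2 + 420*m - 144, - 144*m^2 + 468*m - 144, - 60*m^2 + 108*m - 48:]"
  define g1 where "g1 = [:20*m^2 - 36*m + 16, - 40*m^3 + 300*m^2 - 236*m + 48, - 164*m^3 + 540*m^2 - 268*m + 48, - 112*m^3 + 164*m^2 - 68*m + 16:]"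
  define g2 where "g2 = [:30*m^3 - 24*m^2, - 44*m^4 + 168*m^3 - 64*m^2, - 66*m^4 + 90*m^3 - 24*m^2:]"
  define g3 where "g3 = [:8*m^4 + 4*m^3, - 12*m^5 + 16*m^4 - 4*m^3:]"
  have G: "poly g3 (v q) * x q ^ 3 + poly g2 (v q) * x q ^ 2 + poly g1 (v q) * x q + poly g0 (v q) = 0"
    if q: "q \<in> S" for q
  proof -
    let ?v' = "- 2 * v q * (1 + v q + m * x q)"
    let ?x' = "- x q + v q * x q - 2 * (x q)^2 - v q * b q * (1 - (m - 1) * v q)"
    let ?b' = "b q * (2 * (m - 1) * x q + 6 * v q)"
    have v2: "has_rate (\<lambda>q. v q ^ 2) q (s q) (2 * v q * ?v')"
      by (rule has_rate_chain[OF v[OF q]]) (auto intro!: derivative_eq_intros)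
    have x2: "has_rate (\<lambda>q. x q ^ 2) q (s q) (2 * x q * ?x')"
      by (rule has_rate_chain[OF x[OF q]]) (auto intro!: derivative_eq_intros)
    have "has_rate (\<lambda>q. m * v q * (1 + (m - 1) * v q) * b q - Q q) q (s q)
      (((0 * v q + m * ?v') * (1 + (m - 1) * v q) + (m * v q) * (0 + (0 * v q + (m - 1) * ?v'))) * b q
         + (m * v q * (1 + (m - 1) * v q)) * ?b'
       - ((0 * v q + 12 * ?v') + (0 * v q ^ 2 + 12 * (2 * v q * ?v'))
         + (((0 * v q + (11*m-4) * ?v') + 0) * x q + ((11*m-4) * v q + (5*m-4)) * ?x')
         + (0 * x q ^ 2 + (2*m^2) * (2 * x q * ?x'))))" (is "has_rate _ _ _ ?D")
      unfolding Q_def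
      by (rule has_rate_eq_rhs, (rule has_rate_add has_rate_diff v2 x2 has_rate_mult has_rate_const v[OF q] x[OF q] b[OF q])+, simp)
    from has_rate_unique_0[OF this S(1) q, of 0] P have D: "?D = 0" by simp
    \<comment> \<open>\<open>?C\<close> is the coefficient of \<open>v q * b q\<close> in
      \<open>?D\<close>, so the combination below cancels \<open>b\<close> and leaves a cubic in
      \<open>x\<close> whose coefficients, polynomials in \<open>v\<close>, are \<open>g0\<close> to
      \<open>g3\<close>.\<close>
    let ?C = "m * (- 2 * (1 + v q + m * x q) * (1 + 2 * (m - 1) * v q)
        + (1 + (m - 1) * v q) * (2 * (m - 1) * x q + 6 * v q))
      + ((11*m-4) * v q + (5*m-4) + 4 * m^2 * x q) * (1 - (m - 1) * v q)"
    have "poly g3 (v q) * x q ^ 3 + poly g2 (v q) * x q ^ 2 + poly g1 (v q) * x q + poly g0 (v q)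
      = m * (1 + (m - 1) * v q) * ?D - ?C * (m * v q * (1 + (m - 1) * v q) * b q - Q q)"
      unfolding g0_def g1_def g2_def g3_def Q_def poly_pCons poly_0 by algebra
    then show ?thesis
      unfolding D P[OF q] by simp
  qed
  \<comment> \<open>After \<open>b\<close> is replaced by means of \<open>P\<close>, the rates of
    \<open>v\<close> and \<open>x\<close> multiplied by m (1 + (m - 1) v) are V0 + V1 x and X0 + X1
    x + X2 x^2.\<close>
  define V0 where "V0 = [:0, -2*m:] * [:1, 1:] * [:1, m - 1:]"
  define V1 where "V1 = [:0, -2*m^2:] * [:1, m - 1:]"
  define X0 where "X0 = - ([:0, 12, 12:] * [:1, -(m - 1):])"
  define X1 where "X1 = [:-m, m:] * [:1, m - 1:] - [:5*m - 4, 11*m - 4:] * [:1, -(m - 1):]"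
  define X2 where "X2 = [:-2*m:] * [:1, m - 1:] - [:2*m^2:] * [:1, -(m - 1):]"
  have vV: "m * (1 + (m - 1) * v q) * (- 2 * v q * (1 + v q + m * x q)) = poly V0 (v q) + poly V1 (v q) * x q" for q
    unfolding V0_def V1_def by (simp add: algebra_simps power2_eq_square)
  have xX: "m * (1 + (m - 1) * v q) * (- x q + v q * x q - 2 * (x q)^2 - v q * b q * (1 - (m - 1) * v q))
      = poly X0 (v q) + poly X1 (v q) * x q + poly X2 (v q) * x q ^ 2" if q: "q \<in> S" for q
  proof -
    have "m * (1 + (m - 1) * v q) * (- x q + v q * x q - 2 * (x q)^2 - v q * b q * (1 - (m - 1) * v q))
      = m * (1 + (m - 1) * v q) * (- x q + v q * x q - 2 * (x q)^2)
       - (m * v q * (1 + (m - 1) * v q) * b q) * (1 - (m - 1) * v q)"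
      by algebra
    then show ?thesis
      unfolding P[OF q] Q_def X0_def X1_def X2_def by (simp add: algebra_simps power2_eq_square)
  qed
  \<comment> \<open>\<open>R\<close> results from eliminating \<open>x\<close>. It is not the zero
    polynomial because its value at 1 is nonzero, in both cases.\<close>
  obtain R where R: "R \<noteq> 0" "\<And>q. q \<in> S \<Longrightarrow> poly R (v q) = 0"
  proof (cases "n = 4")
    case True
    then have m4: "m = 4" using m by simp
    \<comment> \<open>These are the coefficients of the cubic divided by 192 (2x + 1 + v). The
      quotient is quadratic in \<open>x\<close> and its derivative is cubic, so the two can be
      paired directly.\<close>
    define k2 where "k2 = [:6, -22::real:]"
    define k1 where "k1 = [:1, 4, -19::real:]"
    define k0 where "k0 = [:0, 1, 0, -3::real:]"
    have K: "poly 0 (v q) * x q ^ 3 + poly k2 (v q) * x q ^ 2 + poly k1 (v q) * x q + poly k0 (v q) = 0"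
      if q: "q \<in> S" for q
    proof -
      have "192 * (2 * x q + 1 + v q) * (poly k2 (v q) * x q ^ 2 + poly k1 (v q) * x q + poly k0 (v q)) = 0"
      proof -
        have "192 * (2 * x q + 1 + v q) * (poly k2 (v q) * x q ^ 2 + poly k1 (v q) * x q + poly k0 (v q))
          = poly g3 (v q) * x q ^ 3 + poly g2 (v q) * x q ^ 2 + poly g1 (v q) * x q + poly g0 (v q)"
          unfolding k0_def k1_def k2_def g0_def g1_def g2_def g3_def m4 poly_pCons poly_0 by algebra
        then show ?thesis using G[OF q] by simp
      qed
      moreover have "2 * x q + 1 + v q \<noteq> 0"
      proof
        assume "2 * x q + 1 + v q = 0"
        moreover have "Q q = (2 * x q + 1 + v q) * (16 * x q + 12 * v q)"
          unfolding Q_def m4 by (simp add: algebra_simps power2_eq_square)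
        ultimately have "Q q = 0" by simp
        then show False
          using P[OF q] pos[OF q] den[OF q] m3 by auto
      qed
      ultimately show ?thesis by auto
    qed
    define h3 where "h3 = pderiv k2 * V1 + 2 * k2 * X2"
    define h2 where "h2 = pderiv k2 * V0 + pderiv k1 * V1 + 2 * k2 * X1 + k1 * X2"
    define h1 where "h1 = pderiv k1 * V0 + pderiv k0 * V1 + 2 * k2 * X0 + k1 * X1"
    define h0 where "h0 = pderiv k0 * V0 + k1 * X0"
    show thesis
    proof (rule that)
      fix q assume q: "q \<in> S"
      have "poly h3 (v q) * x q ^ 3 + poly h2 (v q) * x q ^ 2 + poly h1 (v q) * x q + poly h0 (v q) = 0"
        using cubic_derivative_eq_0[OF S(1) q K v[OF q] x[OF q] vV xX[OF q]]
        unfolding h3_def h2_def h1_def h0_def by simp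
      then have "cubic_quad_res (poly h3 (v q)) (poly h2 (v q)) (poly h1 (v q)) (poly h0 (v q))
          (poly k2 (v q)) (poly k1 (v q)) (poly k0 (v q)) = 0"
        by (rule cubic_quad_res_eq_0) (use K[OF q] in simp)
      then show "poly (cubic_quad_res h3 h2 h1 h0 k2 k1 k0) (v q) = 0"
        unfolding poly_cubic_quad_res .
    next
      have "poly (cubic_quad_res h3 h2 h1 h0 k2 k1 k0) 1 \<noteq> 0"
        unfolding poly_cubic_quad_res h3_def h2_def h1_def h0_def V0_def V1_def X0_def X1_def X2_def
          k0_def k1_def k2_def cubic_quad_res_def Let_def m4
        by (simp add: pderiv_pCons)
      then show "cubic_quad_res h3 h2 h1 h0 k2 k1 k0 \<noteq> 0"
        by auto
    qed
  next
    case False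
    define h4 where "h4 = pderiv g3 * V1 + 3 * g3 * X2"
    define h3 where "h3 = pderiv g3 * V0 + pderiv g2 * V1 + 3 * g3 * X1 + 2 * g2 * X2"
    define h2 where "h2 = pderiv g2 * V0 + pderiv g1 * V1 + 3 * g3 * X0 + 2 * g2 * X1 + g1 * X2"
    define h1 where "h1 = pderiv g1 * V0 + pderiv g0 * V1 + 2 * g2 * X0 + g1 * X1"
    define h0 where "h0 = pderiv g0 * V0 + g1 * X0"
    define r2 where "r2 = g3*(g3*h2 - h4*g1) - (g3*h3 - h4*g2)*g2"
    define r1 where "r1 = g3*(g3*h1 - h4*g0) - (g3*h3 - h4*g2)*g1"
    define r0 where "r0 = g3*(g3*h0) - (g3*h3 - h4*g2)*g0"
    show thesis
    proof (rule that)
      fix q assume q: "q \<in> S"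
      have H: "poly h4 (v q) * x q ^ 4 + poly h3 (v q) * x q ^ 3 + poly h2 (v q) * x q ^ 2 + poly h1 (v q) * x q + poly h0 (v q) = 0"
        using cubic_derivative_eq_0[OF S(1) q G v[OF q] x[OF q] vV xX[OF q]]
        unfolding h4_def h3_def h2_def h1_def h0_def .
      have "poly r2 (v q) * x q ^ 2 + poly r1 (v q) * x q + poly r0 (v q) = 0"
        using quartic_mod_cubic[OF G[OF q] H] unfolding r2_def r1_def r0_def by simp
      with G[OF q] have "cubic_quad_res (poly g3 (v q)) (poly g2 (v q)) (poly g1 (v q)) (poly g0 (v q))
          (poly r2 (v q)) (poly r1 (v q)) (poly r0 (v q)) = 0"
        by (rule cubic_quad_res_eq_0)
      then show "poly (cubic_quad_res g3 g2 g1 g0 r2 r1 r0) (v q) = 0"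
        unfolding poly_cubic_quad_res .
    next
      have m': "m = 3 \<or> m \<ge> 5"
        using n False m by auto
      have g: "poly g3 1 = -12*m^5 + 24*m^4" "poly g2 1 = -110*m^4 + 288*m^3 - 112*m^2"
        "poly g1 1 = -316*m^3 + 1024*m^2 - 608*m + 128" "poly g0 1 = -288*m^2 + 1056*m - 384"
        unfolding g0_def g1_def g2_def g3_def by simp_all
      have d: "poly (pderiv g3) 1 = - 12*m^5 + 16*m^4 - 4*m^3"
        "poly (pderiv g2) 1 = - 176*m^4 + 348*m^3 - 112*m^2"
        "poly (pderiv g1) 1 = - 704*m^3 + 1872*m^2 - 976*m + 192"
        "poly (pderiv g0) 1 = - 840*m^2 + 2736*m - 960"
        unfolding g0_def g1_def g2_def g3_def by (simp_all add: pderiv_pCons algebra_simps)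
      have X: "poly V0 1 = - 4 * m^2" "poly V1 1 = - 2 * m^3" "poly X0 1 = - 24 * (2 - m)"
        "poly X1 1 = - (16 * m - 8) * (2 - m)" "poly X2 1 = - 2 * m^2 - 2 * m^2 * (2 - m)"
        unfolding V0_def V1_def X0_def X1_def X2_def by (simp_all add: algebra_simps power2_eq_square power3_eq_cube)
      have h: "poly h4 1 = -48*m^8 + 328*m^7 - 424*m^6"
        "poly h3 1 = -616*m^7 + 4304*m^6 - 7120*m^5 + 2496*m^4"
        "poly h2 1 = -2904*m^6 + 20280*m^5 - 38560*m^4 + 21696*m^3 - 4352*m^2"
        "poly h1 1 = -5840*m^5 + 40448*m^4 - 82944*m^3 + 52736*m^2 - 14848*m + 2048"
        "poly h0 1 = -4224*m^4 + 28800*m^3 - 59904*m^2 + 32256*m - 6144"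
        unfolding h4_def h3_def h2_def h1_def h0_def poly_add poly_mult poly_numeral g d X by algebra+
      have "poly (cubic_quad_res g3 g2 g1 g0 r2 r1 r0) 1 \<noteq> 0"
        unfolding poly_cubic_quad_res r2_def r1_def r0_def poly_diff poly_mult g h
        using resultant_at_one[OF m'] .
      then show "cubic_quad_res g3 g2 g1 g0 r2 r1 r0 \<noteq> 0"
        by auto
    qed
  qed
  obtain q0 where q0: "q0 \<in> S" using S by blast
  have cont: "continuous_on S v"
    using has_rate_continuous[OF v] by (simp add: continuous_at_imp_continuous_on)
  obtain e where e: "e > 0" "ball q0 e \<subseteq> S"
    using S q0 openE by blast
  have "v constant_on ball q0 e"
  proof (rule continuous_finite_range_constant)
    show "continuous_on (ball q0 e) v" using cont e continuous_on_subset by blast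
    have "v ` ball q0 e \<subseteq> {t. poly R t = 0}" using R e by auto
    then show "finite (v ` ball q0 e)"
      using poly_roots_finite[OF R(1)] finite_subset by blast
  qed auto
  then obtain v0 where v0: "\<And>q. q \<in> ball q0 e \<Longrightarrow> v q = v0"
    unfolding constant_on_def by blast
  \<comment> \<open>Once \<open>v\<close> is constant its rate gives 1 + v + m x = 0, and
    \<open>x\<close>, \<open>b\<close> and \<open>l\<close> are constant in turn. The rates of
    \<open>b\<close> and \<open>l\<close> have different factors, which forces l = 0; the constraint
    then reads 1 + v + m b = 0 with positive summands.\<close>
  have 1: "1 + v0 + m * x q = 0" if q: "q \<in> ball q0 e" for q
  proof -
    have qS: "q \<in> S" using q e by blast
    show ?thesis
      using has_rate_unique_0[OF v[OF qS] _ q v0] pos(1)[OF qS] v0[OF q] by simp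
  qed
  have x0: "x q = - (1 + v0) / m" if "q \<in> ball q0 e" for q
  proof -
    have "m * x q = - (1 + v0)"
      using 1[OF that] by linarith
    then show ?thesis
      using m3 by (simp add: eq_divide_eq mult.commute)
  qed
  have b0: "b q = b q0" if q: "q \<in> ball q0 e" for q
  proof -
    have qS: "q \<in> S" using q e by blast
    have c: "q0 \<in> ball q0 e" using e by simp
    have "m * v0 * (1 + (m - 1) * v0) * b q = m * v0 * (1 + (m - 1) * v0) * b q0"
      using P[OF qS] P[OF q0] v0[OF q] v0[OF c] x0[OF q] x0[OF c] unfolding Q_def by simp
    moreover have "m * v0 * (1 + (m - 1) * v0) > 0"
      using pos(1)[OF q0] den[OF q0] v0[OF c] m3 by simp
    ultimately show ?thesis by (auto simp: less_le)
  qed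
  have c: "q0 \<in> ball q0 e" using e by simp
  have l0: "l q = l q0" if q: "q \<in> ball q0 e" for q
  proof -
    have qS: "q \<in> S" using q e by blast
    show ?thesis
      using E[OF qS] E[OF q0] v0[OF q] v0[OF c] x0[OF q] x0[OF c] b0[OF q] by simp
  qed
  have "b q0 * (2 * (m - 1) * x q0 + 6 * v q0) = 0"
    using has_rate_unique_0[OF b[OF q0] _ c b0] by simp
  then have "2 * (m - 1) * x q0 + 6 * v q0 = 0"
    using pos(2)[OF q0] by simp
  moreover have "l q0 * (2 * (m - 1) * x q0 + 4 * v q0) = 0"
    using has_rate_unique_0[OF l[OF q0] _ c l0] by simp
  ultimately have "l q0 * (- 2 * v q0) = 0"
    by algebra
  then have "l q0 = 0"
    using pos(1)[OF q0] by simp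
  then have "1 + v q0 + m * b q0 = 0"
    using E[OF q0] 1[OF c] v0[OF c] by simp
  moreover have "m * b q0 > 0"
    using pos(2)[OF q0] m3 by simp
  ultimately show False
    using pos(1)[OF q0] by simp
qed

section \<open>Orthonormal families\<close>

definition orthonormal :: "nat \<Rightarrow> (nat \<Rightarrow> 'v::real_inner) \<Rightarrow> bool" where
  "orthonormal n f \<longleftrightarrow> (\<forall>i\<in>{1..n}. \<forall>j\<in>{1..n}. f i \<bullet> f j = (if i = j then 1 else 0))"

text \<open>The dimension bound makes the \<open>n\<close> independent vectors span
  \<open>V\<close>; the remainder of \<open>y\<close> lies in \<open>V\<close> and is orthogonal to
  itself.\<close>

lemma orthonormal_expansion:
  fixes f :: "nat \<Rightarrow> 'v::euclidean_space"
  assumes f: "orthonormal n f" and V: "subspace V" "dim V \<le> n" "\<And>i. i \<in> {1..n} \<Longrightarrow> f i \<in> V" and y: "y \<in> V"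
  shows "y = (\<Sum>i=1..n. (y \<bullet> f i) *\<^sub>R f i)"
proof -
  have ff: "f i \<bullet> f j = (if i = j then 1 else 0)" if "i \<in> {1..n}" "j \<in> {1..n}" for i j
    using f that unfolding orthonormal_def by blast
  have inj: "inj_on f {1..n}"
  proof (rule inj_onI)
    fix i j assume "i \<in> {1..n}" "j \<in> {1..n}" "f i = f j"
    then show "i = j" using ff[of i i] ff[of i j] by (auto split: if_splits)
  qed
  have "pairwise orthogonal (f ` {1..n})"
    using ff by (auto simp: pairwise_def orthogonal_def split: if_splits)
  moreover have "0 \<notin> f ` {1..n}"
  proof
    assume "0 \<in> f ` {1..n}"
    then obtain i where "i \<in> {1..n}" "f i = 0" by auto
    then show False using ff[of i i] by simp
  qed
  ultimately have ind: "independent (f ` {1..n})"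
    using pairwise_orthogonal_independent by blast
  have sub: "f ` {1..n} \<subseteq> V" using V(3) by blast
  have card: "card (f ` {1..n}) = n" using card_image[OF inj] by simp
  have "V \<subseteq> span (f ` {1..n})"
    using card_ge_dim_independent[OF sub ind] V(2) card by simp
  moreover define r where "r = y - (\<Sum>i=1..n. (y \<bullet> f i) *\<^sub>R f i)"
  have "r \<bullet> f j = 0" if j: "j \<in> {1..n}" for j
  proof -
    have "(\<Sum>i=1..n. (y \<bullet> f i) *\<^sub>R f i) \<bullet> f j = (\<Sum>i=1..n. if i = j then y \<bullet> f i else 0)"
      unfolding inner_sum_left using ff j by (intro sum.cong) auto
    then show ?thesis using j by (simp add: r_def inner_diff_left)
  qed
  then have "orthogonal r x" if "x \<in> span (f ` {1..n})" for x
    using that by (intro orthogonal_to_span[OF that]) (auto simp: orthogonal_def)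
  moreover have "r \<in> V"
    unfolding r_def by (intro subspace_diff subspace_sum subspace_scale V y) auto
  ultimately have "orthogonal r r" by blast
  then have "r = 0" by (simp add: orthogonal_def)
  then show ?thesis by (simp add: r_def)
qed

text \<open>The vectors representing the two functionals span at most a plane, which in dimension at
  least 3 leaves an orthogonal direction. Such vectors are the test vectors for the Codazzi
  equations; taking \<open>f\<close> = \<open>g\<close> gives a nonzero vector in a single
  kernel.\<close>

lemma two_functionals_common_kernel:
  fixes f g :: "'c::euclidean_space \<Rightarrow> real"
  assumes "linear f" "linear g" "DIM('c) \<ge> 3"
  obtains v where "v \<noteq> 0" "f v = 0" "g v = 0"
proof -
  have r: "\<exists>z. \<forall>v. l v = v \<bullet> z" if "linear l" for l :: "'c \<Rightarrow> real"
  proof (intro exI allI)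
    fix v show "l v = v \<bullet> (\<Sum>b\<in>Basis. l b *\<^sub>R b)"
      by (subst linear_expand_Basis[OF that]) (simp add: inner_sum_right mult.commute)
  qed
  obtain x where x: "\<And>v. f v = v \<bullet> x" using r[OF assms(1)] by blast
  obtain y where y: "\<And>v. g v = v \<bullet> y" using r[OF assms(2)] by blast
  have "dim {x, y} \<le> card {x, y}" by (rule dim_le_card') simp
  also have "\<dots> \<le> 2" by (simp add: card_insert_if)
  finally have "dim {x, y} < DIM('c)" using assms(3) by simp
  then obtain v where v: "v \<noteq> 0" "\<And>z. z \<in> span {x, y} \<Longrightarrow> orthogonal v z"
    using orthogonal_to_subspace_exists by blast
  have "orthogonal v x" "orthogonal v y" by (auto intro: v(2) span_base)
  then show thesis using that[OF v(1)] x y by (simp add: orthogonal_def)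
qed

section \<open>Immersions of open sets\<close>

abbreviation D2 :: "('c::real_normed_vector \<Rightarrow> 'b::real_normed_vector) \<Rightarrow> 'c \<Rightarrow> 'c \<Rightarrow> 'c \<Rightarrow> 'b" where
  "D2 f q u v \<equiv> D (\<lambda>p. D f p v) q u"

locale immersed_patch =
  fixes S :: "'c::euclidean_space set" and X :: "'c \<Rightarrow> 'e::euclidean_space"
  assumes open_S: "open S" and smooth_X: "smooth_on S X"
    and inj_DX: "q \<in> S \<Longrightarrow> inj (D X q)"
begin

definition g :: "'c \<Rightarrow> 'c \<Rightarrow> 'c \<Rightarrow> real" where
  "g q u v = D X q u \<bullet> D X q v"

lemma smooth_DX: "smooth_on T V \<Longrightarrow> open T \<Longrightarrow> T \<subseteq> S \<Longrightarrow> smooth_on T (\<lambda>p. D X p (V p))"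
  by (rule smooth_on_D[OF _ smooth_on_subset[OF smooth_X]])

lemma linear_DX: "q \<in> S \<Longrightarrow> linear (D X q)"
  by (intro D_linear smooth_on_differentiable[OF smooth_X])

lemma DX_eq_0: "q \<in> S \<Longrightarrow> D X q u = 0 \<longleftrightarrow> u = 0"
  using linear_injective_0[OF linear_DX] inj_DX linear_0[OF linear_DX] by metis

lemma g_commute: "g q u v = g q v u"
  by (simp add: g_def inner_commute)

lemma g_pos: "q \<in> S \<Longrightarrow> u \<noteq> 0 \<Longrightarrow> g q u u > 0"
  by (simp add: g_def DX_eq_0)

lemma g_left:
  assumes "q \<in> S"
  shows "g q (u + u') v = g q u v + g q u' v" "g q (u - u') v = g q u v - g q u' v"
    "g q (c *\<^sub>R u) v = c * g q u v" "g q (\<Sum>i\<in>I. U i) v = (\<Sum>i\<in>I. g q (U i) v)"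
  using linear_DX[OF assms]
  by (simp_all add: g_def linear_add linear_diff linear_cmul linear_sum inner_left_distrib inner_diff_left inner_sum_left)

lemma g_right:
  assumes "q \<in> S"
  shows "g q v (u + u') = g q v u + g q v u'" "g q v (u - u') = g q v u - g q v u'"
    "g q v (c *\<^sub>R u) = c * g q v u" "g q v (\<Sum>i\<in>I. U i) = (\<Sum>i\<in>I. g q v (U i))"
  unfolding g_commute[of q v] by (rule g_left[OF assms])+

lemma smooth_g: "smooth_on T U \<Longrightarrow> smooth_on T V \<Longrightarrow> open T \<Longrightarrow> T \<subseteq> S \<Longrightarrow> smooth_on T (\<lambda>p. g p (U p) (V p))"
  unfolding g_def by (intro smooth_on_inner smooth_DX)

definition frame_on :: "'c set \<Rightarrow> (nat \<Rightarrow> 'c \<Rightarrow> 'c) \<Rightarrow> bool" where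
  "frame_on T E \<longleftrightarrow> (\<forall>i\<in>{1..DIM('c)}. smooth_on T (E i)) \<and>
     (\<forall>q\<in>T. orthonormal DIM('c) (\<lambda>i. D X q (E i q)))"

text \<open>Gram--Schmidt applied to the constant coordinate fields.\<close>

lemma frame_exists: obtains E where "frame_on S E"
proof -
  obtain b :: "nat \<Rightarrow> 'c" where b: "bij_betw b {1..DIM('c)} Basis"
    using ex_bij_betw_nat_finite_1[OF finite_Basis] by blast
  \<comment> \<open>The span clause keeps the induction going: the next coordinate vector is
    independent of the earlier ones, so its orthogonal remainder \<open>F\<close> is nowhere
    zero.\<close>
  have "\<exists>E. (\<forall>i\<in>{1..k}. smooth_on S (E i)) \<and> (\<forall>q\<in>S. orthonormal k (\<lambda>i. D X q (E i q))) \<and>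
      (\<forall>q\<in>S. \<forall>i\<in>{1..k}. E i q \<in> span (b ` {1..k}))" if "k \<le> DIM('c)" for k
    using that
  proof (induction k)
    case 0
    show ?case by (auto simp: orthonormal_def)
  next
    case (Suc k)
    then obtain E where "(\<forall>i\<in>{1..k}. smooth_on S (E i)) \<and> (\<forall>q\<in>S. orthonormal k (\<lambda>i. D X q (E i q))) \<and>
      (\<forall>q\<in>S. \<forall>i\<in>{1..k}. E i q \<in> span (b ` {1..k}))" using Suc_leD by blast
    then have E: "\<And>i. i \<in> {1..k} \<Longrightarrow> smooth_on S (E i)"
      "\<And>q. q \<in> S \<Longrightarrow> orthonormal k (\<lambda>i. D X q (E i q))"
      "\<And>q i. q \<in> S \<Longrightarrow> i \<in> {1..k} \<Longrightarrow> E i q \<in> span (b ` {1..k})" by blast+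
    have EE: "g q (E i q) (E j q) = (if i = j then 1 else 0)" if "q \<in> S" "i \<in> {1..k}" "j \<in> {1..k}" for q i j
      using E(2)[OF that(1)] that(2,3) unfolding orthonormal_def g_def by blast
    define F where "F = (\<lambda>q. b (Suc k) - (\<Sum>i=1..k. g q (b (Suc k)) (E i q) *\<^sub>R E i q))"
    have sF: "smooth_on S F"
      unfolding F_def
      by (intro smooth_on_diff smooth_on_const smooth_on_sum smooth_on_scaleR smooth_g open_S E subset_refl)
    have notin: "b (Suc k) \<notin> span (b ` {1..k})"
    proof
      assume a: "b (Suc k) \<in> span (b ` {1..k})"
      have "b (Suc k) \<notin> b ` {1..k}"
      proof
        assume "b (Suc k) \<in> b ` {1..k}"
        then obtain i where i: "i \<in> {1..k}" "b (Suc k) = b i" by blast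
        have "Suc k = i"
          by (rule inj_onD[OF bij_betw_imp_inj_on[OF b] i(2)]) (use i Suc.prems in auto)
        then show False using i by simp
      qed
      moreover have "insert (b (Suc k)) (b ` {1..k}) \<subseteq> b ` {1..DIM('c)}"
        using Suc.prems by auto
      then have "insert (b (Suc k)) (b ` {1..k}) \<subseteq> Basis"
        using b by (simp add: bij_betw_def)
      then have "independent (insert (b (Suc k)) (b ` {1..k}))"
        by (rule independent_mono[OF independent_Basis])
      ultimately show False
        using a by (simp add: independent_insert)
    qed
    have F0: "F q \<noteq> 0" if q: "q \<in> S" for q
    proof
      assume "F q = 0"
      then have "b (Suc k) = (\<Sum>i=1..k. g q (b (Suc k)) (E i q) *\<^sub>R E i q)"
        by (simp add: F_def)
      moreover have "\<dots> \<in> span (b ` {1..k})"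
        by (intro span_sum span_scale E(3) q)
      ultimately show False using notin by simp
    qed
    have gF: "g q (F q) (E j q) = 0" if q: "q \<in> S" and j: "j \<in> {1..k}" for q j
    proof -
      have "(\<Sum>i=1..k. g q (b (Suc k)) (E i q) * g q (E i q) (E j q)) = (\<Sum>i=1..k. if i = j then g q (b (Suc k)) (E i q) else 0)"
        using EE[OF q _ j] by (intro sum.cong) auto
      then show ?thesis
        using j by (simp add: F_def g_left[OF q])
    qed
    define E' where "E' = E(Suc k := \<lambda>q. (g q (F q) (F q) powr (-1/2)) *\<^sub>R F q)"
    have eq: "E' i = E i" if "i \<in> {1..k}" for i
      using that by (auto simp: E'_def)
    have s: "smooth_on S (E' i)" if "i \<in> {1..Suc k}" for i
    proof (cases "i = Suc k")
      case True
      have "smooth_on S (\<lambda>q. (g q (F q) (F q) powr (-1/2)) *\<^sub>R F q)"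
        by (intro smooth_on_scaleR smooth_on_powr smooth_g sF open_S subset_refl g_pos F0)
      then show ?thesis by (simp add: E'_def True)
    next
      case False
      then show ?thesis using that E(1) eq by auto
    qed
    have o: "orthonormal (Suc k) (\<lambda>i. D X q (E' i q))" if q: "q \<in> S" for q
    proof -
      define c where "c = g q (F q) (F q)"
      have c: "c > 0" using g_pos[OF q F0[OF q]] by (simp add: c_def)
      have "(c powr (-1/2)) * (c powr (-1/2)) * c = c powr (-1/2 + -1/2) * c"
        by (simp only: powr_add)
      also have "\<dots> = 1" using c by (simp add: powr_minus)
      finally have 1: "g q (E' (Suc k) q) (E' (Suc k) q) = 1"
        by (simp add: E'_def g_left[OF q] g_right[OF q] c_def mult.assoc)
      have 2: "g q (E' (Suc k) q) (E' j q) = 0" if "j \<in> {1..k}" for j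
        using gF[OF q that] eq[OF that] by (simp add: E'_def g_left[OF q])
      have "g q (E' i q) (E' j q) = (if i = j then 1 else 0)" if ij: "i \<in> {1..Suc k}" "j \<in> {1..Suc k}" for i j
      proof (cases "i = Suc k"; cases "j = Suc k")
        assume "i \<noteq> Suc k" "j \<noteq> Suc k"
        then have "i \<in> {1..k}" "j \<in> {1..k}" using ij by auto
        then show ?thesis using EE[OF q] eq by simp
      next
        assume "i \<noteq> Suc k" "j = Suc k"
        then have "i \<in> {1..k}" using ij by auto
        then show ?thesis using 2[of i] g_commute \<open>j = Suc k\<close> by auto
      next
        assume "i = Suc k" "j \<noteq> Suc k"
        then have "j \<in> {1..k}" using ij by auto
        then show ?thesis using 2[of j] \<open>i = Suc k\<close> by auto
      qed (use 1 in auto)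
      then show ?thesis unfolding orthonormal_def g_def by blast
    qed
    have sp: "E' i q \<in> span (b ` {1..Suc k})" if "q \<in> S" "i \<in> {1..Suc k}" for q i
    proof (cases "i = Suc k")
      case True
      have m: "span (b ` {1..k}) \<subseteq> span (b ` {1..Suc k})" by (intro span_mono image_mono) auto
      have "F q \<in> span (b ` {1..Suc k})"
        unfolding F_def using m E(3)[OF that(1)]
        by (intro span_diff span_sum span_scale) (auto intro: span_base)
      then show ?thesis by (simp add: E'_def True span_scale)
    next
      case False
      then have i: "i \<in> {1..k}" using that by auto
      have m: "span (b ` {1..k}) \<subseteq> span (b ` {1..Suc k})" by (intro span_mono image_mono) auto
      show ?thesis using E(3)[OF that(1) i] m eq[OF i] by auto
    qed
    show ?case using s o sp by blast
  qed
  from this[OF order_refl] show thesis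
    using that unfolding frame_on_def by blast
qed

lemma subspace_range_DX: "q \<in> S \<Longrightarrow> subspace (range (D X q))"
  using linear_subspace_image[OF linear_DX subspace_UNIV] .

lemma dim_range_DX: "q \<in> S \<Longrightarrow> dim (range (D X q)) = DIM('c)"
  using dim_image_eq[OF linear_DX, of q UNIV] inj_DX by (simp add: span_UNIV)

lemma tangent_expansion:
  assumes "q \<in> S" "orthonormal DIM('c) (\<lambda>i. D X q (E i))"
  shows "D X q u = (\<Sum>i=1..DIM('c). g q u (E i) *\<^sub>R D X q (E i))"
  unfolding g_def
  by (rule orthonormal_expansion[OF assms(2) subspace_range_DX[OF assms(1)]])
     (simp_all add: dim_range_DX[OF assms(1)])

lemma frame_expansion:
  assumes q: "q \<in> S" and E: "orthonormal DIM('c) (\<lambda>i. D X q (E i))"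
  shows "u = (\<Sum>i=1..DIM('c). g q u (E i) *\<^sub>R E i)"
proof -
  have "D X q u = D X q (\<Sum>i=1..DIM('c). g q u (E i) *\<^sub>R E i)"
    by (subst tangent_expansion[OF assms]) (simp add: linear_sum[OF linear_DX[OF q]] linear_cmul[OF linear_DX[OF q]])
  then show ?thesis using inj_DX[OF q] by (simp add: inj_eq)
qed

lemma normal_remainder:
  assumes q: "q \<in> S" and E: "orthonormal DIM('c) (\<lambda>i. D X q (E i))"
  shows "(z - (\<Sum>i=1..DIM('c). (z \<bullet> D X q (E i)) *\<^sub>R D X q (E i))) \<bullet> D X q u = 0"
proof -
  have "z \<bullet> D X q u = z \<bullet> (\<Sum>i=1..DIM('c). g q u (E i) *\<^sub>R D X q (E i))"
    using tangent_expansion[OF assms, of u] by simp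
  also have "\<dots> = (\<Sum>i=1..DIM('c). (z \<bullet> D X q (E i)) *\<^sub>R D X q (E i)) \<bullet> D X q u"
    by (simp add: inner_sum_right inner_sum_left g_def inner_commute mult.commute)
  finally show ?thesis by (simp add: inner_diff_left)
qed

lemma trace_independent:
  assumes q: "q \<in> S" and E: "orthonormal DIM('c) (\<lambda>i. D X q (E i))" and F: "orthonormal DIM('c) (\<lambda>i. D X q (F i))"
    and b: "\<And>v. linear (\<lambda>u. b u v)" "\<And>u. linear (b u)"
  shows "(\<Sum>i=1..DIM('c). b (E i) (E i)) = (\<Sum>i=1..DIM('c). b (F i) (F i))"
proof -
  define I where "I = {1..DIM('c)}"
  have ex: "b (E i) (E i) = (\<Sum>k\<in>I. \<Sum>l\<in>I. (g q (E i) (F k) * g q (E i) (F l)) *\<^sub>R b (F k) (F l))" for i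
  proof -
    have "b (E i) (E i) = b (\<Sum>k\<in>I. g q (E i) (F k) *\<^sub>R F k) (\<Sum>l\<in>I. g q (E i) (F l) *\<^sub>R F l)"
      using frame_expansion[OF q F, of "E i"] by (simp add: I_def)
    also have "\<dots> = (\<Sum>k\<in>I. g q (E i) (F k) *\<^sub>R (\<Sum>l\<in>I. g q (E i) (F l) *\<^sub>R b (F k) (F l)))"
      by (simp only: linear_sum[OF b(1)] linear_cmul[OF b(1)]) (simp only: linear_sum[OF b(2)] linear_cmul[OF b(2)])
    finally show ?thesis by (simp add: scaleR_sum_right)
  qed
  \<comment> \<open>Orthonormality of \<open>F\<close> expanded in \<open>E\<close>: the transition
    matrix has orthonormal columns, so the double sum collapses to its diagonal.\<close>
  have dual: "(\<Sum>i\<in>I. g q (E i) (F k) * g q (E i) (F l)) = (if k = l then 1 else 0)" if k: "k \<in> I" "l \<in> I" for k l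
  proof -
    have "g q (F k) (F l) = g q (\<Sum>i\<in>I. g q (F k) (E i) *\<^sub>R E i) (F l)"
      using frame_expansion[OF q E, of "F k"] by (simp add: I_def)
    also have "\<dots> = (\<Sum>i\<in>I. g q (E i) (F k) * g q (E i) (F l))"
      by (simp add: g_left[OF q] g_commute[of q "F k"])
    finally show ?thesis using F k unfolding orthonormal_def g_def I_def by auto
  qed
  have "(\<Sum>i\<in>I. b (E i) (E i)) = (\<Sum>k\<in>I. \<Sum>i\<in>I. \<Sum>l\<in>I. (g q (E i) (F k) * g q (E i) (F l)) *\<^sub>R b (F k) (F l))"
    unfolding ex by (rule sum.swap)
  also have "\<dots> = (\<Sum>k\<in>I. \<Sum>l\<in>I. \<Sum>i\<in>I. (g q (E i) (F k) * g q (E i) (F l)) *\<^sub>R b (F k) (F l))"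
    by (intro sum.cong[OF refl] sum.swap)
  also have "\<dots> = (\<Sum>k\<in>I. \<Sum>l\<in>I. if k = l then b (F k) (F l) else 0)"
    unfolding scaleR_sum_left[symmetric] using dual by (intro sum.cong) auto
  finally show ?thesis by (simp add: I_def)
qed

text \<open>An orthonormal tangent frame together with \<open>a\<close> and \<open>b\<close> has as
  many members as the ambient dimension, and the tangent coefficients of \<open>n\<close>
  vanish.\<close>

lemma codimension_two_normal:
  assumes q: "q \<in> S" and dim: "DIM('e) = DIM('c) + 2"
    and ab: "a \<bullet> a = 1" "b \<bullet> b = 1" "a \<bullet> b = 0" "\<And>u. a \<bullet> D X q u = 0" "\<And>u. b \<bullet> D X q u = 0"
    and n: "\<And>u. n \<bullet> D X q u = 0"
  shows "n = (n \<bullet> a) *\<^sub>R a + (n \<bullet> b) *\<^sub>R b"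
proof -
  obtain E where E: "frame_on S E" by (rule frame_exists)
  define m where "m = DIM('c)"
  define f where "f = (\<lambda>i. if i \<le> m then D X q (E i q) else if i = m + 1 then a else b)"
  have EE: "D X q (E i q) \<bullet> D X q (E j q) = (if i = j then 1 else 0)" if "i \<in> {1..m}" "j \<in> {1..m}" for i j
    using E q that unfolding frame_on_def orthonormal_def m_def by blast
  have ba: "D X q u \<bullet> a = 0" "D X q u \<bullet> b = 0" "b \<bullet> a = 0" for u
    using ab by (simp_all add: inner_commute)
  have o: "orthonormal (m + 2) f"
    unfolding orthonormal_def f_def using EE ba ab by auto
  have "n = (\<Sum>i=1..m+2. (n \<bullet> f i) *\<^sub>R f i)"
    by (rule orthonormal_expansion[OF o subspace_UNIV]) (simp_all add: dim m_def)
  also have "\<dots> = (\<Sum>i=1..m. (n \<bullet> f i) *\<^sub>R f i) + (n \<bullet> a) *\<^sub>R a + (n \<bullet> b) *\<^sub>R b"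
    by (simp add: numeral_2_eq_2 f_def)
  also have "(\<Sum>i=1..m. (n \<bullet> f i) *\<^sub>R f i) = 0"
    by (intro sum.neutral ballI) (simp add: f_def n)
  finally show ?thesis by simp
qed

end

section \<open>Pseudo-umbilical patches of codimension two\<close>

text \<open>\<open>\<nu>\<close> is the direction of the mean curvature vector \<open>h \<nu>\<close>, and \<open>\<eta>\<close> completes it to an orthonormal
  frame of the normal bundle. The last assumption is the \<open>\<lambda>\<close>-biminimal equation written in a local
  frame, where \<open>C i\<close> represents the tangential part of the derivative of the \<open>i\<close>-th field along itself.\<close>

definition plane_proj :: "'e::euclidean_space \<Rightarrow> 'e \<Rightarrow> 'e \<Rightarrow> 'e" where
  "plane_proj a b y = (y \<bullet> a) *\<^sub>R a + (y \<bullet> b) *\<^sub>R b"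

locale normal_patch = immersed_patch S X
  for S :: "'c::euclidean_space set" and X :: "'c \<Rightarrow> 'e::euclidean_space" +
  fixes \<nu> \<eta> :: "'c \<Rightarrow> 'e" and h :: "'c \<Rightarrow> real" and lam :: real
  assumes dim_c: "DIM('c) \<ge> 3" and dim_e: "DIM('e) = DIM('c) + 2"
    and smooth_\<nu>: "smooth_on S \<nu>" and smooth_\<eta>: "smooth_on S \<eta>" and smooth_h: "smooth_on S h"
    and \<nu>\<nu>: "q \<in> S \<Longrightarrow> \<nu> q \<bullet> \<nu> q = 1" and \<eta>\<eta>: "q \<in> S \<Longrightarrow> \<eta> q \<bullet> \<eta> q = 1" and \<nu>\<eta>: "q \<in> S \<Longrightarrow> \<nu> q \<bullet> \<eta> q = 0"
    and \<nu>_normal: "q \<in> S \<Longrightarrow> \<nu> q \<bullet> D X q u = 0" and \<eta>_normal: "q \<in> S \<Longrightarrow> \<eta> q \<bullet> D X q u = 0"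
    and h_nonzero: "q \<in> S \<Longrightarrow> h q \<noteq> 0"
    and umbilic: "q \<in> S \<Longrightarrow> \<nu> q \<bullet> D2 X q u v = h q * g q u v"
    and tracefree: "q \<in> S \<Longrightarrow> orthonormal DIM('c) (\<lambda>i. D X q (e i)) \<Longrightarrow>
      (\<Sum>i=1..DIM('c). \<eta> q \<bullet> D2 X q (e i) (e i)) = 0"
    and biminimal_eq: "q \<in> S \<Longrightarrow> \<exists>T E C. open T \<and> q \<in> T \<and> T \<subseteq> S \<and> frame_on T E \<and>
      (\<forall>i\<in>{1..DIM('c)}. \<forall>z. g q (C i) z = D (\<lambda>p. D X p (E i p)) q (E i q) \<bullet> D X q z) \<and>
      (\<Sum>i=1..DIM('c).
          plane_proj (\<nu> q) (\<eta> q) (D (\<lambda>p. plane_proj (\<nu> p) (\<eta> p) (D (\<lambda>p. h p *\<^sub>R \<nu> p) p (E i p))) q (E i q))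
        - plane_proj (\<nu> q) (\<eta> q) (D (\<lambda>p. h p *\<^sub>R \<nu> p) q (C i)))
      = ((real DIM('c) * (h q)\<^sup>2 + lam) * h q) *\<^sub>R \<nu> q"
begin

text \<open>The connection form \<open>\<omega>\<close> of the normal bundle, and the second fundamental form in the direction \<open>\<eta>\<close>.\<close>

definition om :: "'c \<Rightarrow> 'c \<Rightarrow> real" where "om q u = D \<nu> q u \<bullet> \<eta> q"

definition al :: "'c \<Rightarrow> 'c \<Rightarrow> 'c \<Rightarrow> real" where "al q u v = \<eta> q \<bullet> D2 X q u v"

abbreviation nproj :: "'c \<Rightarrow> 'e \<Rightarrow> 'e" where "nproj q \<equiv> plane_proj (\<nu> q) (\<eta> q)"

lemmas nproj_def = plane_proj_def

text \<open>The normal Laplacian of \<open>h \<nu>\<close>, with each inner normal derivative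
  already replaced by its components dh and h om in the frame.\<close>

definition lap :: "'c \<Rightarrow> (nat \<Rightarrow> 'c \<Rightarrow> 'c) \<Rightarrow> (nat \<Rightarrow> 'c) \<Rightarrow> 'e" where
  "lap q E C = (\<Sum>i=1..DIM('c).
      nproj q (D (\<lambda>p. D h p (E i p) *\<^sub>R \<nu> p + (h p * om p (E i p)) *\<^sub>R \<eta> p) q (E i q))
      - (D h q (C i) *\<^sub>R \<nu> q + (h q * om q (C i)) *\<^sub>R \<eta> q))"

lemma vector_eqI:
  assumes q: "q \<in> S" and 1: "\<And>z. y \<bullet> D X q z = y' \<bullet> D X q z" and 2: "y \<bullet> \<nu> q = y' \<bullet> \<nu> q" and 3: "y \<bullet> \<eta> q = y' \<bullet> \<eta> q"
  shows "y = y'"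
proof -
  define r where "r = y - y'"
  have "r = (r \<bullet> \<nu> q) *\<^sub>R \<nu> q + (r \<bullet> \<eta> q) *\<^sub>R \<eta> q"
    by (rule codimension_two_normal[OF q dim_e \<nu>\<nu>[OF q] \<eta>\<eta>[OF q] \<nu>\<eta>[OF q] \<nu>_normal[OF q] \<eta>_normal[OF q]])
       (simp add: r_def inner_diff_left 1)
  also have "\<dots> = 0"
    by (simp add: r_def inner_diff_left 2 3)
  finally show ?thesis by (simp add: r_def)
qed

section \<open>Structure equations of the normal frame\<close>

lemmas rate_\<nu> = has_rate_smooth[OF smooth_\<nu>] and rate_\<eta> = has_rate_smooth[OF smooth_\<eta>]
  and rate_h = has_rate_smooth[OF smooth_h] and rate_DX = has_rate_smooth[OF smooth_on_D_const[OF smooth_X]]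

lemma D2_commute: "q \<in> S \<Longrightarrow> D2 X q u v = D2 X q v u"
  by (rule second_derivative_symmetric[OF smooth_X open_S])

lemma al_commute: "q \<in> S \<Longrightarrow> al q u v = al q v u"
  unfolding al_def using D2_commute by simp

lemma linear_D_smooth: "smooth_on S f \<Longrightarrow> q \<in> S \<Longrightarrow> linear (D f q)"
  by (intro D_linear smooth_on_differentiable)

lemma al_left:
  assumes q: "q \<in> S"
  shows "al q (u + u') v = al q u v + al q u' v" "al q (u - u') v = al q u v - al q u' v"
    "al q (c *\<^sub>R u) v = c * al q u v"
proof -
  have l: "linear (\<lambda>u. D2 X q u v)"
    using linear_D_smooth[OF smooth_on_D_const[OF smooth_X] q] by simp
  show "al q (u + u') v = al q u v + al q u' v" "al q (u - u') v = al q u v - al q u' v"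
    "al q (c *\<^sub>R u) v = c * al q u v"
    unfolding al_def linear_add[OF l] linear_diff[OF l] linear_cmul[OF l]
    by (simp_all add: inner_add_right inner_diff_right)
qed

lemma linear_om: "q \<in> S \<Longrightarrow> linear (om q)"
  unfolding om_def
  by (intro linearI) (simp_all add: linear_add[OF linear_D_smooth[OF smooth_\<nu>]]
      linear_cmul[OF linear_D_smooth[OF smooth_\<nu>]] inner_add_left)

lemma linear_dh: "q \<in> S \<Longrightarrow> linear (D h q)"
  by (rule linear_D_smooth[OF smooth_h])

lemma linear_g: "q \<in> S \<Longrightarrow> linear (g q u)"
  by (intro linearI) (simp_all add: g_right)

text \<open>The relation \<open>\<nu> \<bullet> D X v = 0\<close> is differentiated; the next lemmas
  treat the other orthonormality relations in the same way.\<close>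

lemma D\<nu>_DX: "q \<in> S \<Longrightarrow> D \<nu> q u \<bullet> D X q v = - h q * g q u v"
  using has_rate_unique_0[OF has_rate_inner[OF rate_\<nu> rate_DX] open_S _ \<nu>_normal, of q u v] by (simp add: umbilic)

lemma D\<eta>_DX: "q \<in> S \<Longrightarrow> D \<eta> q u \<bullet> D X q v = - al q u v"
  using has_rate_unique_0[OF has_rate_inner[OF rate_\<eta> rate_DX] open_S _ \<eta>_normal, of q u v]
  by (simp add: al_def)

lemma D\<nu>_\<nu>: "q \<in> S \<Longrightarrow> D \<nu> q u \<bullet> \<nu> q = 0"
  using has_rate_unique_0[OF has_rate_inner[OF rate_\<nu> rate_\<nu>] open_S _ \<nu>\<nu>, of q u] by (simp add: inner_commute)

lemma D\<eta>_\<eta>: "q \<in> S \<Longrightarrow> D \<eta> q u \<bullet> \<eta> q = 0"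
  using has_rate_unique_0[OF has_rate_inner[OF rate_\<eta> rate_\<eta>] open_S _ \<eta>\<eta>, of q u] by (simp add: inner_commute)

lemma D\<eta>_\<nu>: "q \<in> S \<Longrightarrow> D \<eta> q u \<bullet> \<nu> q = - om q u"
  using has_rate_unique_0[OF has_rate_inner[OF rate_\<nu> rate_\<eta>] open_S _ \<nu>\<eta>, of q u]
  by (simp add: inner_commute om_def)

lemma D\<nu>_eq:
  assumes q: "q \<in> S"
  shows "D \<nu> q u = om q u *\<^sub>R \<eta> q - h q *\<^sub>R D X q u"
proof (rule vector_eqI[OF q])
  have n: "D X q u \<bullet> \<nu> q = 0" "D X q u \<bullet> \<eta> q = 0" "\<eta> q \<bullet> \<nu> q = 0" for u
    using \<nu>_normal[OF q] \<eta>_normal[OF q] \<nu>\<eta>[OF q] by (simp_all add: inner_commute)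
  show "D \<nu> q u \<bullet> D X q z = (om q u *\<^sub>R \<eta> q - h q *\<^sub>R D X q u) \<bullet> D X q z" for z
    unfolding D\<nu>_DX[OF q] by (simp add: inner_diff_left \<eta>_normal[OF q] g_def)
  show "D \<nu> q u \<bullet> \<nu> q = (om q u *\<^sub>R \<eta> q - h q *\<^sub>R D X q u) \<bullet> \<nu> q"
    unfolding D\<nu>_\<nu>[OF q] by (simp add: inner_diff_left n)
  show "D \<nu> q u \<bullet> \<eta> q = (om q u *\<^sub>R \<eta> q - h q *\<^sub>R D X q u) \<bullet> \<eta> q"
    by (simp add: inner_diff_left n \<eta>\<eta>[OF q] om_def)
qed

lemma smooth_om: "open T \<Longrightarrow> T \<subseteq> S \<Longrightarrow> smooth_on T V \<Longrightarrow> smooth_on T (\<lambda>p. om p (V p))"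
  unfolding om_def
  by (intro smooth_on_inner smooth_on_D smooth_on_subset[OF smooth_\<nu>] smooth_on_subset[OF smooth_\<eta>])

lemmas smooth_om_const = smooth_om[OF open_S subset_refl smooth_on_const]

lemma D2\<nu>:
  assumes q: "q \<in> S"
  shows "D2 \<nu> q u v = (D (\<lambda>p. om p v) q u *\<^sub>R \<eta> q + om q v *\<^sub>R D \<eta> q u)
    - (D h q u *\<^sub>R D X q v + h q *\<^sub>R D2 X q u v)"
  by (rule has_rate_unique[OF has_rate_smooth[OF smooth_on_D_const[OF smooth_\<nu>] q]
        has_rate_diff[OF has_rate_scaleR[OF has_rate_smooth[OF smooth_om_const q] rate_\<eta>[OF q]]
          has_rate_scaleR[OF rate_h[OF q] rate_DX[OF q]]] open_S q D\<nu>_eq])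

text \<open>The tangential part of the symmetry of the second derivative of \<open>\<nu>\<close>.
  The shape operator of \<open>\<nu>\<close> is \<open>h\<close> times the identity, so its
  covariant derivative contributes only dh.\<close>

lemma codazzi:
  assumes q: "q \<in> S"
  shows "D h q u * g q v z - D h q v * g q u z = om q u * al q v z - om q v * al q u z"
proof -
  have *: "D2 \<nu> q u v \<bullet> D X q z = - om q v * al q u z - D h q u * g q v z - h q * (D2 X q u v \<bullet> D X q z)" for u v
    unfolding D2\<nu>[OF q] by (simp add: inner_diff_left inner_add_left \<eta>_normal[OF q] D\<eta>_DX[OF q] g_def)
  have "D2 \<nu> q u v = D2 \<nu> q v u"
    by (rule second_derivative_symmetric[OF smooth_\<nu> open_S q])
  then show ?thesis
    using *[of u v] *[of v u] D2_commute[OF q, of u v] by simp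
qed

text \<open>The \<open>\<eta>\<close>-part of the same symmetry, which is the Ricci equation. The
  commutator of the shape operators vanishes because that of \<open>\<nu>\<close> is a multiple of
  the identity, so the form \<open>om\<close> is closed.\<close>

lemma d_om:
  assumes q: "q \<in> S"
  shows "D (\<lambda>p. om p v) q u = D (\<lambda>p. om p u) q v"
proof -
  have *: "D2 \<nu> q u v \<bullet> \<eta> q = D (\<lambda>p. om p v) q u - h q * (D2 X q u v \<bullet> \<eta> q)" for u v
    unfolding D2\<nu>[OF q] using \<eta>_normal[OF q, of v]
    by (simp add: inner_diff_left inner_add_left D\<eta>_\<eta>[OF q] \<eta>\<eta>[OF q] inner_commute[of "D X q v"])
  have "D2 \<nu> q u v = D2 \<nu> q v u"
    by (rule second_derivative_symmetric[OF smooth_\<nu> open_S q])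
  then show ?thesis
    using *[of u v] *[of v u] D2_commute[OF q, of u v] by simp
qed

text \<open>Where \<open>om\<close> is nonzero, the Codazzi equation with dh = 0 makes
  \<open>al\<close> a multiple of om \<otimes> om, and zero trace makes it vanish. Then D \<eta> =
  -om \<nu> near the point, and the symmetry of the second derivative of \<open>\<eta>\<close>,
  tested with v in the kernel of \<open>om\<close>, gives om(u) h g(v, v) = 0.\<close>

lemma om_eq_0_if_dh_eq_0:
  assumes dh: "\<And>q u. q \<in> S \<Longrightarrow> D h q u = 0" and q: "q \<in> S"
  shows "om q u = 0"
proof (rule ccontr)
  assume ne: "om q u \<noteq> 0"
  define T where "T = {p \<in> S. om p u \<noteq> 0}"
  have "continuous_on S (\<lambda>p. om p u)"
    by (rule smooth_on_continuous[OF smooth_om_const])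
  then have "open T"
    unfolding T_def using continuous_open_preimage[OF _ open_S, of "\<lambda>p. om p u" "- {0}"]
    by (simp add: vimage_def Int_def open_Compl)
  have qT: "q \<in> T" using q ne by (simp add: T_def)
  obtain E where E: "frame_on S E" by (rule frame_exists)
  have al0: "al p v z = 0" if p: "p \<in> T" for p v z
  proof -
    have pS: "p \<in> S" and pn: "om p u \<noteq> 0" using p by (auto simp: T_def)
    have c: "om p u * al p v z = om p v * al p u z" for v z
      using codazzi[OF pS, of u v z] dh[OF pS] by simp
    define k where "k = al p u u / (om p u)^2"
    have al: "al p v z = k * om p v * om p z" for v z
    proof -
      have "om p u * om p u * al p v z = om p v * (om p u * al p z u)"
        using c[of v z] al_commute[OF pS, of u z] by simp
      also have "\<dots> = om p v * om p z * al p u u"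
        using c[of z u] by simp
      finally show ?thesis
        using pn by (simp add: k_def power2_eq_square field_simps)
    qed
    define s where "s = (\<Sum>i=1..DIM('c). (om p (E i p))^2)"
    have on: "orthonormal DIM('c) (\<lambda>i. D X p (E i p))" using E pS by (auto simp: frame_on_def)
    have "k * s = 0"
      using tracefree[OF pS on] al[unfolded al_def]
      by (simp add: s_def sum_distrib_left power2_eq_square mult.assoc)
    moreover have "s \<noteq> 0"
    proof
      assume "s = 0"
      then have z: "om p (E i p) = 0" if "i \<in> {1..DIM('c)}" for i
        using that by (simp add: s_def sum_nonneg_eq_0_iff)
      have "om p u = om p (\<Sum>i=1..DIM('c). g p u (E i p) *\<^sub>R E i p)"
        using frame_expansion[OF pS on, of u] by simp
      also have "\<dots> = 0"
        using z by (simp add: linear_sum[OF linear_om[OF pS]] linear_cmul[OF linear_om[OF pS]])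
      finally show False using pn by simp
    qed
    ultimately show ?thesis using al by simp
  qed
  have D\<eta>: "D \<eta> p v = - (om p v *\<^sub>R \<nu> p)" if p: "p \<in> T" for p v
  proof -
    have pS: "p \<in> S" using p by (auto simp: T_def)
    show ?thesis
      by (rule vector_eqI[OF pS])
         (simp_all add: D\<eta>_DX[OF pS] al0[OF p] \<nu>_normal[OF pS] D\<eta>_\<nu>[OF pS] \<nu>\<nu>[OF pS] D\<eta>_\<eta>[OF pS] \<nu>\<eta>[OF pS])
  qed
  have D2\<eta>: "D2 \<eta> q v z = - (D (\<lambda>p. om p z) q v *\<^sub>R \<nu> q + om q z *\<^sub>R D \<nu> q v)" for v z
    by (rule has_rate_unique[OF has_rate_smooth[OF smooth_on_D_const[OF smooth_\<eta>] q]
        has_rate_minus[OF has_rate_scaleR[OF has_rate_smooth[OF smooth_om_const q] rate_\<nu>[OF q]]]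
        \<open>open T\<close> qT D\<eta>])
  obtain v where v: "v \<noteq> 0" "om q v = 0"
    using two_functionals_common_kernel[OF linear_om[OF q] linear_om[OF q] dim_c] by blast
  have "D2 \<eta> q u v \<bullet> D X q v = D2 \<eta> q v u \<bullet> D X q v"
    using second_derivative_symmetric[OF smooth_\<eta> open_S q] by simp
  then have "om q u * (h q * g q v v) = 0"
    unfolding D2\<eta> by (simp add: inner_diff_left \<nu>_normal[OF q] D\<nu>_DX[OF q] v)
  then show False
    using ne h_nonzero[OF q] g_pos[OF q v(1)] by simp
qed

section \<open>The biminimal equation in the normal frame, and the case of constant h\<close>

lemma nproj_D:
  assumes q: "q \<in> S"
  shows "nproj q (D (\<lambda>p. h p *\<^sub>R \<nu> p) q u) = D h q u *\<^sub>R \<nu> q + (h q * om q u) *\<^sub>R \<eta> q"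
proof -
  have "D (\<lambda>p. h p *\<^sub>R \<nu> p) q u = D h q u *\<^sub>R \<nu> q + h q *\<^sub>R D \<nu> q u"
    by (rule D_has_rate[OF has_rate_scaleR[OF rate_h[OF q] rate_\<nu>[OF q]]])
  then show ?thesis
    by (simp add: nproj_def inner_add_left \<nu>\<nu>[OF q] D\<nu>_\<nu>[OF q] \<nu>\<eta>[OF q] om_def)
qed

lemma biminimal_eq':
  assumes q: "q \<in> S"
  obtains T E C where "open T" "q \<in> T" "T \<subseteq> S" "frame_on T E"
    "\<And>i z. i \<in> {1..DIM('c)} \<Longrightarrow> g q (C i) z = D (\<lambda>p. D X p (E i p)) q (E i q) \<bullet> D X q z"
    "lap q E C = ((real DIM('c) * (h q)\<^sup>2 + lam) * h q) *\<^sub>R \<nu> q"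
proof -
  obtain T E C where T: "open T" "q \<in> T" "T \<subseteq> S" "frame_on T E"
    and C: "\<And>i z. i \<in> {1..DIM('c)} \<Longrightarrow> g q (C i) z = D (\<lambda>p. D X p (E i p)) q (E i q) \<bullet> D X q z"
    and eq: "(\<Sum>i=1..DIM('c).
        nproj q (D (\<lambda>p. nproj p (D (\<lambda>p. h p *\<^sub>R \<nu> p) p (E i p))) q (E i q))
        - nproj q (D (\<lambda>p. h p *\<^sub>R \<nu> p) q (C i)))
      = ((real DIM('c) * (h q)\<^sup>2 + lam) * h q) *\<^sub>R \<nu> q"
    using biminimal_eq[OF q] by blast
  have "D (\<lambda>p. nproj p (D (\<lambda>p. h p *\<^sub>R \<nu> p) p (E i p))) q
      = D (\<lambda>p. D h p (E i p) *\<^sub>R \<nu> p + (h p * om p (E i p)) *\<^sub>R \<eta> p) q" if i: "i \<in> {1..DIM('c)}" for i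
  proof (rule D_cong(2)[OF _ T(1,2)])
    have s: "smooth_on T (E i)" using T i by (simp add: frame_on_def)
    have "smooth_on T (\<lambda>p. D h p (E i p) *\<^sub>R \<nu> p + (h p * om p (E i p)) *\<^sub>R \<eta> p)"
      by (intro smooth_on_add smooth_on_scaleR smooth_on_mult smooth_on_D smooth_om s
          T smooth_on_subset[OF smooth_h] smooth_on_subset[OF smooth_\<nu>] smooth_on_subset[OF smooth_\<eta>])
    then show "(\<lambda>p. D h p (E i p) *\<^sub>R \<nu> p + (h p * om p (E i p)) *\<^sub>R \<eta> p) differentiable at q"
      using smooth_on_differentiable T by blast
  qed (use T nproj_D in auto)
  with eq have "lap q E C = ((real DIM('c) * (h q)\<^sup>2 + lam) * h q) *\<^sub>R \<nu> q"
    unfolding lap_def nproj_D[OF q] by simp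
  with T C that show thesis by blast
qed

lemma h_square:
  assumes dh: "\<And>q u. q \<in> S \<Longrightarrow> D h q u = 0" and q: "q \<in> S"
  shows "real DIM('c) * (h q)\<^sup>2 + lam = 0"
proof -
  obtain T E C where T: "open T" "q \<in> T" "T \<subseteq> S" "frame_on T E"
    and "\<And>i z. i \<in> {1..DIM('c)} \<Longrightarrow> g q (C i) z = D (\<lambda>p. D X p (E i p)) q (E i q) \<bullet> D X q z"
    and eq: "lap q E C = ((real DIM('c) * (h q)\<^sup>2 + lam) * h q) *\<^sub>R \<nu> q"
    by (rule biminimal_eq'[OF q], rule that; (assumption | blast))
  have "D (\<lambda>p. D h p (E i p) *\<^sub>R \<nu> p + (h p * om p (E i p)) *\<^sub>R \<eta> p) q u = 0" for i u
    by (rule D_locally_const[OF T(1,2)]) (use T dh om_eq_0_if_dh_eq_0[OF dh] in auto)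
  then have "lap q E C = 0"
    unfolding lap_def by (intro sum.neutral ballI) (simp only: nproj_def dh[OF q] om_eq_0_if_dh_eq_0[OF dh q], simp)
  then have "((real DIM('c) * (h q)\<^sup>2 + lam) * h q) *\<^sub>R \<nu> q = 0"
    using eq by (rule_tac trans[OF sym])
  moreover have "\<nu> q \<noteq> 0" using \<nu>\<nu>[OF q] by auto
  ultimately show ?thesis using h_nonzero[OF q] by simp
qed

text \<open>For constant \<open>h\<close> and om = 0 the derivative of \<open>\<nu>\<close> is -h D
  X, so the motion of \<nu>/h compensates that of X.\<close>

lemma D_centre:
  assumes dh: "\<And>q u. q \<in> S \<Longrightarrow> D h q u = 0" and q: "q \<in> S"
  shows "has_rate (\<lambda>p. X p + inverse (h p) *\<^sub>R \<nu> p) q u 0"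
proof -
  have s: "smooth_on S (\<lambda>p. inverse (h p))"
    by (rule smooth_on_inverse[OF open_S smooth_h h_nonzero])
  have "has_rate (\<lambda>p. inverse (h p) * h p) q u (D (\<lambda>p. inverse (h p)) q u * h q + inverse (h q) * D h q u)"
    by (rule has_rate_mult[OF has_rate_smooth[OF s q] rate_h[OF q]])
  from has_rate_unique_0[OF this open_S q, of 1] have i: "D (\<lambda>p. inverse (h p)) q u = 0"
    using h_nonzero dh q by simp
  have "has_rate (\<lambda>p. X p + inverse (h p) *\<^sub>R \<nu> p) q u
      (D X q u + (D (\<lambda>p. inverse (h p)) q u *\<^sub>R \<nu> q + inverse (h q) *\<^sub>R D \<nu> q u))"
    by (rule has_rate_add[OF has_rate_smooth[OF smooth_X q] has_rate_scaleR[OF has_rate_smooth[OF s q] rate_\<nu>[OF q]]])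
  then show ?thesis
    using h_nonzero[OF q] by (simp add: i D\<nu>_eq[OF q] om_eq_0_if_dh_eq_0[OF dh q])
qed

end

section \<open>Patches on which h has no critical point\<close>

locale gradient_patch = normal_patch S X \<nu> \<eta> h lam
  for S :: "'c::euclidean_space set" and X :: "'c \<Rightarrow> 'e::euclidean_space" and \<nu> \<eta> h lam +
  assumes nonempty: "S \<noteq> {}" and dh_nonzero: "q \<in> S \<Longrightarrow> \<exists>u. D h q u \<noteq> 0"
begin

text \<open>With v orthogonal to u and in the kernel of \<open>om\<close>, both right-hand terms of
  the Codazzi equation for u, v, v vanish, and so does the term with g(u, v). Hence the kernel of
  \<open>om\<close> lies in that of dh.\<close>

lemma om_kernel:
  assumes q: "q \<in> S" and u: "om q u = 0"
  shows "D h q u = 0"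
proof -
  obtain v where v: "v \<noteq> 0" "om q v = 0" "g q u v = 0"
    using two_functionals_common_kernel[OF linear_om[OF q] linear_g[OF q] dim_c] by blast
  have "D h q u * g q v v = 0"
    using codazzi[OF q, of u v v] u v by simp
  then show ?thesis using g_pos[OF q v(1)] by simp
qed

definition fr :: "nat \<Rightarrow> 'c \<Rightarrow> 'c" where "fr = (SOME E. frame_on S E)"

lemma fr: "frame_on S fr"
  unfolding fr_def using frame_exists someI_ex by metis

lemma fr_on: "q \<in> S \<Longrightarrow> orthonormal DIM('c) (\<lambda>i. D X q (fr i q))"
  and fr_smooth: "i \<in> {1..DIM('c)} \<Longrightarrow> smooth_on S (fr i)"
  using fr by (auto simp: frame_on_def)

definition grad :: "'c \<Rightarrow> 'c" where
  "grad q = (\<Sum>i=1..DIM('c). D h q (fr i q) *\<^sub>R fr i q)"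

text \<open>The unit gradient is needed twice: \<open>wh\<close> in the coordinates of
  \<open>S\<close>, where derivatives are taken, and \<open>w\<close> as an ambient vector, which
  can itself be differentiated and projected.\<close>

definition wh :: "'c \<Rightarrow> 'c" where
  "wh q = (g q (grad q) (grad q) powr (-1/2)) *\<^sub>R grad q"

definition w :: "'c \<Rightarrow> 'e" where "w q = D X q (wh q)"

definition th :: "'c \<Rightarrow> 'c \<Rightarrow> real" where "th q u = w q \<bullet> D X q u"

definition h1 :: "'c \<Rightarrow> real" where "h1 q = D h q (wh q)"

definition a :: "'c \<Rightarrow> real" where "a q = om q (wh q)"

definition \<mu> :: "'c \<Rightarrow> real" where "\<mu> q = h1 q / a q"

lemma g_grad:
  assumes q: "q \<in> S"
  shows "g q (grad q) u = D h q u"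
proof -
  have "D h q u = D h q (\<Sum>i=1..DIM('c). g q u (fr i q) *\<^sub>R fr i q)"
    using frame_expansion[OF q fr_on[OF q], of u] by simp
  also have "\<dots> = (\<Sum>i=1..DIM('c). g q u (fr i q) * D h q (fr i q))"
    by (simp add: linear_sum[OF linear_dh[OF q]] linear_cmul[OF linear_dh[OF q]])
  finally show ?thesis
    by (simp add: grad_def g_left[OF q] g_commute[of q u] mult.commute)
qed

lemma grad_nonzero: "q \<in> S \<Longrightarrow> grad q \<noteq> 0"
  using g_grad dh_nonzero linear_0[OF linear_g, of q] g_commute by metis

lemma smooth_grad: "smooth_on S grad"
  unfolding grad_def by (intro smooth_on_sum smooth_on_scaleR smooth_on_D open_S smooth_h fr_smooth)

lemma smooth_wh: "smooth_on S wh"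
  unfolding wh_def
  by (intro smooth_on_scaleR smooth_on_powr smooth_g open_S smooth_grad g_pos grad_nonzero subset_refl)

lemma smooth_w: "smooth_on S w"
  unfolding w_def by (intro smooth_DX smooth_wh open_S subset_refl)

lemma smooth_h1: "smooth_on S h1"
  unfolding h1_def by (intro smooth_on_D smooth_wh open_S smooth_h)

lemma smooth_a: "smooth_on S a"
  unfolding a_def by (intro smooth_om smooth_wh open_S subset_refl)

lemma smooth_th: "smooth_on S (\<lambda>p. th p u)"
  unfolding th_def by (intro smooth_on_inner smooth_w smooth_on_D_const smooth_X open_S)

lemma th_g: "th q u = g q (wh q) u"
  by (simp add: th_def w_def g_def)

lemma g_wh_wh:
  assumes q: "q \<in> S"
  shows "g q (wh q) (wh q) = 1"
proof -
  define c where "c = g q (grad q) (grad q)"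
  have c: "c > 0" using g_pos[OF q grad_nonzero[OF q]] by (simp add: c_def)
  have "(c powr (-1/2)) * (c powr (-1/2)) * c = c powr (-1/2 + -1/2) * c"
    by (simp only: powr_add)
  also have "\<dots> = 1" using c by (simp add: powr_minus)
  finally show ?thesis
    by (simp add: wh_def g_left[OF q] g_right[OF q] c_def mult.assoc)
qed

lemma th_wh: "q \<in> S \<Longrightarrow> th q (wh q) = 1"
  by (simp add: th_g g_wh_wh)

lemma linear_th: "q \<in> S \<Longrightarrow> linear (th q)"
  unfolding th_g by (rule linear_g)

lemma dh_eq:
  assumes q: "q \<in> S"
  shows "D h q u = h1 q * th q u"
proof -
  define c where "c = g q (grad q) (grad q)"
  have c: "c > 0" using g_pos[OF q grad_nonzero[OF q]] by (simp add: c_def)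
  have "(c powr (-1/2)) * c * (c powr (-1/2)) = c powr (-1/2 + -1/2) * c"
    by (simp only: powr_add mult.commute mult.left_commute)
  also have "\<dots> = 1" using c by (simp add: powr_minus)
  finally have 1: "(c powr (-1/2)) * c * (c powr (-1/2)) = 1" .
  have "h1 q = (c powr (-1/2)) * c"
    by (simp add: h1_def g_grad[OF q, symmetric] wh_def g_right[OF q] c_def)
  moreover have "th q u = (c powr (-1/2)) * D h q u"
    by (simp add: th_g wh_def g_left[OF q] g_grad[OF q] c_def)
  ultimately have "h1 q * th q u = ((c powr (-1/2)) * c * (c powr (-1/2))) * D h q u"
    by simp
  then show ?thesis using 1 by simp
qed

lemma h1_nonzero: "q \<in> S \<Longrightarrow> h1 q \<noteq> 0"
  using dh_eq dh_nonzero by fastforce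

lemma a_nonzero: "q \<in> S \<Longrightarrow> a q \<noteq> 0"
  using om_kernel[of q "wh q"] h1_nonzero[of q] by (auto simp: a_def h1_def)

lemma \<mu>_nonzero: "q \<in> S \<Longrightarrow> \<mu> q \<noteq> 0"
  by (simp add: \<mu>_def h1_nonzero a_nonzero)

lemma h1_eq: "q \<in> S \<Longrightarrow> h1 q = \<mu> q * a q"
  by (simp add: \<mu>_def a_nonzero)

lemma smooth_\<mu>: "smooth_on S \<mu>"
  unfolding \<mu>_def by (intro smooth_on_divide smooth_h1 smooth_a open_S a_nonzero)

text \<open>Subtracting the right multiple of \<open>wh\<close> puts u into the kernel of
  \<open>om\<close>, hence of dh, and dh is a multiple of \<open>th\<close>.\<close>

lemma om_eq:
  assumes q: "q \<in> S"
  shows "om q u = a q * th q u"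
proof -
  have "om q (u - (om q u / a q) *\<^sub>R wh q) = 0"
    using a_nonzero[OF q] by (simp add: linear_diff[OF linear_om[OF q]] linear_cmul[OF linear_om[OF q]] a_def)
  from om_kernel[OF q this] have "D h q u - (om q u / a q) * h1 q = 0"
    by (simp add: linear_diff[OF linear_dh[OF q]] linear_cmul[OF linear_dh[OF q]] h1_def)
  then have "(th q u - om q u / a q) * h1 q = 0"
    by (simp add: dh_eq[OF q] algebra_simps)
  then show ?thesis
    using h1_nonzero[OF q] a_nonzero[OF q] by (simp add: field_simps)
qed

lemma th_proj: "q \<in> S \<Longrightarrow> th q (u - th q u *\<^sub>R wh q) = 0"
  by (simp add: linear_diff[OF linear_th] linear_cmul[OF linear_th] th_wh)

lemma sum_th_square:
  assumes q: "q \<in> S" and E: "orthonormal DIM('c) (\<lambda>i. D X q (E i))"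
  shows "(\<Sum>i=1..DIM('c). th q (E i) * th q (E i)) = 1"
proof -
  have "1 = th q (\<Sum>i=1..DIM('c). g q (wh q) (E i) *\<^sub>R E i)"
    using frame_expansion[OF q E, of "wh q"] th_wh[OF q] by simp
  then show ?thesis
    by (simp add: g_right[OF q] th_g)
qed

lemma sum_g:
  assumes "orthonormal DIM('c) (\<lambda>i. D X q (E i))"
  shows "(\<Sum>i=1..DIM('c). g q (E i) (E i)) = real DIM('c)"
proof -
  have "(\<Sum>i=1..DIM('c). g q (E i) (E i)) = (\<Sum>i=1..DIM('c). 1)"
    using assms unfolding orthonormal_def g_def by (intro sum.cong) auto
  then show ?thesis by simp
qed

text \<open>For u in the kernel of \<open>th\<close>, the Codazzi equation with \<open>wh\<close> as
  second argument gives al(u, .) = \<mu> g(u, .). By symmetry al(\<open>wh\<close>, .) is then a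
  multiple of \<open>th\<close>, and zero trace fixes the factor.\<close>

lemma al_eq:
  assumes q: "q \<in> S"
  shows "al q u z = \<mu> q * (g q u z - real DIM('c) * th q u * th q z)"
proof -
  have 1: "al q u z = \<mu> q * g q u z" if "th q u = 0" for u z
    using codazzi[OF q, of u "wh q" z] that a_nonzero[OF q]
    by (simp add: dh_eq[OF q] om_eq[OF q] th_wh[OF q] \<mu>_def field_simps)
  define A where "A = al q (wh q) (wh q)"
  have 2: "al q (wh q) z = th q z * A" for z
  proof -
    have "al q (z - th q z *\<^sub>R wh q) (wh q) = 0"
      unfolding 1[OF th_proj[OF q]] using th_proj[OF q, of z] by (simp add: th_g g_commute)
    then show ?thesis
      by (simp add: al_left[OF q] A_def al_commute[OF q, of z])
  qed
  have 3: "al q u z = \<mu> q * (g q u z - th q u * th q z) + A * th q u * th q z" for u z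
  proof -
    have "al q (u - th q u *\<^sub>R wh q) z = \<mu> q * g q (u - th q u *\<^sub>R wh q) z"
      by (rule 1[OF th_proj[OF q]])
    then show ?thesis
      by (simp add: al_left[OF q] g_left[OF q] 2 th_g[symmetric] algebra_simps)
  qed
  have "0 = (\<Sum>i=1..DIM('c). al q (fr i q) (fr i q))"
    using tracefree[OF q fr_on[OF q]] by (simp add: al_def)
  also have "\<dots> = \<mu> q * ((\<Sum>i=1..DIM('c). g q (fr i q) (fr i q)) - (\<Sum>i=1..DIM('c). th q (fr i q) * th q (fr i q)))
      + A * (\<Sum>i=1..DIM('c). th q (fr i q) * th q (fr i q))"
    unfolding 3 by (simp add: sum.distrib sum_distrib_left sum_subtractf algebra_simps)
  finally have A: "A = - \<mu> q * (real DIM('c) - 1)"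
    unfolding sum_th_square[OF q fr_on[OF q]] sum_g[OF fr_on[OF q]] by simp
  then show ?thesis
    unfolding 3 A by (simp add: algebra_simps)
qed

lemma D\<eta>_eq:
  assumes q: "q \<in> S"
  shows "D \<eta> q u = (real DIM('c) * \<mu> q * th q u) *\<^sub>R w q - \<mu> q *\<^sub>R D X q u - (a q * th q u) *\<^sub>R \<nu> q"
proof (rule vector_eqI[OF q])
  have n: "D X q u \<bullet> \<nu> q = 0" "D X q u \<bullet> \<eta> q = 0" "w q \<bullet> \<nu> q = 0" "w q \<bullet> \<eta> q = 0" for u
    using \<nu>_normal[OF q] \<eta>_normal[OF q] by (simp_all add: inner_commute w_def)
  show "D \<eta> q u \<bullet> D X q z = ((real DIM('c) * \<mu> q * th q u) *\<^sub>R w q - \<mu> q *\<^sub>R D X q u - (a q * th q u) *\<^sub>R \<nu> q) \<bullet> D X q z" for z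
    unfolding D\<eta>_DX[OF q] al_eq[OF q]
    by (simp add: inner_diff_left \<nu>_normal[OF q] th_def[symmetric] g_def[symmetric] algebra_simps)
  show "D \<eta> q u \<bullet> \<nu> q = ((real DIM('c) * \<mu> q * th q u) *\<^sub>R w q - \<mu> q *\<^sub>R D X q u - (a q * th q u) *\<^sub>R \<nu> q) \<bullet> \<nu> q"
    unfolding D\<eta>_\<nu>[OF q] om_eq[OF q] by (simp add: inner_diff_left n \<nu>\<nu>[OF q])
  show "D \<eta> q u \<bullet> \<eta> q = ((real DIM('c) * \<mu> q * th q u) *\<^sub>R w q - \<mu> q *\<^sub>R D X q u - (a q * th q u) *\<^sub>R \<nu> q) \<bullet> \<eta> q"
    unfolding D\<eta>_\<eta>[OF q] by (simp add: inner_diff_left n \<nu>\<eta>[OF q])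
qed

section \<open>The covariant derivative of w\<close>

definition tw :: "'c \<Rightarrow> 'c \<Rightarrow> 'c \<Rightarrow> real" where "tw q u z = D w q u \<bullet> D X q z"

lemma linear_Dw: "q \<in> S \<Longrightarrow> linear (D w q)"
  by (rule linear_D_smooth[OF smooth_w])

lemma tw_left:
  assumes q: "q \<in> S"
  shows "tw q (u + u') v = tw q u v + tw q u' v" "tw q (u - u') v = tw q u v - tw q u' v"
    "tw q (c *\<^sub>R u) v = c * tw q u v"
  using linear_Dw[OF q]
  by (simp_all add: tw_def linear_add linear_diff linear_cmul inner_add_left inner_diff_left)

lemma tw_right:
  assumes q: "q \<in> S"
  shows "tw q u (v + v') = tw q u v + tw q u v'" "tw q u (v - v') = tw q u v - tw q u v'"
    "tw q u (c *\<^sub>R v) = c * tw q u v"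
  using linear_DX[OF q]
  by (simp_all add: tw_def linear_add linear_diff linear_cmul inner_add_right inner_diff_right)

lemmas rate_w = has_rate_smooth[OF smooth_w] and rate_th = has_rate_smooth[OF smooth_th]
  and rate_h1 = has_rate_smooth[OF smooth_h1] and rate_a = has_rate_smooth[OF smooth_a]
  and rate_\<mu> = has_rate_smooth[OF smooth_\<mu>]

lemma tw_wh:
  assumes q: "q \<in> S"
  shows "tw q u (wh q) = 0"
proof -
  have "w p \<bullet> w p = 1" if "p \<in> S" for p
    using th_wh[OF that] by (simp add: th_def w_def)
  from has_rate_unique_0[OF has_rate_inner[OF rate_w[OF q] rate_w[OF q]] open_S q this, of u]
  show ?thesis by (simp add: tw_def w_def[symmetric] inner_commute)
qed

lemma Dw_\<nu>:
  assumes q: "q \<in> S"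
  shows "D w q u \<bullet> \<nu> q = h q * th q u"
proof -
  have "w p \<bullet> \<nu> p = 0" if "p \<in> S" for p
    using \<nu>_normal[OF that] by (simp add: w_def inner_commute)
  from has_rate_unique_0[OF has_rate_inner[OF rate_w[OF q] rate_\<nu>[OF q]] open_S q this, of u]
  have "D w q u \<bullet> \<nu> q + D \<nu> q u \<bullet> w q = 0" by (simp add: inner_commute)
  then show ?thesis
    by (simp add: w_def D\<nu>_DX[OF q] th_g g_commute)
qed

lemma Dw_\<eta>:
  assumes q: "q \<in> S"
  shows "D w q u \<bullet> \<eta> q = - (real DIM('c) - 1) * \<mu> q * th q u"
proof -
  have "w p \<bullet> \<eta> p = 0" if "p \<in> S" for p
    using \<eta>_normal[OF that] by (simp add: w_def inner_commute)
  from has_rate_unique_0[OF has_rate_inner[OF rate_w[OF q] rate_\<eta>[OF q]] open_S q this, of u]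
  have "D w q u \<bullet> \<eta> q + D \<eta> q u \<bullet> w q = 0" by (simp add: inner_commute)
  then have "D w q u \<bullet> \<eta> q = al q u (wh q)"
    by (simp add: w_def D\<eta>_DX[OF q])
  also have "\<dots> = - (real DIM('c) - 1) * \<mu> q * th q u"
    by (simp add: al_eq[OF q] th_wh[OF q] g_commute[of q u] th_g[symmetric] algebra_simps)
  finally show ?thesis .
qed

lemma D_th:
  assumes q: "q \<in> S"
  shows "D (\<lambda>p. th p v) q u = tw q u v + w q \<bullet> D2 X q u v"
proof -
  have "has_rate (\<lambda>p. w p \<bullet> D X p v) q u (D w q u \<bullet> D X q v + w q \<bullet> D2 X q u v)"
    by (rule has_rate_inner[OF rate_w[OF q] rate_DX[OF q]])
  then show ?thesis
    unfolding th_def tw_def by (rule D_has_rate)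
qed

lemma D_th_antisym: "q \<in> S \<Longrightarrow> D (\<lambda>p. th p v) q u - D (\<lambda>p. th p u) q v = tw q u v - tw q v u"
  by (simp add: D_th D2_commute[of q u v])

text \<open>The formula solves the Codazzi equation of \<open>\<eta>\<close> for the covariant
  derivative of \<open>w\<close> on the complement of \<open>w\<close>; \<open>tw_eq\<close> shows
  that this derivative is \<open>\<kappa>\<close> times the identity there.\<close>

definition \<kappa> :: "'c \<Rightarrow> real" where
  "\<kappa> q = - (D \<mu> q (wh q) + a q * h q) / (real DIM('c) * \<mu> q)"

lemma smooth_\<kappa>: "smooth_on S \<kappa>"
proof -
  have "smooth_on S (\<lambda>q. real DIM('c) * \<mu> q)"
    by (intro smooth_on_mult smooth_on_const open_S smooth_\<mu>)
  then show ?thesis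
    unfolding \<kappa>_def
    by (intro smooth_on_divide smooth_on_minus smooth_on_add smooth_on_mult smooth_on_D
        smooth_wh smooth_\<mu> smooth_a smooth_h open_S smooth_on_const) (simp_all add: \<mu>_nonzero)
qed

lemmas rate_\<kappa> = has_rate_smooth[OF smooth_\<kappa>]

text \<open>The tangential part of the symmetry of the second derivative of \<open>\<eta>\<close>,
  once D \<eta> has the explicit form \<open>D\<eta>_eq\<close>.\<close>

lemma codazzi_\<eta>:
  assumes q: "q \<in> S"
  defines "m \<equiv> real DIM('c)"
  shows "- D \<mu> q u * g q v z + D \<mu> q v * g q u z + m * (D \<mu> q u * th q v - D \<mu> q v * th q u) * th q z
    + m * \<mu> q * (tw q u v - tw q v u) * th q z + m * \<mu> q * (th q v * tw q u z - th q u * tw q v z)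
    + a q * h q * (th q v * g q u z - th q u * g q v z) = 0"
proof -
  have e: "D2 \<eta> q u v \<bullet> D X q z = m * (D \<mu> q u * th q v + \<mu> q * D (\<lambda>p. th p v) q u) * th q z
      + m * \<mu> q * th q v * tw q u z - D \<mu> q u * g q v z - \<mu> q * (D2 X q u v \<bullet> D X q z)
      + a q * th q v * h q * g q u z" for u v
  proof -
    \<comment> \<open>The right side has the shape in which the product rules deliver it;
      \<open>0 * \<mu> q\<close> comes from the rate of the constant factor m.\<close>
    have D2: "D2 \<eta> q u v = (((0 * \<mu> q + m * D \<mu> q u) * th q v + (m * \<mu> q) * D (\<lambda>p. th p v) q u) *\<^sub>R w q
          + (m * \<mu> q * th q v) *\<^sub>R D w q u)
        - (D \<mu> q u *\<^sub>R D X q v + \<mu> q *\<^sub>R D2 X q u v)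
        - ((D a q u * th q v + a q * D (\<lambda>p. th p v) q u) *\<^sub>R \<nu> q + (a q * th q v) *\<^sub>R D \<nu> q u)"
      unfolding m_def
      by (rule has_rate_unique[OF has_rate_smooth[OF smooth_on_D_const[OF smooth_\<eta>] q]
         has_rate_diff[OF has_rate_diff[OF
           has_rate_scaleR[OF has_rate_mult[OF has_rate_mult[OF has_rate_const rate_\<mu>[OF q]] rate_th[OF q]] rate_w[OF q]]
           has_rate_scaleR[OF rate_\<mu>[OF q] rate_DX[OF q]]]
           has_rate_scaleR[OF has_rate_mult[OF rate_a[OF q] rate_th[OF q]] rate_\<nu>[OF q]]]
         open_S q D\<eta>_eq])
    show ?thesis
      unfolding D2 by (simp add: inner_diff_left inner_add_left \<nu>_normal[OF q] D\<nu>_DX[OF q]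
          tw_def[symmetric] th_def[symmetric] g_def[symmetric] algebra_simps)
  qed
  have "D2 \<eta> q u v = D2 \<eta> q v u"
    by (rule second_derivative_symmetric[OF smooth_\<eta> open_S q])
  then have "D2 \<eta> q u v \<bullet> D X q z - D2 \<eta> q v u \<bullet> D X q z = 0" by simp
  moreover have "D (\<lambda>p. th p v) q u = D (\<lambda>p. th p u) q v + tw q u v - tw q v u"
    using D_th_antisym[OF q, of v u] by simp
  ultimately show ?thesis
    unfolding e using D2_commute[OF q, of u v] by (simp add: algebra_simps)
qed

text \<open>The test vector v is orthogonal to u and in the kernel of \<open>th\<close>; on u, v, v
  every term of the Codazzi equation except the first vanishes.\<close>

lemma D\<mu>_kernel:
  assumes q: "q \<in> S" and u: "th q u = 0"
  shows "D \<mu> q u = 0"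
proof -
  obtain v where v: "v \<noteq> 0" "th q v = 0" "g q u v = 0"
    using two_functionals_common_kernel[OF linear_th[OF q] linear_g[OF q] dim_c] by blast
  have "D \<mu> q u * g q v v = 0"
    using codazzi_\<eta>[OF q, of u v v] u v by simp
  then show ?thesis using g_pos[OF q v(1)] by simp
qed

lemma parallel_th:
  assumes q: "q \<in> S" and l: "linear l" and k: "\<And>u. th q u = 0 \<Longrightarrow> l u = 0"
  shows "l u = l (wh q) * th q u"
  using k[OF th_proj[OF q, of u]] by (simp add: linear_diff[OF l] linear_cmul[OF l])

text \<open>The Codazzi equation of \<open>\<eta>\<close> on u, wh, wh shows that the integral
  curves of \<open>w\<close> are geodesics; on u, wh, z it shows that the level sets of
  \<open>h\<close> are umbilic.\<close>

lemma tw_eq: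
  assumes q: "q \<in> S"
  shows "tw q u z = \<kappa> q * (g q u z - th q u * th q z)"
proof -
  define m where "m = real DIM('c)"
  have m: "m > 0" by (simp add: m_def)
  have mm: "m * \<mu> q \<noteq> 0" using m \<mu>_nonzero[OF q] by simp
  have gw: "g q (wh q) z = th q z" "g q z (wh q) = th q z" for z
    by (simp_all add: th_g g_commute)
  have 1: "tw q (wh q) u = 0" if u: "th q u = 0" for u
  proof -
    have "m * \<mu> q * tw q (wh q) u = 0"
      using codazzi_\<eta>[OF q, of u "wh q" "wh q"] u D\<mu>_kernel[OF q u]
      by (simp add: gw tw_wh[OF q] th_wh[OF q] m_def)
    then show ?thesis using mm by simp
  qed
  have 2: "tw q (wh q) z = 0" for z
    using 1[OF th_proj[OF q, of z]] by (simp add: tw_right[OF q] tw_wh[OF q])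
  have 3: "tw q u z = \<kappa> q * g q u z" if u: "th q u = 0" for u
  proof -
    have "D \<mu> q (wh q) * g q u z + m * \<mu> q * tw q u z + a q * h q * g q u z = 0"
      using codazzi_\<eta>[OF q, of u "wh q" z] u D\<mu>_kernel[OF q u]
      by (simp add: gw tw_wh[OF q] th_wh[OF q] m_def 2)
    then have "m * \<mu> q * tw q u z = - (D \<mu> q (wh q) + a q * h q) * g q u z"
      by (simp add: algebra_simps)
    then show ?thesis
      using mm by (simp add: \<kappa>_def m_def[symmetric] field_simps)
  qed
  have "tw q (u - th q u *\<^sub>R wh q) z = \<kappa> q * g q (u - th q u *\<^sub>R wh q) z"
    by (rule 3[OF th_proj[OF q]])
  then show ?thesis
    by (simp add: tw_left[OF q] g_left[OF q] 2 gw)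
qed

lemma d_th: "q \<in> S \<Longrightarrow> D (\<lambda>p. th p v) q u = D (\<lambda>p. th p u) q v"
  using D_th_antisym[of q v u] by (simp add: tw_eq g_commute[of q u] mult.commute[of "th q u"])

text \<open>As \<open>th\<close> is closed by \<open>d_th\<close>, closedness of f th means df
  \<and> th = 0. It is applied to dh = h1 th and to om = a th.\<close>

lemma D_parallel:
  assumes q: "q \<in> S" and f: "smooth_on S f"
    and closed: "\<And>u v. D (\<lambda>p. f p * th p v) q u = D (\<lambda>p. f p * th p u) q v"
  shows "D f q u = D f q (wh q) * th q u"
proof (rule parallel_th[OF q linear_D_smooth[OF f q]])
  fix u assume u: "th q u = 0"
  have "D (\<lambda>p. f p * th p v) q u = D f q u * th q v + f q * D (\<lambda>p. th p v) q u" for u v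
    by (rule D_has_rate[OF has_rate_mult[OF has_rate_smooth[OF f q] rate_th[OF q]]])
  with closed[of "wh q" u] d_th[OF q, of "wh q" u] show "D f q u = 0"
    by (simp add: u th_wh[OF q])
qed

lemma Dh1_eq:
  assumes q: "q \<in> S"
  shows "D h1 q u = D h1 q (wh q) * th q u"
proof (rule D_parallel[OF q smooth_h1])
  have "D (\<lambda>p. h1 p * th p v) q u = D2 h q u v" for u v
    by (rule sym, rule has_rate_unique[OF has_rate_smooth[OF smooth_on_D_const[OF smooth_h] q]
          has_rate_smooth[OF smooth_on_mult[OF open_S smooth_h1 smooth_th] q] open_S q dh_eq])
  then show "D (\<lambda>p. h1 p * th p v) q u = D (\<lambda>p. h1 p * th p u) q v" for u v
    using second_derivative_symmetric[OF smooth_h open_S q] by simp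
qed

lemma Da_eq:
  assumes q: "q \<in> S"
  shows "D a q u = D a q (wh q) * th q u"
proof (rule D_parallel[OF q smooth_a])
  have "D (\<lambda>p. a p * th p v) q u = D (\<lambda>p. om p v) q u" for u v
    by (rule sym, rule has_rate_unique[OF has_rate_smooth[OF smooth_om_const q]
          has_rate_smooth[OF smooth_on_mult[OF open_S smooth_a smooth_th] q] open_S q om_eq])
  then show "D (\<lambda>p. a p * th p v) q u = D (\<lambda>p. a p * th p u) q v" for u v
    using d_om[OF q] by simp
qed

lemma Dw_eq:
  assumes q: "q \<in> S"
  shows "D w q u = \<kappa> q *\<^sub>R (D X q u - th q u *\<^sub>R w q) + (h q * th q u) *\<^sub>R \<nu> q
    - ((real DIM('c) - 1) * \<mu> q * th q u) *\<^sub>R \<eta> q" (is "_ = ?r")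
proof (rule vector_eqI[OF q])
  have n: "D X q u \<bullet> \<nu> q = 0" "D X q u \<bullet> \<eta> q = 0" "w q \<bullet> \<nu> q = 0" "w q \<bullet> \<eta> q = 0" "\<eta> q \<bullet> \<nu> q = 0" for u
    using \<nu>_normal[OF q] \<eta>_normal[OF q] \<nu>\<eta>[OF q] by (simp_all add: inner_commute w_def)
  show "D w q u \<bullet> D X q z = ?r \<bullet> D X q z" for z
    unfolding tw_def[symmetric] tw_eq[OF q]
    by (simp add: inner_diff_left inner_add_left \<nu>_normal[OF q] \<eta>_normal[OF q] th_def[symmetric] g_def[symmetric])
  show "D w q u \<bullet> \<nu> q = ?r \<bullet> \<nu> q"
    unfolding Dw_\<nu>[OF q] by (simp add: inner_diff_left inner_add_left n \<nu>\<nu>[OF q])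
  show "D w q u \<bullet> \<eta> q = ?r \<bullet> \<eta> q"
    unfolding Dw_\<eta>[OF q] by (simp add: inner_diff_left inner_add_left n \<nu>\<eta>[OF q] \<eta>\<eta>[OF q] algebra_simps)
qed

text \<open>The Gauss equation for the planes containing \<open>w\<close>.\<close>

lemma D\<kappa>_wh:
  assumes q: "q \<in> S"
  defines "m \<equiv> real DIM('c)"
  shows "D \<kappa> q (wh q) = - (\<kappa> q)\<^sup>2 - (h q)\<^sup>2 + (m - 1) * (\<mu> q)\<^sup>2"
proof -
  have e: "D2 w q u v \<bullet> D X q z = D \<kappa> q u * (g q v z - th q v * th q z)
      + \<kappa> q * (D2 X q u v \<bullet> D X q z - D (\<lambda>p. th p v) q u * th q z - th q v * tw q u z)
      - (h q)\<^sup>2 * th q v * g q u z + (m - 1) * \<mu> q * th q v * al q u z" for u v z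
  proof -
    have D2: "D2 w q u v = (D \<kappa> q u *\<^sub>R (D X q v - th q v *\<^sub>R w q)
          + \<kappa> q *\<^sub>R (D2 X q u v - (D (\<lambda>p. th p v) q u *\<^sub>R w q + th q v *\<^sub>R D w q u)))
        + ((D h q u * th q v + h q * D (\<lambda>p. th p v) q u) *\<^sub>R \<nu> q + (h q * th q v) *\<^sub>R D \<nu> q u)
        - (((0 * \<mu> q + (m - 1) * D \<mu> q u) * th q v + ((m - 1) * \<mu> q) * D (\<lambda>p. th p v) q u) *\<^sub>R \<eta> q
          + ((m - 1) * \<mu> q * th q v) *\<^sub>R D \<eta> q u)"
      unfolding m_def
      by (rule has_rate_unique[OF has_rate_smooth[OF smooth_on_D_const[OF smooth_w] q]
         has_rate_diff[OF has_rate_add[OF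
           has_rate_scaleR[OF rate_\<kappa>[OF q] has_rate_diff[OF rate_DX[OF q] has_rate_scaleR[OF rate_th[OF q] rate_w[OF q]]]]
           has_rate_scaleR[OF has_rate_mult[OF rate_h[OF q] rate_th[OF q]] rate_\<nu>[OF q]]]
           has_rate_scaleR[OF has_rate_mult[OF has_rate_mult[OF has_rate_const rate_\<mu>[OF q]] rate_th[OF q]] rate_\<eta>[OF q]]]
         open_S q Dw_eq])
    show ?thesis
      unfolding D2 by (simp add: inner_diff_left inner_add_left \<nu>_normal[OF q] \<eta>_normal[OF q] D\<nu>_DX[OF q] D\<eta>_DX[OF q]
          tw_def[symmetric] th_def[symmetric] g_def[symmetric] algebra_simps power2_eq_square)
  qed
  \<comment> \<open>A vector u orthogonal to \<open>w\<close> is used; in the symmetry of the second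
    derivative of \<open>w\<close>, tested against u, everything is a multiple of g(u, u).\<close>
  obtain u where u: "u \<noteq> 0" "th q u = 0"
    using two_functionals_common_kernel[OF linear_th[OF q] linear_th[OF q] dim_c] by blast
  have "D2 w q u (wh q) = D2 w q (wh q) u"
    by (rule second_derivative_symmetric[OF smooth_w open_S q])
  then have "D2 w q u (wh q) \<bullet> D X q u - D2 w q (wh q) u \<bullet> D X q u = 0" by simp
  moreover have "g q (wh q) u = 0" "g q u (wh q) = 0"
    using u by (simp_all add: th_g g_commute)
  ultimately have "(D \<kappa> q (wh q) + (\<kappa> q)\<^sup>2 + (h q)\<^sup>2 - (m - 1) * (\<mu> q)\<^sup>2) * g q u u = 0"
    unfolding e using D2_commute[OF q, of u "wh q"] d_th[OF q, of u "wh q"]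
    by (simp add: u th_wh[OF q] tw_eq[OF q] al_eq[OF q] algebra_simps power2_eq_square)
  then have "D \<kappa> q (wh q) + (\<kappa> q)\<^sup>2 + (h q)\<^sup>2 - (m - 1) * (\<mu> q)\<^sup>2 = 0"
    using g_pos[OF q u(1)] by (metis mult_eq_0_iff less_irrefl)
  then show ?thesis by linarith
qed

section \<open>The differential equations along w\<close>

lemma D\<mu>_wh: "q \<in> S \<Longrightarrow> D \<mu> q (wh q) = - (a q * h q + real DIM('c) * \<mu> q * \<kappa> q)"
  using \<mu>_nonzero[of q] by (simp add: \<kappa>_def)

lemma Dh_wh: "q \<in> S \<Longrightarrow> D h q (wh q) = \<mu> q * a q"
  using h1_eq by (simp add: h1_def)

lemma Dh1_wh:
  assumes q: "q \<in> S"
  shows "D h1 q (wh q) = D \<mu> q (wh q) * a q + \<mu> q * D a q (wh q)"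
  by (rule has_rate_unique[OF rate_h1[OF q] has_rate_mult[OF rate_\<mu>[OF q] rate_a[OF q]] open_S q h1_eq])

text \<open>The normal derivative of \<open>h \<nu>\<close> along E i is th(E i) Z with Z = h1 \<nu>
  + h a \<eta>. Differentiating th(E i) gives a \<open>tw\<close> term and th(C i), and the latter
  cancels the correction by \<open>C i\<close>. What remains is the trace of \<open>tw\<close> times
  Z plus the normal derivative of Z along \<open>w\<close>; its two components are compared with the
  right side.\<close>

lemma laplace_equations:
  assumes q: "q \<in> S"
  defines "m \<equiv> real DIM('c)"
  shows "(m - 1) * \<kappa> q * h1 q + D h1 q (wh q) - h q * (a q)\<^sup>2 = (m * (h q)\<^sup>2 + lam) * h q"
    and "(m - 1) * \<kappa> q * (h q * a q) + 2 * h1 q * a q + h q * D a q (wh q) = 0"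
proof -
  obtain T E C where T: "open T" "q \<in> T" "T \<subseteq> S" "frame_on T E"
    and C: "\<And>i z. i \<in> {1..DIM('c)} \<Longrightarrow> g q (C i) z = D (\<lambda>p. D X p (E i p)) q (E i q) \<bullet> D X q z"
    and eq: "lap q E C = ((real DIM('c) * (h q)\<^sup>2 + lam) * h q) *\<^sub>R \<nu> q"
    by (rule biminimal_eq'[OF q], rule that; (assumption | blast))
  have on: "orthonormal DIM('c) (\<lambda>i. D X q (E i q))"
    and sE: "\<And>i. i \<in> {1..DIM('c)} \<Longrightarrow> smooth_on T (E i)"
    using T by (auto simp: frame_on_def)
  define Z where "Z = (\<lambda>p. h1 p *\<^sub>R \<nu> p + (h p * a p) *\<^sub>R \<eta> p)"
  have rZ: "has_rate Z q u ((D h1 q u *\<^sub>R \<nu> q + h1 q *\<^sub>R D \<nu> q u)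
      + ((D h q u * a q + h q * D a q u) *\<^sub>R \<eta> q + (h q * a q) *\<^sub>R D \<eta> q u))" for u
    unfolding Z_def
    by (rule has_rate_add[OF has_rate_scaleR[OF rate_h1[OF q] rate_\<nu>[OF q]]
        has_rate_scaleR[OF has_rate_mult[OF rate_h[OF q] rate_a[OF q]] rate_\<eta>[OF q]]])
  have \<eta>\<nu>: "\<eta> q \<bullet> \<nu> q = 0" using \<nu>\<eta>[OF q] by (simp add: inner_commute)
  \<comment> \<open>\<open>dn\<close> and \<open>de\<close> are the components of the normal
    derivative of \<open>Z\<close> along \<open>w\<close>.\<close>
  define dn where "dn = D h1 q (wh q) - h q * (a q)\<^sup>2"
  define de where "de = 2 * h1 q * a q + h q * D a q (wh q)"
  have summand: "nproj q (D (\<lambda>p. D h p (E i p) *\<^sub>R \<nu> p + (h p * om p (E i p)) *\<^sub>R \<eta> p) q (E i q))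
        - (D h q (C i) *\<^sub>R \<nu> q + (h q * om q (C i)) *\<^sub>R \<eta> q)
      = tw q (E i q) (E i q) *\<^sub>R Z q + (th q (E i q) * th q (E i q)) *\<^sub>R (dn *\<^sub>R \<nu> q + de *\<^sub>R \<eta> q)"
    if i: "i \<in> {1..DIM('c)}" for i
  proof -
    let ?u = "E i q"
    have sDX: "smooth_on T (\<lambda>p. D X p (E i p))"
      by (rule smooth_DX[OF sE[OF i] T(1,3)])
    have "has_rate (\<lambda>p. w p \<bullet> D X p (E i p)) q ?u
        (D w q ?u \<bullet> D X q (E i q) + w q \<bullet> D (\<lambda>p. D X p (E i p)) q ?u)"
      by (rule has_rate_inner[OF rate_w[OF q] has_rate_smooth[OF sDX T(2)]])
    moreover have "w q \<bullet> D (\<lambda>p. D X p (E i p)) q ?u = th q (C i)"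
      using C[OF i, of "wh q"] by (simp add: w_def th_def g_def inner_commute)
    ultimately have r1: "has_rate (\<lambda>p. th p (E i p)) q ?u (tw q ?u ?u + th q (C i))"
      by (simp add: th_def tw_def)
    let ?Z' = "(D h1 q ?u *\<^sub>R \<nu> q + h1 q *\<^sub>R D \<nu> q ?u)
      + ((D h q ?u * a q + h q * D a q ?u) *\<^sub>R \<eta> q + (h q * a q) *\<^sub>R D \<eta> q ?u)"
    have 1: "D (\<lambda>p. D h p (E i p) *\<^sub>R \<nu> p + (h p * om p (E i p)) *\<^sub>R \<eta> p) q ?u
        = (tw q ?u ?u + th q (C i)) *\<^sub>R Z q + th q ?u *\<^sub>R ?Z'"
    proof (rule trans[OF _ D_has_rate[OF has_rate_scaleR[OF r1 rZ]]])
      have "D (\<lambda>p. D h p (E i p) *\<^sub>R \<nu> p + (h p * om p (E i p)) *\<^sub>R \<eta> p) q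
          = D (\<lambda>p. th p (E i p) *\<^sub>R Z p) q"
      proof (rule D_cong(2)[OF _ T(1,2)])
        show "(\<lambda>p. th p (E i p) *\<^sub>R Z p) differentiable at q"
          by (rule has_rate_differentiable[OF has_rate_scaleR[OF r1 rZ]])
        fix p assume "p \<in> T"
        then have p: "p \<in> S" using T by blast
        show "th p (E i p) *\<^sub>R Z p = D h p (E i p) *\<^sub>R \<nu> p + (h p * om p (E i p)) *\<^sub>R \<eta> p"
          unfolding dh_eq[OF p] om_eq[OF p] Z_def by (simp add: scaleR_add_right mult.commute mult.left_commute)
      qed
      then show "D (\<lambda>p. D h p (E i p) *\<^sub>R \<nu> p + (h p * om p (E i p)) *\<^sub>R \<eta> p) q ?u
          = D (\<lambda>p. th p (E i p) *\<^sub>R Z p) q ?u" by simp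
    qed
    have 2: "nproj q (c *\<^sub>R Z q + d *\<^sub>R y) = c *\<^sub>R Z q + d *\<^sub>R nproj q y" for c d y
      by (simp add: nproj_def Z_def inner_add_left \<nu>\<nu>[OF q] \<eta>\<eta>[OF q] \<nu>\<eta>[OF q] \<eta>\<nu> scaleR_add_left scaleR_add_right)
    have 3: "nproj q ?Z' = th q ?u *\<^sub>R (dn *\<^sub>R \<nu> q + de *\<^sub>R \<eta> q)"
    proof -
      have "?Z' \<bullet> \<nu> q = th q ?u * dn"
        by (simp add: inner_add_left \<nu>\<nu>[OF q] \<eta>\<nu> D\<nu>_\<nu>[OF q] D\<eta>_\<nu>[OF q] om_eq[OF q] Dh1_eq[OF q, of ?u]
            dn_def algebra_simps power2_eq_square)
      moreover have "?Z' \<bullet> \<eta> q = th q ?u * de"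
        by (simp add: inner_add_left \<eta>\<eta>[OF q] \<nu>\<eta>[OF q] D\<eta>_\<eta>[OF q] om_def[symmetric] om_eq[OF q] Da_eq[OF q, of ?u]
            dh_eq[OF q, of ?u] de_def algebra_simps)
      ultimately show ?thesis
        unfolding nproj_def by (simp add: scaleR_add_right)
    qed
    have 4: "D h q (C i) *\<^sub>R \<nu> q + (h q * om q (C i)) *\<^sub>R \<eta> q = th q (C i) *\<^sub>R Z q"
      unfolding dh_eq[OF q] om_eq[OF q] Z_def by (simp add: scaleR_add_right mult.commute mult.left_commute)
    show ?thesis
      unfolding 1 2 3 4 by (simp add: scaleR_add_left)
  qed
  have tr: "(\<Sum>i=1..DIM('c). tw q (E i q) (E i q)) = (m - 1) * \<kappa> q"
    unfolding tw_eq[OF q] sum_distrib_left[symmetric] sum_subtractf sum_g[OF on] sum_th_square[OF q on] m_def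
    by simp
  have "((m * (h q)\<^sup>2 + lam) * h q) *\<^sub>R \<nu> q
      = (\<Sum>i=1..DIM('c). tw q (E i q) (E i q) *\<^sub>R Z q + (th q (E i q) * th q (E i q)) *\<^sub>R (dn *\<^sub>R \<nu> q + de *\<^sub>R \<eta> q))"
    unfolding m_def eq[symmetric] lap_def by (rule sum.cong[OF refl summand])
  also have "\<dots> = ((m - 1) * \<kappa> q) *\<^sub>R Z q + (dn *\<^sub>R \<nu> q + de *\<^sub>R \<eta> q)"
    unfolding sum.distrib scaleR_sum_left[symmetric] tr sum_th_square[OF q on] by simp
  finally have *: "((m * (h q)\<^sup>2 + lam) * h q) *\<^sub>R \<nu> q = ((m - 1) * \<kappa> q) *\<^sub>R Z q + (dn *\<^sub>R \<nu> q + de *\<^sub>R \<eta> q)" .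
  show "(m - 1) * \<kappa> q * h1 q + D h1 q (wh q) - h q * (a q)\<^sup>2 = (m * (h q)\<^sup>2 + lam) * h q"
    using arg_cong[OF *, of "\<lambda>y. y \<bullet> \<nu> q"]
    by (simp add: Z_def inner_add_left \<nu>\<nu>[OF q] \<eta>\<nu> dn_def)
  show "(m - 1) * \<kappa> q * (h q * a q) + 2 * h1 q * a q + h q * D a q (wh q) = 0"
    using arg_cong[OF *, of "\<lambda>y. y \<bullet> \<eta> q"]
    by (simp add: Z_def inner_add_left \<nu>\<eta>[OF q] \<eta>\<eta>[OF q] de_def)
qed

lemma inconsistent: False
proof -
  define m where "m = real DIM('c)"
  \<comment> \<open>This factor makes the field \<open>s\<close> invariant under homotheties of the
    ambient space and under the change of \<open>\<eta>\<close> to -\<eta>, like the four unknowns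
    below; the rates of the unknowns then become polynomials in these unknowns.\<close>
  define c where "c = (\<lambda>q. \<mu> q / (h q * a q))"
  define s where "s = (\<lambda>q. c q *\<^sub>R wh q)"
  have rate: "has_rate f q (s q) (c q * D f q (wh q))" if "smooth_on S f" "q \<in> S" for f :: "'c \<Rightarrow> real" and q
    using has_rate_smooth[OF that, of "s q"] linear_cmul[OF linear_D_smooth[OF that]] by (simp add: s_def)
  have Da: "D a q (wh q) = - (m - 1) * \<kappa> q * a q - 2 * \<mu> q * a q * a q / h q" if q: "q \<in> S" for q
    using laplace_equations(2)[OF q] h_nonzero[OF q] unfolding h1_eq[OF q] m_def by (simp add: field_simps)
  note r\<mu> = rate[OF smooth_\<mu>] and r\<kappa> = rate[OF smooth_\<kappa>] and ra = rate[OF smooth_a]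
  have nz: "h q \<noteq> 0" "a q \<noteq> 0" "\<mu> q \<noteq> 0" if "q \<in> S" for q
    using h_nonzero[OF that] a_nonzero[OF that] \<mu>_nonzero[OF that] by auto
  define v where "v = (\<lambda>q. (\<mu> q * \<mu> q) / (h q * h q))"
  define x where "x = (\<lambda>q. (\<mu> q * \<kappa> q) / (h q * a q))"
  define b where "b = (\<lambda>q. (h q * h q) / (a q * a q))"
  define l where "l = (\<lambda>q. lam / (a q * a q))"
  note defs = v_def x_def b_def l_def c_def m_def[symmetric]
  show False
  proof (rule rate_system_inconsistent[OF dim_c open_S nonempty m_def])
    fix q assume q: "q \<in> S"
    note nzq = nz[OF q] and rh = rate[OF smooth_h q]
    note along_w = D\<mu>_wh[OF q] D\<kappa>_wh[OF q] Dh_wh[OF q] Da[OF q]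
    show "has_rate v q (s q) (- 2 * v q * (1 + v q + m * x q))"
      by (rule has_rate_eq_rhs[OF has_rate_divide[OF has_rate_mult[OF r\<mu>[OF q] r\<mu>[OF q]] has_rate_mult[OF rh rh]], folded v_def])
         (use nzq in \<open>simp_all add: along_w defs field_simps power2_eq_square\<close>)
    show "has_rate x q (s q) (- x q + v q * x q - 2 * (x q)\<^sup>2 - v q * b q * (1 - (m - 1) * v q))"
      by (rule has_rate_eq_rhs[OF has_rate_divide[OF has_rate_mult[OF r\<mu>[OF q] r\<kappa>[OF q]] has_rate_mult[OF rh ra[OF q]]], folded x_def])
         (use nzq in \<open>simp_all add: along_w defs field_simps power2_eq_square\<close>)
    show "has_rate b q (s q) (b q * (2 * (m - 1) * x q + 6 * v q))"
      by (rule has_rate_eq_rhs[OF has_rate_divide[OF has_rate_mult[OF rh rh] has_rate_mult[OF ra[OF q] ra[OF q]]], folded b_def])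
         (use nzq in \<open>simp_all add: along_w defs field_simps power2_eq_square\<close>)
    show "has_rate l q (s q) (l q * (2 * (m - 1) * x q + 4 * v q))"
      by (rule has_rate_eq_rhs[OF has_rate_divide[OF has_rate_const[of lam] has_rate_mult[OF ra[OF q] ra[OF q]]], folded l_def])
         (use nzq in \<open>simp_all add: along_w defs field_simps power2_eq_square\<close>)
    show "2 + 2 * v q + m * x q + m * b q + l q = 0"
      using laplace_equations(1)[OF q] nzq unfolding Dh1_wh[OF q] h1_eq[OF q] D\<mu>_wh[OF q] Da[OF q]
      by (simp add: defs field_simps power2_eq_square)
    show "v q > 0" "b q > 0"
      unfolding defs by (rule divide_pos_pos; use nzq not_real_square_gt_zero in blast)+
  qed
qed

end

section \<open>Orthogonal projections\<close>

lemma orthogonal_comp_iff: "x \<in> W\<^sup>\<bottom> \<longleftrightarrow> (\<forall>y\<in>W. y \<bullet> x = 0)"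
  by (auto simp: orthogonal_comp_def orthogonal_def)

lemma orth_projI:
  assumes S: "subspace S" and w: "w \<in> S" "\<And>n. n \<in> S \<Longrightarrow> n \<bullet> v = n \<bullet> w"
  shows "orth_proj S v = w"
  unfolding orth_proj_def
proof (rule the_equality)
  show "w \<in> S \<and> v - w \<in> S\<^sup>\<bottom>"
    using w by (simp add: orthogonal_comp_iff inner_diff_right)
  fix w' assume w': "w' \<in> S \<and> v - w' \<in> S\<^sup>\<bottom>"
  then have "w - w' \<in> S" using S w subspace_diff by blast
  then have "(w - w') \<bullet> (v - w') = 0" "(w - w') \<bullet> v = (w - w') \<bullet> w"
    using w' w(2) by (auto simp: orthogonal_comp_iff)
  then have "(w - w') \<bullet> (w - w') = 0" by (simp add: inner_diff_right)
  then show "w' = w" by simp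
qed

lemma orth_proj:
  assumes S: "subspace S"
  shows orth_proj_in: "orth_proj S v \<in> S" and inner_orth_proj: "n \<in> S \<Longrightarrow> n \<bullet> orth_proj S v = n \<bullet> v"
proof -
  have "v \<in> S + S\<^sup>\<bottom>" using subspace_sum_orthogonal_comp[OF S] by simp
  then obtain w z where wz: "w \<in> S" "z \<in> S\<^sup>\<bottom>" "v = w + z" by (rule set_plus_elim)
  have e: "n \<bullet> v = n \<bullet> w" if "n \<in> S" for n
    using wz(2) that by (simp add: wz(3) inner_add_right orthogonal_comp_iff)
  have "orth_proj S v = w" by (rule orth_projI[OF S wz(1) e])
  then show "orth_proj S v \<in> S" "n \<in> S \<Longrightarrow> n \<bullet> orth_proj S v = n \<bullet> v" using wz(1) e by auto
qed

lemma orth_proj_add: "subspace S \<Longrightarrow> orth_proj S (x + y) = orth_proj S x + orth_proj S y"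
  by (rule orth_projI) (simp_all add: orth_proj_in inner_orth_proj subspace_add inner_add_right)

lemma orth_proj_scaleR: "subspace S \<Longrightarrow> orth_proj S (c *\<^sub>R x) = c *\<^sub>R orth_proj S x"
  by (rule orth_projI) (simp_all add: orth_proj_in inner_orth_proj subspace_scale)

lemma orth_proj_0: "subspace S \<Longrightarrow> orth_proj S 0 = 0"
  by (rule orth_projI) (simp_all add: subspace_0)

lemma orth_proj_sum: "subspace S \<Longrightarrow> orth_proj S (\<Sum>i\<in>I. f i) = (\<Sum>i\<in>I. orth_proj S (f i))"
  by (induction I rule: infinite_finite_induct) (simp_all add: orth_proj_0 orth_proj_add)

lemma orth_proj_UNIV: "orth_proj UNIV v = v"
  by (rule orth_projI) simp_all

section \<open>Tangent fields along an immersed patch\<close>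

context immersed_patch
begin

lemma linear_D2: 
  assumes q: "q \<in> S"
  shows "linear (\<lambda>u. D2 X q u v)" "linear (\<lambda>v. D2 X q u v)"
proof -
  have 1: "linear (\<lambda>u. D2 X q u v)" for v
    using D_linear[OF smooth_on_differentiable[OF smooth_on_D_const[OF smooth_X] q]] by simp
  have "D2 X q u v = D2 X q v u" for v
    by (rule second_derivative_symmetric[OF smooth_X open_S q])
  then show "linear (\<lambda>u. D2 X q u v)" "linear (\<lambda>v. D2 X q u v)"
    using 1 by simp_all
qed

lemma smooth_D2:
  assumes T: "open T" "T \<subseteq> S" and U: "smooth_on T U" and V: "smooth_on T V"
  shows "smooth_on T (\<lambda>p. D2 X p (U p) (V p))"
proof (rule smooth_on_cong[OF T(1)])
  show "smooth_on T (\<lambda>p. \<Sum>b\<in>Basis. (V p \<bullet> b) *\<^sub>R D (\<lambda>q. D X q b) p (U p))"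
    by (intro smooth_on_sum smooth_on_scaleR smooth_on_inner smooth_on_const smooth_on_D smooth_on_D_const
        smooth_on_subset[OF smooth_X] T U V)
  fix p assume "p \<in> T"
  then have "p \<in> S" using T by blast
  from linear_expand_Basis[OF linear_D2(2)[OF this], of "V p" "U p"]
  show "(\<Sum>b\<in>Basis. (V p \<bullet> b) *\<^sub>R D2 X p (U p) b) = D2 X p (U p) (V p)" by simp
qed

lemma rate_DX_field:
  assumes V: "V differentiable at q" and q: "q \<in> S"
  shows "has_rate (\<lambda>p. D X p (V p)) q u (D X q (D V q u) + D2 X q u (V q))"
proof -
  have b: "has_rate (\<lambda>p. V p \<bullet> b) q u (D V q u \<bullet> b)" for b
    using has_rate_inner[OF has_rate_D[OF V, of u] has_rate_const[of b]] by simp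
  have e: "D X p v = (\<Sum>b\<in>Basis. (v \<bullet> b) *\<^sub>R D X p b)" if "p \<in> S" for p v
    by (rule linear_expand_Basis[OF linear_DX[OF that]])
  have r: "has_rate (\<lambda>p. \<Sum>b\<in>B. (V p \<bullet> b) *\<^sub>R D X p b) q u
      (\<Sum>b\<in>B. (D V q u \<bullet> b) *\<^sub>R D X q b + (V q \<bullet> b) *\<^sub>R D2 X q u b)" if "finite B" for B
    using that
  proof (induction B rule: finite_induct)
    case empty
    then show ?case using has_rate_const by simp
  next
    case (insert c B)
    then show ?case
      using has_rate_add[OF has_rate_scaleR[OF b has_rate_smooth[OF smooth_on_D_const[OF smooth_X] q]] insert.IH]
      by simp
  qed
  have s: "(\<Sum>b\<in>Basis. (D V q u \<bullet> b) *\<^sub>R D X q b + (V q \<bullet> b) *\<^sub>R D2 X q u b) = D X q (D V q u) + D2 X q u (V q)"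
    unfolding sum.distrib e[OF q, of "D V q u"] linear_expand_Basis[OF linear_D2(2)[OF q], of "V q" u] ..
  obtain f' where f': "((\<lambda>p. \<Sum>b\<in>Basis. (V p \<bullet> b) *\<^sub>R D X p b) has_derivative f') (at q)"
      "f' u = D X q (D V q u) + D2 X q u (V q)"
    using r[OF finite_Basis] unfolding s has_rate_def by auto
  have "((\<lambda>p. D X p (V p)) has_derivative f') (at q)"
    by (rule has_derivative_transform_within_open[OF f'(1) open_S q]) (rule e[symmetric])
  then show ?thesis
    unfolding has_rate_def using f'(2) by auto
qed

text \<open>The coefficients in an orthonormal frame are inner products with \<open>Y\<close>, so
  the lift is smooth without inverting the derivative of \<open>X\<close>.\<close>

lemma tangent_field_lift:
  assumes T: "open T" "T \<subseteq> S" and Y: "smooth_on T Y" and tan: "\<And>y. y \<in> T \<Longrightarrow> Y y \<in> range (D X y)"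
  obtains V where "smooth_on T V" "\<And>y. y \<in> T \<Longrightarrow> D X y (V y) = Y y"
proof -
  obtain E where E: "frame_on S E" by (rule frame_exists)
  define V where "V = (\<lambda>y. \<Sum>i=1..DIM('c). (Y y \<bullet> D X y (E i y)) *\<^sub>R E i y)"
  have sE: "smooth_on T (E i)" if "i \<in> {1..DIM('c)}" for i
    using E that T smooth_on_subset unfolding frame_on_def by blast
  have "smooth_on T V"
    unfolding V_def by (intro smooth_on_sum smooth_on_scaleR smooth_on_inner smooth_DX sE T Y)
  moreover have "D X y (V y) = Y y" if y: "y \<in> T" for y
  proof -
    have yS: "y \<in> S" using T y by blast
    have on: "orthonormal DIM('c) (\<lambda>i. D X y (E i y))" using E yS unfolding frame_on_def by blast
    obtain v where v: "Y y = D X y v" using tan[OF y] by blast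
    have "V y = v"
      unfolding V_def v by (rule frame_expansion[OF yS on, unfolded g_def, symmetric])
    then show ?thesis using v by simp
  qed
  ultimately show thesis by (rule that)
qed

text \<open>Writing Y = D X V, the derivative of V enters only through a tangential term. Hence the
  normal part depends on the value of Y at the point alone, so the second fundamental form does not
  depend on the extension.\<close>

lemma D_tangent_field_normal:
  assumes T: "open T" "T \<subseteq> S" "q \<in> T" and Y: "smooth_on T Y" and tan: "\<And>y. y \<in> T \<Longrightarrow> Y y \<in> range (D X y)"
    and Yq: "Y q = D X q v" and n: "n \<in> (range (D X q))\<^sup>\<bottom>"
  shows "n \<bullet> D Y q u = n \<bullet> D2 X q u v"
proof -
  obtain V where V: "smooth_on T V" "\<And>y. y \<in> T \<Longrightarrow> D X y (V y) = Y y"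
    by (rule tangent_field_lift[OF T(1,2) Y tan], assumption, rule that; blast)
  have q: "q \<in> S" using T by blast
  have "V q = v"
    using V(2)[OF T(3)] Yq inj_DX[OF q] by (simp add: inj_eq)
  moreover have "D X q (D V q u) + D2 X q u (V q) = D Y q u"
    by (rule has_rate_unique[OF rate_DX_field[OF smooth_on_differentiable[OF V(1) T(3)] q]
        has_rate_smooth[OF Y T(3)] T(1,3) V(2)])
  moreover have "n \<bullet> D X q (D V q u) = 0"
    using n by (simp add: orthogonal_comp_iff inner_commute)
  ultimately show ?thesis by (metis add_0 inner_add_right)
qed

end

section \<open>Geometry of a submanifold in a chart\<close>

locale submanifold =
  fixes M :: "('a, 'c::euclidean_space, 'e::euclidean_space) submfd"
  assumes immersed: "immersed_submanifold M"
begin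

lemma manifold: "smooth_manifold (mtop M) (atlas M)"
  using immersed by (simp add: immersed_submanifold_def)

definition dom :: "('a, 'c) chart \<Rightarrow> 'c set" where "dom c = snd c ` fst c"

abbreviation XX :: "('a, 'c) chart \<Rightarrow> 'c \<Rightarrow> 'e" where "XX c \<equiv> in_chart c (imm M)"

abbreviation dX :: "('a, 'c) chart \<Rightarrow> 'a \<Rightarrow> 'c \<Rightarrow> 'e" where "dX c p \<equiv> D (XX c) (snd c p)"

abbreviation d2X :: "('a, 'c) chart \<Rightarrow> 'a \<Rightarrow> 'c \<Rightarrow> 'c \<Rightarrow> 'e" where
  "d2X c p u v \<equiv> D2 (XX c) (snd c p) u v"

section \<open>Topology of charts and change of charts\<close>

lemma chart_open: "c \<in> atlas M \<Longrightarrow> openin (mtop M) (fst c)" (is "?c \<Longrightarrow> ?o")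
  and open_dom: "c \<in> atlas M \<Longrightarrow> open (dom c)" (is "_ \<Longrightarrow> ?d")
  and chart_homeo: "c \<in> atlas M \<Longrightarrow> homeomorphic_map (subtopology (mtop M) (fst c)) (top_of_set (dom c)) (snd c)"
    (is "_ \<Longrightarrow> ?h")
proof -
  have *: "\<forall>(U, \<phi>)\<in>atlas M. openin (mtop M) U \<and> open (\<phi> ` U) \<and>
      homeomorphic_map (subtopology (mtop M) U) (top_of_set (\<phi> ` U)) \<phi>"
    using manifold unfolding smooth_manifold_def by (elim conjE)
  show "?c \<Longrightarrow> ?o" "?c \<Longrightarrow> ?d" "?c \<Longrightarrow> ?h"
    using bspec[OF *[unfolded case_prod_unfold], of c] unfolding dom_def by blast+
qed

lemma chart_cover: "p \<in> topspace (mtop M) \<Longrightarrow> \<exists>c\<in>atlas M. p \<in> fst c"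
  using manifold unfolding smooth_manifold_def by blast

lemma chart_subset: "c \<in> atlas M \<Longrightarrow> fst c \<subseteq> topspace (mtop M)"
  using chart_open openin_subset by blast

lemma chart_inj: "c \<in> atlas M \<Longrightarrow> inj_on (snd c) (fst c)"
  using homeomorphic_imp_injective_map[OF chart_homeo] chart_subset
  by (metis inf.absorb_iff2 topspace_subtopology)

lemma in_chart_at: "c \<in> atlas M \<Longrightarrow> p \<in> fst c \<Longrightarrow> in_chart c F (snd c p) = F p"
  by (simp add: in_chart_def chart_inj)

lemma snd_in_dom: "p \<in> fst c \<Longrightarrow> snd c p \<in> dom c"
  by (simp add: dom_def)

lemma open_chart_image:
  assumes c: "c \<in> atlas M" and W: "openin (mtop M) W"
  shows "open (snd c ` (fst c \<inter> W))"
proof -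
  have "openin (subtopology (mtop M) (fst c)) (fst c \<inter> W)"
    using W by (metis inf_commute openin_subtopology_Int)
  then have "openin (top_of_set (dom c)) (snd c ` (fst c \<inter> W))"
    using homeomorphic_imp_open_map[OF chart_homeo[OF c]] unfolding open_map_def by blast
  then show ?thesis
    using open_dom[OF c] openin_open_eq by blast
qed

lemma open_chart_vimage:
  assumes c: "c \<in> atlas M" and T: "open T"
  shows "openin (mtop M) {p \<in> fst c. snd c p \<in> T}"
proof -
  have "continuous_map (subtopology (mtop M) (fst c)) (top_of_set (dom c)) (snd c)"
    using homeomorphic_imp_continuous_map[OF chart_homeo[OF c]] .
  then have "continuous_map (subtopology (mtop M) (fst c)) euclidean (snd c)"
    by (simp add: continuous_map_in_subtopology)
  then have "openin (subtopology (mtop M) (fst c)) {p \<in> topspace (subtopology (mtop M) (fst c)). snd c p \<in> T}"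
    using T by (intro openin_continuous_map_preimage) auto
  moreover have "topspace (subtopology (mtop M) (fst c)) = fst c"
    using chart_subset[OF c] by auto
  ultimately have "openin (subtopology (mtop M) (fst c)) {p \<in> fst c. snd c p \<in> T}" by metis
  then show ?thesis
    by (rule openin_trans_full[OF _ chart_open[OF c]])
qed

lemma transition_smooth:
  assumes "c \<in> atlas M" "d \<in> atlas M"
  shows "smooth_on (snd c ` (fst c \<inter> fst d)) (in_chart c (snd d))"
proof -
  have "\<forall>(U, \<phi>)\<in>atlas M. \<forall>(V, \<psi>)\<in>atlas M. smooth_on (\<phi> ` (U \<inter> V)) (in_chart (U, \<phi>) \<psi>)"
    using manifold unfolding smooth_manifold_def by blast
  from bspec[OF bspec[OF this assms(1), unfolded case_prod_unfold] assms(2)]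
  show ?thesis by simp
qed

lemma in_chart_transition:
  assumes c: "c \<in> atlas M" and d: "d \<in> atlas M" and y: "y \<in> snd d ` (fst d \<inter> fst c)"
  shows "in_chart c F (in_chart d (snd c) y) = in_chart d F y"
  using y by (auto simp: in_chart_at[OF c] in_chart_at[OF d])

lemma smooth_map_in_chart:
  assumes "smooth_map_on M W F" "c \<in> atlas M"
  shows "smooth_on (snd c ` (fst c \<inter> W)) (in_chart c F)"
  using bspec[OF assms(1)[unfolded smooth_map_on_def] assms(2)] by (simp add: case_prod_unfold)

lemma smooth_map_from_chart:
  assumes c: "c \<in> atlas M" and F: "smooth_on (snd c ` W) (in_chart c F)" and W: "W \<subseteq> fst c" "openin (mtop M) W"
  shows "smooth_map_on M W F"
  unfolding smooth_map_on_def case_prod_unfold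
proof
  fix d assume d: "d \<in> atlas M"
  have o: "open (snd d ` (fst d \<inter> W))" by (rule open_chart_image[OF d W(2)])
  have s: "smooth_on (snd d ` (fst d \<inter> W)) (in_chart d (snd c))"
    by (rule smooth_on_subset[OF transition_smooth[OF d c]]) (use W in auto)
  have oW: "open (snd c ` W)"
    using open_chart_image[OF c W(2)] W(1) by (simp add: inf.absorb2)
  have im: "in_chart d (snd c) ` (snd d ` (fst d \<inter> W)) \<subseteq> snd c ` W"
    by (auto simp: in_chart_at[OF d])
  show "smooth_on (snd d ` (fst d \<inter> W)) (in_chart (fst d, snd d) F)"
    by (rule smooth_on_cong[OF o smooth_on_compose[OF o oW im F s]])
       (use W in \<open>auto simp: in_chart_at[OF d] in_chart_at[OF c]\<close>)
qed

lemma smooth_XX: "c \<in> atlas M \<Longrightarrow> smooth_on (dom c) (XX c)"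
  using smooth_map_in_chart[of "topspace (mtop M)" "imm M" c] immersed chart_subset[of c]
  by (simp add: immersed_submanifold_def dom_def inf.absorb1)

lemma patch: "c \<in> atlas M \<Longrightarrow> immersed_patch (dom c) (XX c)"
proof
  assume c: "c \<in> atlas M"
  show "open (dom c)" "smooth_on (dom c) (XX c)" by (rule open_dom[OF c], rule smooth_XX[OF c])
  fix q assume "q \<in> dom c"
  then obtain p where p: "p \<in> fst c" "q = snd c p" by (auto simp: dom_def)
  have "\<forall>(U, \<phi>)\<in>atlas M. \<forall>p\<in>U. inj (D (in_chart (U, \<phi>) (imm M)) (\<phi> p))"
    using immersed by (simp add: immersed_submanifold_def)
  from bspec[OF bspec[OF this c, unfolded case_prod_unfold] p(1)] show "inj (D (XX c) q)"
    by (simp add: p)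
qed

section \<open>Tangent vectors and derivatives in an arbitrary chart\<close>

lemma chart_around:
  assumes "p \<in> topspace (mtop M)"
  shows "chart_around M p \<in> atlas M" "p \<in> fst (chart_around M p)"
proof -
  have "\<exists>c. c \<in> atlas M \<and> p \<in> fst c" using chart_cover[OF assms] by blast
  from someI_ex[OF this] show "chart_around M p \<in> atlas M" "p \<in> fst (chart_around M p)"
    unfolding chart_around_def by auto
qed

text \<open>\<open>L\<close> is the derivative of the transition map, invertible with the derivative
  of the reverse transition as inverse. It is the same for every \<open>F\<close>, so passing from
  the chosen chart to \<open>c\<close> changes all differentials by one linear isomorphism.\<close>

lemma differential_chart:
  assumes c: "c \<in> atlas M" and p: "p \<in> fst c"
  obtains L where "surj L" "inj L" "\<And>F :: 'a \<Rightarrow> 'e. in_chart c F differentiable at (snd c p) \<Longrightarrow>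
      differential M F p = D (in_chart c F) (snd c p) \<circ> L"
proof -
  have pM: "p \<in> topspace (mtop M)" using chart_subset[OF c] p by blast
  define d where "d = chart_around M p"
  have d: "d \<in> atlas M" "p \<in> fst d" using chart_around[OF pM] by (auto simp: d_def)
  define t where "t = in_chart d (snd c)"
  define t' where "t' = in_chart c (snd d)"
  have tp: "t (snd d p) = snd c p" "t' (snd c p) = snd d p"
    using in_chart_at[OF d, of "snd c"] in_chart_at[OF c p, of "snd d"] by (auto simp: t_def t'_def)
  have o: "open (snd d ` (fst d \<inter> fst c))" "open (snd c ` (fst c \<inter> fst d))"
    using open_chart_image[OF d(1) chart_open[OF c]] open_chart_image[OF c chart_open[OF d(1)]] .
  have mem: "snd d p \<in> snd d ` (fst d \<inter> fst c)" "snd c p \<in> snd c ` (fst c \<inter> fst d)" using d p by auto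
  have dt: "t differentiable at (snd d p)" "t' differentiable at (snd c p)"
    unfolding t_def t'_def
    by (rule smooth_on_differentiable[OF transition_smooth[OF d(1) c] mem(1)],
        rule smooth_on_differentiable[OF transition_smooth[OF c d(1)] mem(2)])
  define L where "L = D t (snd d p)"
  define L' where "L' = D t' (snd c p)"
  have h: "((\<lambda>y. t' (t y)) has_derivative (\<lambda>u. L' (L u))) (at (snd d p))"
    unfolding L_def L'_def
    by (rule has_derivative_compose[OF D_works[OF dt(1)], unfolded tp, OF D_works[OF dt(2)]])
  have h': "((\<lambda>y. t (t' y)) has_derivative (\<lambda>u. L (L' u))) (at (snd c p))"
    unfolding L_def L'_def
    by (rule has_derivative_compose[OF D_works[OF dt(2)], unfolded tp, OF D_works[OF dt(1)]])
  have "((\<lambda>y. y) has_derivative (\<lambda>u. L' (L u))) (at (snd d p))"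
    by (rule has_derivative_transform_within_open[OF h o(1) mem(1)])
       (auto simp: t_def t'_def in_chart_at[OF d(1)] in_chart_at[OF c])
  then have 1: "L' (L u) = u" for u
    using has_derivative_unique[OF _ has_derivative_ident] by metis
  have "((\<lambda>y. y) has_derivative (\<lambda>u. L (L' u))) (at (snd c p))"
    by (rule has_derivative_transform_within_open[OF h' o(2) mem(2)])
       (auto simp: t_def t'_def in_chart_at[OF d(1)] in_chart_at[OF c])
  then have 2: "L (L' u) = u" for u
    using has_derivative_unique[OF _ has_derivative_ident] by metis
  show thesis
  proof (rule that)
    show "surj L" using 2 by (metis surjI)
    show "inj L" using 1 by (metis injI)
    fix F :: "'a \<Rightarrow> 'e"
    assume F: "in_chart c F differentiable at (snd c p)"
    have "((\<lambda>y. in_chart c F (t y)) has_derivative (\<lambda>u. D (in_chart c F) (snd c p) (L u))) (at (snd d p))"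
      unfolding L_def
      by (rule has_derivative_compose[OF D_works[OF dt(1)], unfolded tp, OF D_works[OF F]])
    then have "(in_chart d F has_derivative (\<lambda>u. D (in_chart c F) (snd c p) (L u))) (at (snd d p))"
      by (rule has_derivative_transform_within_open[OF _ o(1) mem(1)])
         (simp add: t_def in_chart_transition[OF c d(1)])
    then show "differential M F p = D (in_chart c F) (snd c p) \<circ> L"
      unfolding differential_def d_def[symmetric] by (simp add: D_eqI o_def)
  qed
qed

lemma tangent_space_chart:
  assumes c: "c \<in> atlas M" and p: "p \<in> fst c"
  shows "tangent_space M p = range (dX c p)"
proof -
  obtain L where L: "surj L" "\<And>F :: 'a \<Rightarrow> 'e. in_chart c F differentiable at (snd c p) \<Longrightarrow>
      differential M F p = D (in_chart c F) (snd c p) \<circ> L"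
    using differential_chart[OF c p] by metis
  have "XX c differentiable at (snd c p)"
    by (rule smooth_on_differentiable[OF smooth_XX[OF c] snd_in_dom[OF p]])
  show ?thesis
    unfolding tangent_space_def L(2)[OF \<open>XX c differentiable at (snd c p)\<close>] image_comp[symmetric] L(1) ..
qed

text \<open>The isomorphism \<open>L\<close> occurs in the differential of \<open>F\<close> and in
  that of the immersion, and cancels in the quotient.\<close>

lemma dderiv_chart:
  fixes F :: "'a \<Rightarrow> 'e"
  assumes c: "c \<in> atlas M" and p: "p \<in> fst c" and F: "in_chart c F differentiable at (snd c p)"
  shows "dderiv M (dX c p u) F p = D (in_chart c F) (snd c p) u"
proof -
  obtain L where L: "surj L" "inj L" "\<And>F :: 'a \<Rightarrow> 'e. in_chart c F differentiable at (snd c p) \<Longrightarrow>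
      differential M F p = D (in_chart c F) (snd c p) \<circ> L"
    by (rule differential_chart[OF c p], rule that; blast)
  have X: "XX c differentiable at (snd c p)"
    by (rule smooth_on_differentiable[OF smooth_XX[OF c] snd_in_dom[OF p]])
  obtain v where v: "u = L v" using L(1) by blast
  have "inj (dX c p \<circ> L)"
    using L(2) immersed_patch.inj_DX[OF patch[OF c] snd_in_dom[OF p]] by (rule inj_compose[rotated])
  then have "inv (dX c p \<circ> L) (dX c p u) = v"
    by (rule inv_f_eq) (simp add: v)
  then show ?thesis
    unfolding dderiv_def L(3)[OF X] L(3)[OF F] by (simp add: v)
qed

lemma subspace_tangent: "p \<in> topspace (mtop M) \<Longrightarrow> subspace (tangent_space M p)"
  using chart_cover tangent_space_chart immersed_patch.subspace_range_DX[OF patch] snd_in_dom by metis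

lemma subspace_normal: "subspace (TN (imm M p)) \<Longrightarrow> subspace (normal_space TN M p)"
  unfolding normal_space_def by (intro subspace_inter subspace_orthogonal_comp)

lemma field_from_chart:
  assumes c: "c \<in> atlas M" and V: "smooth_on (dom c) V"
  shows "tangent_field M (fst c) (\<lambda>q. dX c q (V (snd c q)))"
  unfolding tangent_field_def
proof
  show "smooth_map_on M (fst c) (\<lambda>q. dX c q (V (snd c q)))"
  proof (rule smooth_map_from_chart[OF c _ subset_refl chart_open[OF c]])
    show "smooth_on (snd c ` fst c) (in_chart c (\<lambda>q. dX c q (V (snd c q))))"
      by (rule smooth_on_cong[OF open_dom[OF c, unfolded dom_def] immersed_patch.smooth_DX[OF patch[OF c] V open_dom[OF c] subset_refl, unfolded dom_def]])
         (auto simp: in_chart_at[OF c])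
  qed
  show "\<forall>q\<in>fst c. dX c q (V (snd c q)) \<in> tangent_space M q"
    using tangent_space_chart[OF c] by auto
qed

section \<open>Second fundamental form, frames and mean curvature in a chart\<close>

lemma extension:
  assumes p: "p \<in> topspace (mtop M)" and w: "w \<in> tangent_space M p"
  shows "\<exists>W. openin (mtop M) W \<and> p \<in> W \<and> tangent_field M W (extension M p w) \<and> extension M p w p = w"
proof -
  obtain c where c: "c \<in> atlas M" "p \<in> fst c" using chart_cover[OF p] by blast
  obtain u where u: "w = dX c p u" using w tangent_space_chart[OF c] by blast
  \<comment> \<open>The field with constant coordinates \<open>u\<close> shows that the choice in
    \<open>extension\<close> has a candidate.\<close>
  have "\<exists>Y W. openin (mtop M) W \<and> p \<in> W \<and> tangent_field M W Y \<and> Y p = w"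
    using field_from_chart[OF c(1) smooth_on_const] chart_open[OF c(1)] c(2) u by blast
  from someI_ex[OF this] show ?thesis unfolding extension_def .
qed

lemma field_in_chart:
  assumes c: "c \<in> atlas M" and W: "openin (mtop M) W" and Y: "tangent_field M W Y"
  shows "open (snd c ` (fst c \<inter> W))" "snd c ` (fst c \<inter> W) \<subseteq> dom c" "smooth_on (snd c ` (fst c \<inter> W)) (in_chart c Y)"
    "\<And>y. y \<in> snd c ` (fst c \<inter> W) \<Longrightarrow> in_chart c Y y \<in> range (D (XX c) y)"
proof -
  show "open (snd c ` (fst c \<inter> W))" by (rule open_chart_image[OF c W])
  show "snd c ` (fst c \<inter> W) \<subseteq> dom c" by (auto simp: dom_def)
  show "smooth_on (snd c ` (fst c \<inter> W)) (in_chart c Y)"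
    by (rule smooth_map_in_chart[OF _ c]) (use Y in \<open>simp add: tangent_field_def\<close>)
  fix y assume "y \<in> snd c ` (fst c \<inter> W)"
  then obtain q where q: "q \<in> fst c" "q \<in> W" "y = snd c q" by blast
  have "Y q \<in> tangent_space M q"
    using Y q(2) by (simp add: tangent_field_def)
  then show "in_chart c Y y \<in> range (D (XX c) y)"
    unfolding tangent_space_chart[OF c q(1)] q(3) in_chart_at[OF c q(1)] .
qed

text \<open>\<open>D_tangent_field_normal\<close> disposes of the chosen extension; the two nested
  projections act as one because the normal space lies inside the tangent space of the ambient
  manifold.\<close>

lemma second_ff_chart:
  assumes c: "c \<in> atlas M" and p: "p \<in> fst c" and TN: "subspace (TN (imm M p))"
  shows "second_ff TN M p (dX c p u) (dX c p v)
    = orth_proj (normal_space TN M p) (d2X c p u v)"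
proof -
  have pM: "p \<in> topspace (mtop M)" using chart_subset[OF c] p by blast
  let ?Y = "extension M p (dX c p v)"
  obtain W where W: "openin (mtop M) W" "p \<in> W" "tangent_field M W ?Y" "?Y p = dX c p v"
    using extension[OF pM, of "dX c p v"] tangent_space_chart[OF c p] by blast
  note f = field_in_chart[OF c W(1,3)]
  have mem: "snd c p \<in> snd c ` (fst c \<inter> W)" using p W by blast
  have dY: "in_chart c ?Y differentiable at (snd c p)"
    by (rule smooth_on_differentiable[OF f(3) mem])
  have n: "n \<bullet> D (in_chart c ?Y) (snd c p) u = n \<bullet> d2X c p u v" if "n \<in> normal_space TN M p" for n
    by (rule immersed_patch.D_tangent_field_normal[OF patch[OF c] f(1,2) mem f(3,4)])
       (use that W(4) in_chart_at[OF c p, of ?Y] tangent_space_chart[OF c p] in \<open>auto simp: normal_space_def\<close>)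
  show ?thesis
    unfolding second_ff_def ambient_conn_def dderiv_chart[OF c p dY]
  proof (rule orth_projI)
    show "orth_proj (normal_space TN M p) (d2X c p u v) \<in> normal_space TN M p"
      by (rule orth_proj_in[OF subspace_normal[where TN = TN, OF TN]])
    fix k assume k: "k \<in> normal_space TN M p"
    then have "k \<in> TN (imm M p)" by (simp add: normal_space_def)
    then show "k \<bullet> orth_proj (TN (imm M p)) (D (in_chart c ?Y) (snd c p) u)
        = k \<bullet> orth_proj (normal_space TN M p) (d2X c p u v)"
      by (simp add: inner_orth_proj[OF TN] inner_orth_proj[OF subspace_normal[where TN = TN, OF TN] k] n[OF k])
  qed (rule subspace_normal[where TN = TN, OF TN])
qed

lemma frame_around_exists:
  assumes p: "p \<in> topspace (mtop M)"
  shows "\<exists>W. openin (mtop M) W \<and> p \<in> W \<and> local_orthonormal_frame M W (frame_around M p)"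
proof -
  obtain c where c: "c \<in> atlas M" "p \<in> fst c" using chart_cover[OF p] by blast
  obtain E where E: "immersed_patch.frame_on (XX c) (dom c) E"
    by (rule immersed_patch.frame_exists[OF patch[OF c(1)]])
  note E = E[unfolded immersed_patch.frame_on_def[OF patch[OF c(1)]]]
  have "local_orthonormal_frame M (fst c) (\<lambda>i q. dX c q (E i (snd c q)))"
    unfolding local_orthonormal_frame_def
  proof (intro conjI ballI)
    fix i assume "i \<in> {1..DIM('c)}"
    then have "smooth_on (dom c) (E i)" using E by blast
    then show "tangent_field M (fst c) (\<lambda>q. dX c q (E i (snd c q)))"
      by (rule field_from_chart[OF c(1)])
  next
    fix q i j assume *: "q \<in> fst c" "i \<in> {1..DIM('c)}" "j \<in> {1..DIM('c)}"
    then have "orthonormal DIM('c) (\<lambda>i. dX c q (E i (snd c q)))"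
      using E snd_in_dom by blast
    with * show "dX c q (E i (snd c q)) \<bullet> dX c q (E j (snd c q)) = (if i = j then 1 else 0)"
      unfolding orthonormal_def by blast
  qed
  then have "\<exists>e W. openin (mtop M) W \<and> p \<in> W \<and> local_orthonormal_frame M W e"
    using chart_open[OF c(1)] c(2) by blast
  from someI_ex[OF this] show ?thesis unfolding frame_around_def .
qed

lemma frame_around_chart:
  assumes c: "c \<in> atlas M" and p: "p \<in> fst c"
  obtains T E where "open T" "snd c p \<in> T" "T \<subseteq> dom c" "immersed_patch.frame_on (XX c) T E"
    "\<And>i q. i \<in> {1..DIM('c)} \<Longrightarrow> q \<in> fst c \<Longrightarrow> snd c q \<in> T \<Longrightarrow>
      frame_around M p i q = dX c q (E i (snd c q))"
    "\<And>i. i \<in> {1..DIM('c)} \<Longrightarrow> smooth_on T (in_chart c (frame_around M p i))"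
proof -
  interpret immersed_patch "dom c" "XX c" by (rule patch[OF c])
  have pM: "p \<in> topspace (mtop M)" using chart_subset[OF c] p by blast
  obtain W where W: "openin (mtop M) W" "p \<in> W" "local_orthonormal_frame M W (frame_around M p)"
    using frame_around_exists[OF pM] by blast
  have e: "tangent_field M W (frame_around M p i)" if "i \<in> {1..DIM('c)}" for i
    using W(3) that unfolding local_orthonormal_frame_def by blast
  define T where "T = snd c ` (fst c \<inter> W)"
  have "\<exists>V. smooth_on T V \<and> (\<forall>y\<in>T. D (XX c) y (V y) = in_chart c (frame_around M p i) y)" if i: "i \<in> {1..DIM('c)}" for i
    using tangent_field_lift[OF field_in_chart[OF c W(1) e[OF i]]] unfolding T_def by metis
  then obtain E where E: "\<And>i. i \<in> {1..DIM('c)} \<Longrightarrow> smooth_on T (E i)"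
    "\<And>i y. i \<in> {1..DIM('c)} \<Longrightarrow> y \<in> T \<Longrightarrow> D (XX c) y (E i y) = in_chart c (frame_around M p i) y"
    by metis
  have T: "open T" "T \<subseteq> dom c" "snd c p \<in> T"
    using open_chart_image[OF c W(1)] p W(2) by (auto simp: T_def dom_def)
  have mem: "q \<in> W" if q: "q \<in> fst c" "snd c q \<in> T" for q
    using q inj_onD[OF chart_inj[OF c]] by (auto simp: T_def)
  have eq: "frame_around M p i q = dX c q (E i (snd c q))" if "i \<in> {1..DIM('c)}" "q \<in> fst c" "snd c q \<in> T" for i q
    using E(2)[OF that(1,3)] in_chart_at[OF c that(2), of "frame_around M p i"] by simp
  have "frame_on T E"
    unfolding frame_on_def
  proof (intro conjI ballI)
    fix y assume "y \<in> T"
    then obtain q where q: "q \<in> fst c" "q \<in> W" "y = snd c q" by (auto simp: T_def)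
    show "orthonormal DIM('c) (\<lambda>i. D (XX c) y (E i y))"
      unfolding orthonormal_def
    proof (intro ballI)
      fix i j assume ij: "i \<in> {1..DIM('c)}" "j \<in> {1..DIM('c)}"
      then have "frame_around M p i q \<bullet> frame_around M p j q = (if i = j then 1 else 0)"
        using W(3) q(2) unfolding local_orthonormal_frame_def by blast
      then show "D (XX c) y (E i y) \<bullet> D (XX c) y (E j y) = (if i = j then 1 else 0)"
        using eq ij q \<open>y \<in> T\<close> by simp
    qed
  qed (rule E(1))
  moreover have "smooth_on T (in_chart c (frame_around M p i))" if "i \<in> {1..DIM('c)}" for i
    using field_in_chart(3)[OF c W(1) e[OF that]] by (simp add: T_def)
  ultimately show thesis
    using T eq by (intro that[of T E]) auto
qed

text \<open>\<open>TN\<close> is left general because the result serves both for Euclidean space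
  and, in the last part, for the hypersphere.\<close>

lemma mean_curvature_chart:
  assumes c: "c \<in> atlas M" and p: "p \<in> fst c" and TN: "subspace (TN (imm M p))"
    and E: "orthonormal DIM('c) (\<lambda>i. dX c p (E i))"
  shows "real DIM('c) *\<^sub>R mean_curvature TN M p
    = orth_proj (normal_space TN M p) (\<Sum>i=1..DIM('c). d2X c p (E i) (E i))"
proof -
  interpret immersed_patch "dom c" "XX c" by (rule patch[OF c])
  note q = snd_in_dom[OF p]
  obtain T E' where T: "open T" "snd c p \<in> T" "T \<subseteq> dom c" "frame_on T E'"
    and e: "\<And>i q. i \<in> {1..DIM('c)} \<Longrightarrow> q \<in> fst c \<Longrightarrow> snd c q \<in> T \<Longrightarrow>
      frame_around M p i q = dX c q (E' i (snd c q))"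
    by (rule frame_around_chart[OF c p], rule that; (assumption | blast))
  define b where "b = (\<lambda>u v. orth_proj (normal_space TN M p) (d2X c p u v))"
  note s = subspace_normal[where TN = TN, OF TN]
  have "linear (\<lambda>u. b u v)" "linear (b u)" for u v
    unfolding b_def
    by (intro linearI; simp add: linear_add[OF linear_D2(1)[OF q]] linear_cmul[OF linear_D2(1)[OF q]]
        linear_add[OF linear_D2(2)[OF q]] linear_cmul[OF linear_D2(2)[OF q]] orth_proj_add[OF s] orth_proj_scaleR[OF s])+
  moreover have "orthonormal DIM('c) (\<lambda>i. dX c p (E' i (snd c p)))"
    using T by (simp add: frame_on_def)
  ultimately have "(\<Sum>i=1..DIM('c). b (E' i (snd c p)) (E' i (snd c p))) = (\<Sum>i=1..DIM('c). b (E i) (E i))"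
    using E by (intro trace_independent[OF q])
  moreover have "real DIM('c) *\<^sub>R mean_curvature TN M p = (\<Sum>i=1..DIM('c). b (E' i (snd c p)) (E' i (snd c p)))"
    unfolding mean_curvature_def Let_def b_def
    using e[OF _ p T(2)] by (simp add: second_ff_chart[where TN = TN, OF c p TN])
  ultimately show ?thesis
    unfolding orth_proj_sum[OF s] b_def by simp
qed

end

section \<open>Pseudo-umbilical biminimal submanifolds\<close>

lemma subspace_euclidean_tangent: "subspace (euclidean_tangent x)"
  by (simp add: euclidean_tangent_def)

locale pseudo_umbilical_biminimal = submanifold M
  for M :: "('a, 'c::euclidean_space, 'e::euclidean_space) submfd" +
  fixes lam :: real
  assumes dim_c: "DIM('c) \<ge> 3" and dim_e: "DIM('e) = DIM('c) + 2"
    and pseudo_umbilical: "pseudo_umbilical euclidean_tangent M"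
    and biminimal: "biminimal euclidean_tangent M 0 lam"
begin

section \<open>The hypotheses in a chart\<close>

abbreviation H :: "'a \<Rightarrow> 'e" where "H \<equiv> mean_curvature euclidean_tangent M"

abbreviation nspace :: "'a \<Rightarrow> 'e set" where "nspace \<equiv> normal_space euclidean_tangent M"

abbreviation sff :: "'a \<Rightarrow> 'e \<Rightarrow> 'e \<Rightarrow> 'e" where "sff \<equiv> second_ff euclidean_tangent M"

abbreviation shape :: "'a \<Rightarrow> 'e \<Rightarrow> 'e \<Rightarrow> 'e" where "shape \<equiv> shape_op euclidean_tangent M"

abbreviation nconn :: "'e \<Rightarrow> ('a \<Rightarrow> 'e) \<Rightarrow> 'a \<Rightarrow> 'e" where "nconn \<equiv> normal_conn euclidean_tangent M"

lemma subspace_nspace: "subspace (nspace p)"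
  by (rule subspace_normal[where TN = euclidean_tangent, OF subspace_euclidean_tangent])

lemma nspace_iff:
  assumes "c \<in> atlas M" "p \<in> fst c"
  shows "n \<in> nspace p \<longleftrightarrow> (\<forall>u. n \<bullet> dX c p u = 0)"
  unfolding normal_space_def tangent_space_chart[OF assms]
  by (auto simp: euclidean_tangent_def orthogonal_comp_iff inner_commute)

lemmas sff = second_ff_chart[where TN = euclidean_tangent, OF _ _ subspace_euclidean_tangent]
  and mean_curvature = mean_curvature_chart[where TN = euclidean_tangent, OF _ _ subspace_euclidean_tangent]

lemma H_eq:
  assumes "c \<in> atlas M" "p \<in> fst c" "orthonormal DIM('c) (\<lambda>i. dX c p (E i))"
  shows "H p = (1 / real DIM('c)) *\<^sub>R orth_proj (nspace p) (\<Sum>i=1..DIM('c). d2X c p (E i) (E i))"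
  unfolding mean_curvature[OF assms, symmetric] by simp

lemma H_normal:
  assumes c: "c \<in> atlas M" and p: "p \<in> fst c"
  shows "H p \<in> nspace p"
proof -
  interpret immersed_patch "dom c" "XX c" by (rule patch[OF c])
  obtain E where "frame_on (dom c) E" by (rule frame_exists)
  then have E: "orthonormal DIM('c) (\<lambda>i. dX c p (E i (snd c p)))"
    using snd_in_dom[OF p] by (simp add: frame_on_def)
  show ?thesis
    unfolding H_eq[OF c p E] by (intro subspace_scale subspace_nspace orth_proj_in)
qed

lemma H_trace:
  assumes "c \<in> atlas M" "p \<in> fst c" "orthonormal DIM('c) (\<lambda>i. dX c p (E i))" and n: "n \<in> nspace p"
  shows "(\<Sum>i=1..DIM('c). n \<bullet> d2X c p (E i) (E i)) = real DIM('c) * (n \<bullet> H p)"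
  using arg_cong[OF mean_curvature[OF assms(1-3)], of "\<lambda>y. n \<bullet> y"]
  by (simp add: inner_orth_proj[OF subspace_nspace n] inner_sum_right)

text \<open>Subtracting the components along a smooth tangent frame expresses the normal projection
  by visibly smooth terms.\<close>

lemma smooth_H:
  assumes c: "c \<in> atlas M"
  shows "smooth_on (dom c) (in_chart c H)"
proof -
  interpret immersed_patch "dom c" "XX c" by (rule patch[OF c])
  obtain E where E: "frame_on (dom c) E" by (rule frame_exists)
  have sE: "smooth_on (dom c) (E i)" if "i \<in> {1..DIM('c)}" for i
    using E that by (simp add: frame_on_def)
  define Z where "Z = (\<lambda>y. \<Sum>i=1..DIM('c). D2 (XX c) y (E i y) (E i y))"
  have sZ: "smooth_on (dom c) Z"
    unfolding Z_def by (intro smooth_on_sum smooth_D2 sE open_S subset_refl)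
  have "smooth_on (dom c) (\<lambda>y. (1 / real DIM('c)) *\<^sub>R
      (Z y - (\<Sum>i=1..DIM('c). (Z y \<bullet> D (XX c) y (E i y)) *\<^sub>R D (XX c) y (E i y))))"
    by (intro smooth_on_scaleR smooth_on_const smooth_on_diff smooth_on_sum smooth_on_inner smooth_DX sZ sE open_S subset_refl)
  then show ?thesis
  proof (rule smooth_on_cong[OF open_S])
    fix y assume y: "y \<in> dom c"
    then obtain p where p: "p \<in> fst c" "y = snd c p" by (auto simp: dom_def)
    have on: "orthonormal DIM('c) (\<lambda>i. D (XX c) y (E i y))" using E y by (simp add: frame_on_def)
    let ?W = "Z y - (\<Sum>i=1..DIM('c). (Z y \<bullet> D (XX c) y (E i y)) *\<^sub>R D (XX c) y (E i y))"
    have "orth_proj (nspace p) (Z y) = ?W"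
    proof (rule orth_projI[OF subspace_nspace])
      have "?W \<bullet> D (XX c) y u = 0" for u by (rule normal_remainder[OF y on])
      then show "?W \<in> nspace p" unfolding nspace_iff[OF c p(1)] p(2) by blast
      fix n assume "n \<in> nspace p"
      then have "n \<bullet> D (XX c) y u = 0" for u unfolding nspace_iff[OF c p(1)] p(2) by blast
      then show "n \<bullet> Z y = n \<bullet> ?W" by (simp add: inner_diff_right inner_sum_right)
    qed
    then show "(1 / real DIM('c)) *\<^sub>R ?W = in_chart c H y"
      using H_eq[OF c p(1) on[unfolded p(2)]] unfolding p(2) in_chart_at[OF c p(1)] Z_def by simp
  qed
qed

text \<open>The definite description in \<open>shape_op\<close> is justified by the vector
  representing the linear functional z \<mapsto> B(v, z) \<bullet> \<xi> in an orthonormal tangent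
  frame.\<close>

lemma shape_op:
  assumes p: "p \<in> topspace (mtop M)" and v: "v \<in> tangent_space M p"
  shows "shape p \<xi> v \<in> tangent_space M p \<and>
    (\<forall>w\<in>tangent_space M p. sff p v w \<bullet> \<xi> = shape p \<xi> v \<bullet> w)"
  unfolding shape_op_def
proof (rule theI')
  obtain c where c: "c \<in> atlas M" "p \<in> fst c" using chart_cover[OF p] by blast
  interpret immersed_patch "dom c" "XX c" by (rule patch[OF c(1)])
  note q = snd_in_dom[OF c(2)]
  obtain E where "frame_on (dom c) E" by (rule frame_exists)
  then have on: "orthonormal DIM('c) (\<lambda>i. dX c p (E i (snd c p)))"
    using q by (simp add: frame_on_def)
  obtain u where u: "v = dX c p u" using v tangent_space_chart[OF c] by blast
  define b where "b = (\<lambda>z. sff p v (dX c p z) \<bullet> \<xi>)"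
  have b: "b z = orth_proj (nspace p) (d2X c p u z) \<bullet> \<xi>" for z
    unfolding b_def u sff[OF c] ..
  have lb: "linear b"
    unfolding b
    by (intro linearI) (simp_all add: linear_add[OF linear_D2(2)[OF q]] linear_cmul[OF linear_D2(2)[OF q]]
        orth_proj_add[OF subspace_nspace] orth_proj_scaleR[OF subspace_nspace] inner_add_left)
  define a where "a = dX c p (\<Sum>i=1..DIM('c). b (E i (snd c p)) *\<^sub>R E i (snd c p))"
  have "a \<bullet> dX c p z = b z" for z
  proof -
    have "b z = b (\<Sum>i=1..DIM('c). g (snd c p) z (E i (snd c p)) *\<^sub>R E i (snd c p))"
      using frame_expansion[OF q on, of z] by simp
    also have "\<dots> = (\<Sum>i=1..DIM('c). g (snd c p) z (E i (snd c p)) * b (E i (snd c p)))"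
      by (simp add: linear_sum[OF lb] linear_cmul[OF lb])
    also have "\<dots> = g (snd c p) (\<Sum>i=1..DIM('c). b (E i (snd c p)) *\<^sub>R E i (snd c p)) z"
      by (simp add: g_left[OF q] g_commute[of _ z] mult.commute)
    finally show ?thesis by (simp add: a_def g_def)
  qed
  then have a: "a \<in> tangent_space M p" "\<And>w. w \<in> tangent_space M p \<Longrightarrow> sff p v w \<bullet> \<xi> = a \<bullet> w"
    unfolding tangent_space_chart[OF c] by (auto simp: a_def b_def)
  show "\<exists>!a. a \<in> tangent_space M p \<and> (\<forall>w\<in>tangent_space M p. sff p v w \<bullet> \<xi> = a \<bullet> w)"
  proof (rule ex1I[of _ a])
    fix a' assume a': "a' \<in> tangent_space M p \<and> (\<forall>w\<in>tangent_space M p. sff p v w \<bullet> \<xi> = a' \<bullet> w)"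
    then have "a - a' \<in> tangent_space M p" using a subspace_diff[OF subspace_tangent[OF p]] by blast
    then have "a \<bullet> (a - a') = a' \<bullet> (a - a')" using a a' by metis
    then have "(a - a') \<bullet> (a - a') = 0" by (simp add: inner_diff_left)
    then show "a' = a" by simp
  qed (use a in blast)
qed

lemma shape_op_H: "p \<in> topspace (mtop M) \<Longrightarrow> v \<in> tangent_space M p \<Longrightarrow>
    shape p (H p) v = (norm (H p))\<^sup>2 *\<^sub>R v"
  using pseudo_umbilical unfolding pseudo_umbilical_def by blast

lemma umbilic:
  assumes c: "c \<in> atlas M" and p: "p \<in> fst c"
  shows "H p \<bullet> d2X c p u z = (norm (H p))\<^sup>2 * (dX c p u \<bullet> dX c p z)"
proof -
  have pM: "p \<in> topspace (mtop M)" using chart_subset[OF c] p by blast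
  have t: "dX c p u \<in> tangent_space M p" for u using tangent_space_chart[OF c p] by blast
  have "sff p (dX c p u) (dX c p z) \<bullet> H p
      = ((norm (H p))\<^sup>2 *\<^sub>R dX c p u) \<bullet> dX c p z"
    using shape_op[OF pM t, of "H p" u] t unfolding shape_op_H[OF pM t] by blast
  moreover have "sff p (dX c p u) (dX c p z) \<bullet> H p
      = H p \<bullet> d2X c p u z"
    unfolding sff[OF c p] by (simp add: inner_commute[of _ "H p"] inner_orth_proj[OF subspace_nspace H_normal[OF c p]])
  ultimately show ?thesis by simp
qed

text \<open>Pseudo-umbilicity turns the sum of B(A_H e_i, e_i) into |H|^2 times the trace of B, that
  is m |H|^2 H.\<close>

lemma normal_laplacian_H:
  assumes p: "p \<in> topspace (mtop M)"
  shows "normal_laplacian euclidean_tangent M H p = (real DIM('c) * (norm (H p))\<^sup>2 + lam) *\<^sub>R H p"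
proof -
  obtain c where c: "c \<in> atlas M" "p \<in> fst c" using chart_cover[OF p] by blast
  interpret immersed_patch "dom c" "XX c" by (rule patch[OF c(1)])
  note q = snd_in_dom[OF c(2)]
  define e where "e = frame_around M p"
  have e: "e i p \<in> tangent_space M p" if "i \<in> {1..DIM('c)}" for i
    using frame_around_exists[OF p] that unfolding local_orthonormal_frame_def tangent_field_def e_def by blast
  have sc: "sff p (k *\<^sub>R v) v = k *\<^sub>R sff p v v"
    if v: "v \<in> tangent_space M p" for v k
  proof -
    obtain u where u: "v = dX c p u" using v tangent_space_chart[OF c] by blast
    show ?thesis
      unfolding u linear_cmul[OF linear_DX[OF q], symmetric] sff[OF c]
      by (simp add: linear_cmul[OF linear_D2(1)[OF q]] orth_proj_scaleR[OF subspace_nspace])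
  qed
  have mH: "(\<Sum>i=1..DIM('c). sff p (e i p) (e i p)) = real DIM('c) *\<^sub>R H p"
    unfolding mean_curvature_def Let_def e_def by simp
  have "normal_laplacian euclidean_tangent M H p
      - (\<Sum>i=1..DIM('c). sff p (shape p (H p) (e i p)) (e i p))
      + (real DIM('c) * 0) *\<^sub>R H p = lam *\<^sub>R H p"
    using biminimal p unfolding biminimal_def Let_def e_def by blast
  moreover have "(\<Sum>i=1..DIM('c). sff p (shape p (H p) (e i p)) (e i p))
      = (\<Sum>i=1..DIM('c). (norm (H p))\<^sup>2 *\<^sub>R sff p (e i p) (e i p))"
    by (intro sum.cong refl) (simp add: shape_op_H[OF p e] sc[OF e])
  ultimately show ?thesis
    unfolding scaleR_sum_right[symmetric] mH by (simp add: algebra_simps)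
qed

lemma normal_conn_chart:
  assumes c: "c \<in> atlas M" and p: "p \<in> fst c" and F: "in_chart c F differentiable at (snd c p)"
  shows "nconn (dX c p u) F p = orth_proj (nspace p) (D (in_chart c F) (snd c p) u)"
  unfolding normal_conn_def ambient_conn_def dderiv_chart[OF assms] by (simp add: euclidean_tangent_def orth_proj_UNIV)

text \<open>One frame on \<open>T\<close> serves all open subsets \<open>S\<close>, so that the
  argument can later be restricted to the part of \<open>T\<close> where dh is nonzero.\<close>

lemma normal_patch_exists:
  assumes c: "c \<in> atlas M" and p: "p \<in> fst c" and H0: "H p \<noteq> 0"
  shows "\<exists>T \<nu> \<eta>. open T \<and> snd c p \<in> T \<and> T \<subseteq> dom c \<and>
    (\<forall>y\<in>T. in_chart c H y = norm (in_chart c H y) *\<^sub>R \<nu> y) \<and>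
    (\<forall>S. open S \<longrightarrow> S \<subseteq> T \<longrightarrow> normal_patch S (XX c) \<nu> \<eta> (\<lambda>y. norm (in_chart c H y)) lam)"
proof -
  interpret immersed_patch "dom c" "XX c" by (rule patch[OF c])
  note q = snd_in_dom[OF p]
  define K where "K = in_chart c H"
  define h where "h = (\<lambda>y. norm (K y))"
  define \<nu> where "\<nu> = (\<lambda>y. inverse (h y) *\<^sub>R K y)"
  define T1 where "T1 = {y \<in> dom c. K y \<noteq> 0}"
  have Kn: "K y \<bullet> D (XX c) y u = 0" if y: "y \<in> dom c" for y u
  proof -
    obtain p where p: "p \<in> fst c" "y = snd c p" using y by (auto simp: dom_def)
    show ?thesis
      using H_normal[OF c p(1)] unfolding nspace_iff[OF c p(1)] by (simp add: p K_def in_chart_at[OF c])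
  qed
  have sK: "smooth_on (dom c) K" unfolding K_def by (rule smooth_H[OF c])
  have oT1: "open T1"
    unfolding T1_def using continuous_open_preimage[OF smooth_on_continuous[OF sK] open_S, of "- {0}"]
    by (simp add: vimage_def Int_def open_Compl)
  have T1: "T1 \<subseteq> dom c" "\<And>y. y \<in> T1 \<Longrightarrow> K y \<noteq> 0" by (auto simp: T1_def)
  have qT1: "snd c p \<in> T1" using q H0 by (simp add: T1_def K_def in_chart_at[OF c p])
  have sh: "smooth_on T1 h"
    unfolding h_def by (rule smooth_on_norm[OF oT1 smooth_on_subset[OF sK T1(1)] T1(2)])
  have s\<nu>: "smooth_on T1 \<nu>"
    unfolding \<nu>_def by (intro smooth_on_scaleR smooth_on_inverse sh smooth_on_subset[OF sK T1(1)] oT1) (simp add: h_def T1(2))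
  have \<nu>\<nu>: "\<nu> y \<bullet> \<nu> y = 1" if "y \<in> T1" for y
    using T1(2)[OF that] by (simp add: \<nu>_def h_def power2_norm_eq_inner[symmetric] power2_eq_square)
  have \<nu>n: "\<nu> y \<bullet> D (XX c) y u = 0" if "y \<in> dom c" for y u
    by (simp add: \<nu>_def Kn[OF that])
  have h\<nu>: "K y = h y *\<^sub>R \<nu> y" for y
    by (cases "K y = 0") (simp_all add: \<nu>_def h_def)
  obtain E where E: "frame_on (dom c) E" by (rule frame_exists)
  have sE: "smooth_on T1 (E i)" if "i \<in> {1..DIM('c)}" for i
    using E that T1 smooth_on_subset unfolding frame_on_def by blast
  have on: "orthonormal DIM('c) (\<lambda>i. D (XX c) y (E i y))" if "y \<in> dom c" for y
    using E that by (simp add: frame_on_def)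
  have "dim (insert (\<nu> (snd c p)) (range (dX c p))) \<le> DIM('c) + 1"
    using dim_insert[of "\<nu> (snd c p)" "range (dX c p)"] dim_range_DX[OF q] by simp
  then have "dim (insert (\<nu> (snd c p)) (range (dX c p))) < DIM('e)"
    using dim_e by simp
  then obtain z0 where z0: "z0 \<noteq> 0" "\<And>z. z \<in> span (insert (\<nu> (snd c p)) (range (dX c p))) \<Longrightarrow> orthogonal z0 z"
    using orthogonal_to_subspace_exists by blast
  have z0': "z0 \<bullet> \<nu> (snd c p) = 0" "z0 \<bullet> dX c p u = 0" for u
    using z0(2)[OF span_base] by (auto simp: orthogonal_def)
  \<comment> \<open>The constant vector \<open>z0\<close> is projected off the tangent space and off
    \<open>\<nu>\<close>. At the base point nothing is removed, so \<open>z\<close> stays nonzero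
    nearby and can be normalised to \<open>\<eta>\<close>.\<close>
  define z where "z = (\<lambda>y. z0 - (\<Sum>i=1..DIM('c). (z0 \<bullet> D (XX c) y (E i y)) *\<^sub>R D (XX c) y (E i y)) - (z0 \<bullet> \<nu> y) *\<^sub>R \<nu> y)"
  have sz: "smooth_on T1 z"
    unfolding z_def
    by (intro smooth_on_scaleR smooth_on_const smooth_on_diff smooth_on_sum smooth_on_inner smooth_DX sE s\<nu> oT1 T1(1))
  have zn: "z y \<bullet> D (XX c) y u = 0" if y: "y \<in> dom c" for y u
    using normal_remainder[OF y on[OF y], of z0 u] by (simp add: z_def inner_diff_left \<nu>n[OF y])
  have z\<nu>: "z y \<bullet> \<nu> y = 0" if y: "y \<in> T1" for y
  proof -
    have "D (XX c) y u \<bullet> \<nu> y = 0" for u using \<nu>n[of y u] y T1 by (auto simp: inner_commute)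
    then show ?thesis by (simp add: z_def inner_diff_left inner_sum_left \<nu>\<nu>[OF y])
  qed
  define T where "T = {y \<in> T1. z y \<noteq> 0}"
  have oT: "open T"
    unfolding T_def using continuous_open_preimage[OF smooth_on_continuous[OF sz] oT1, of "- {0}"]
    by (simp add: vimage_def Int_def open_Compl)
  have T: "T \<subseteq> T1" "\<And>y. y \<in> T \<Longrightarrow> z y \<noteq> 0" by (auto simp: T_def)
  have "z (snd c p) = z0" by (simp add: z_def z0')
  then have qT: "snd c p \<in> T" using qT1 z0(1) by (simp add: T_def)
  define \<eta> where "\<eta> = (\<lambda>y. inverse (norm (z y)) *\<^sub>R z y)"
  have s\<eta>: "smooth_on T \<eta>"
    unfolding \<eta>_def by (intro smooth_on_scaleR smooth_on_inverse smooth_on_norm smooth_on_subset[OF sz T(1)] oT) (simp_all add: T(2))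
  have \<eta>\<eta>: "\<eta> y \<bullet> \<eta> y = 1" if "y \<in> T" for y
    using T(2)[OF that] by (simp add: \<eta>_def power2_norm_eq_inner[symmetric] power2_eq_square)
  have \<nu>\<eta>: "\<nu> y \<bullet> \<eta> y = 0" if "y \<in> T" for y
    using z\<nu>[of y] T(1) that by (auto simp: \<eta>_def inner_commute)
  have \<eta>n: "\<eta> y \<bullet> D (XX c) y u = 0" if "y \<in> T" for y u
    using zn[of y u] T(1) T1(1) that by (auto simp: \<eta>_def)
  have proj: "orth_proj (nspace p) w = (w \<bullet> \<nu> y) *\<^sub>R \<nu> y + (w \<bullet> \<eta> y) *\<^sub>R \<eta> y" if p: "p \<in> fst c" "y = snd c p" "y \<in> T" for p y w
  proof (rule orth_projI[OF subspace_nspace])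
    have y: "y \<in> dom c" "y \<in> T1" using that T T1 by auto
    show "(w \<bullet> \<nu> y) *\<^sub>R \<nu> y + (w \<bullet> \<eta> y) *\<^sub>R \<eta> y \<in> nspace p"
      unfolding nspace_iff[OF c p(1)] p(2)[symmetric]
      by (simp add: inner_add_left \<nu>n[OF y(1)] \<eta>n[OF p(3)])
    fix n assume "n \<in> nspace p"
    then have "n \<bullet> D (XX c) y u = 0" for u unfolding nspace_iff[OF c p(1)] p(2) by blast
    then have n: "n = (n \<bullet> \<nu> y) *\<^sub>R \<nu> y + (n \<bullet> \<eta> y) *\<^sub>R \<eta> y"
      by (rule codimension_two_normal[OF y(1) dim_e \<nu>\<nu>[OF y(2)] \<eta>\<eta>[OF p(3)] \<nu>\<eta>[OF p(3)] \<nu>n[OF y(1)] \<eta>n[OF p(3)]])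
    have "n \<bullet> w = ((n \<bullet> \<nu> y) *\<^sub>R \<nu> y + (n \<bullet> \<eta> y) *\<^sub>R \<eta> y) \<bullet> w" using n by simp
    then show "n \<bullet> w = n \<bullet> ((w \<bullet> \<nu> y) *\<^sub>R \<nu> y + (w \<bullet> \<eta> y) *\<^sub>R \<eta> y)"
      by (simp add: inner_add_left inner_add_right inner_commute[of _ w] mult.commute)
  qed
  have "\<exists>T \<nu> \<eta>. open T \<and> snd c p \<in> T \<and> T \<subseteq> dom c \<and> (\<forall>y\<in>T. K y = h y *\<^sub>R \<nu> y) \<and>
      (\<forall>S. open S \<longrightarrow> S \<subseteq> T \<longrightarrow> normal_patch S (XX c) \<nu> \<eta> h lam)"
  proof (rule exI[of _ T], rule exI[of _ \<nu>], rule exI[of _ \<eta>], intro conjI ballI allI impI)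
    show "open T" "snd c p \<in> T" by (rule oT, rule qT)
    show "T \<subseteq> dom c" using T T1 by blast
    show "K y = h y *\<^sub>R \<nu> y" for y by (rule h\<nu>)
    fix S assume S: "open S" "S \<subseteq> T"
    then have ST1: "S \<subseteq> T1" and Sd: "S \<subseteq> dom c" using T T1 by auto
    have pS: "immersed_patch S (XX c)"
      using S(1) smooth_on_subset[OF smooth_X Sd] inj_DX Sd by (intro immersed_patch.intro) auto
    note g' = immersed_patch.g_def[OF pS]
    show "normal_patch S (XX c) \<nu> \<eta> h lam"
    proof (rule normal_patch.intro[OF pS], rule normal_patch_axioms.intro)
      show "DIM('c) \<ge> 3" "DIM('e) = DIM('c) + 2" by (rule dim_c, rule dim_e)
      show "smooth_on S \<nu>" "smooth_on S \<eta>" "smooth_on S h"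
        using smooth_on_subset[OF s\<nu> ST1] smooth_on_subset[OF s\<eta> S(2)] smooth_on_subset[OF sh ST1] by auto
      fix y assume y: "y \<in> S"
      then have yT: "y \<in> T" and yT1: "y \<in> T1" and yd: "y \<in> dom c" using S ST1 Sd by auto
      show "\<nu> y \<bullet> \<nu> y = 1" "\<eta> y \<bullet> \<eta> y = 1" "\<nu> y \<bullet> \<eta> y = 0"
        by (rule \<nu>\<nu>[OF yT1], rule \<eta>\<eta>[OF yT], rule \<nu>\<eta>[OF yT])
      show "\<nu> y \<bullet> D (XX c) y u = 0" "\<eta> y \<bullet> D (XX c) y u = 0" for u
        by (rule \<nu>n[OF yd], rule \<eta>n[OF yT])
      show h0: "h y \<noteq> 0" using T1(2)[OF yT1] by (simp add: h_def)
      obtain p where p: "p \<in> fst c" "y = snd c p" using yd by (auto simp: dom_def)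
      have pM: "p \<in> topspace (mtop M)" using chart_subset[OF c] p by blast
      have Hp: "H p = h y *\<^sub>R \<nu> y" using h\<nu>[of y] by (simp add: K_def p in_chart_at[OF c])
      have nHp: "norm (H p) = h y" by (simp add: h_def K_def p in_chart_at[OF c])
      show "\<nu> y \<bullet> D2 (XX c) y u v = h y * immersed_patch.g (XX c) y u v" for u v
      proof -
        have "H p \<bullet> d2X c p u v = (norm (H p))\<^sup>2 * (dX c p u \<bullet> dX c p v)"
          by (rule umbilic[OF c p(1)])
        then have "(h y *\<^sub>R \<nu> y) \<bullet> D2 (XX c) y u v = (h y)\<^sup>2 * (D (XX c) y u \<bullet> D (XX c) y v)"
          unfolding nHp unfolding Hp p(2)[symmetric] .
        then show ?thesis using h0 by (simp add: g' power2_eq_square)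
      qed
      show "(\<Sum>i=1..DIM('c). \<eta> y \<bullet> D2 (XX c) y (e i) (e i)) = 0"
        if e: "orthonormal DIM('c) (\<lambda>i. D (XX c) y (e i))" for e
      proof -
        have "\<eta> y \<in> nspace p"
          unfolding nspace_iff[OF c p(1)] p(2)[symmetric] using \<eta>n[OF yT] by blast
        from H_trace[OF c p(1) e[unfolded p(2)] this] show ?thesis
          unfolding Hp using \<nu>\<eta>[OF yT] by (simp add: p(2) inner_commute)
      qed
      obtain T0 E where T0: "open T0" "snd c p \<in> T0" "T0 \<subseteq> dom c" "frame_on T0 E"
        and e: "\<And>i q. i \<in> {1..DIM('c)} \<Longrightarrow> q \<in> fst c \<Longrightarrow> snd c q \<in> T0 \<Longrightarrow>
            frame_around M p i q = dX c q (E i (snd c q))"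
        and se: "\<And>i. i \<in> {1..DIM('c)} \<Longrightarrow> smooth_on T0 (in_chart c (frame_around M p i))"
        by (rule frame_around_chart[OF c p(1)], rule that; (assumption | blast))
      define R where "R = T0 \<inter> S"
      have R: "open R" "y \<in> R" "R \<subseteq> S" "R \<subseteq> T0" "R \<subseteq> T" using T0 S y p by (auto simp: R_def)
      have frR: "frame_on R E"
        using T0(4) R(4) smooth_on_subset unfolding frame_on_def by blast
      have sER: "smooth_on R (E i)" if "i \<in> {1..DIM('c)}" for i
        using frR that by (simp add: frame_on_def)
      have inR: "\<exists>q\<in>fst c. x = snd c q" if "x \<in> R" for x using that R(3) Sd by (auto simp: dom_def)
      have ex: "in_chart c (frame_around M p i) x = D (XX c) x (E i x)" if i: "i \<in> {1..DIM('c)}" and x: "x \<in> R" for i x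
      proof -
        obtain q where q: "q \<in> fst c" "x = snd c q" using inR[OF x] by blast
        show ?thesis using e[OF i q(1)] x R(4) q by (auto simp: in_chart_at[OF c])
      qed
      have De: "D (in_chart c (frame_around M p i)) y = D (\<lambda>x. D (XX c) x (E i x)) y"
        and de: "in_chart c (frame_around M p i) differentiable at y" if i: "i \<in> {1..DIM('c)}" for i
      proof -
        have d: "in_chart c (frame_around M p i) differentiable at y"
          by (rule smooth_on_differentiable[OF se[OF i]]) (use R in blast)
        show "in_chart c (frame_around M p i) differentiable at y" by (rule d)
        show "D (in_chart c (frame_around M p i)) y = D (\<lambda>x. D (XX c) x (E i x)) y"
          using D_cong(2)[OF d R(1,2), of "\<lambda>x. D (XX c) x (E i x)"] ex[OF i] by simp
      qed
      have ep: "frame_around M p i p = D (XX c) y (E i y)" if "i \<in> {1..DIM('c)}" for i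
        using e[OF that p(1) T0(2)] by (simp add: p(2))
      have "\<exists>C. tangent_conn euclidean_tangent M (frame_around M p i p) (frame_around M p i) p = D (XX c) y C
          \<and> (\<forall>z. g y C z = D (\<lambda>x. D (XX c) x (E i x)) y (E i y) \<bullet> D (XX c) y z)" if i: "i \<in> {1..DIM('c)}" for i
      proof -
        let ?d = "D (\<lambda>x. D (XX c) x (E i x)) y (E i y)"
        have t: "tangent_conn euclidean_tangent M (frame_around M p i p) (frame_around M p i) p = orth_proj (tangent_space M p) ?d"
          using dderiv_chart[OF c p(1) de[OF i, unfolded p(2)], of "E i y"]
          unfolding tangent_conn_def ambient_conn_def ep[OF i] p(2)[symmetric] De[OF i]
          by (simp add: euclidean_tangent_def orth_proj_UNIV)
        have ts: "tangent_space M p = range (D (XX c) y)" using tangent_space_chart[OF c p(1)] p by simp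
        have sub: "subspace (tangent_space M p)" by (rule subspace_tangent[OF pM])
        obtain C where C: "orth_proj (tangent_space M p) ?d = D (XX c) y C"
          using orth_proj_in[OF sub, of ?d] unfolding ts by blast
        have "g y C z = ?d \<bullet> D (XX c) y z" for z
          unfolding g_def C[symmetric] inner_commute[of _ "D (XX c) y z"]
          by (rule inner_orth_proj[OF sub]) (simp add: ts)
        then show ?thesis using t C by auto
      qed
      then have "\<forall>i\<in>{1..DIM('c)}. \<exists>C. tangent_conn euclidean_tangent M (frame_around M p i p) (frame_around M p i) p = D (XX c) y C
          \<and> (\<forall>z. g y C z = D (\<lambda>x. D (XX c) x (E i x)) y (E i y) \<bullet> D (XX c) y z)"
        by (rule ballI)
      from bchoice[OF this] obtain C where C': "\<forall>i\<in>{1..DIM('c)}.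
          tangent_conn euclidean_tangent M (frame_around M p i p) (frame_around M p i) p = D (XX c) y (C i)
          \<and> (\<forall>z. g y (C i) z = D (\<lambda>x. D (XX c) x (E i x)) y (E i y) \<bullet> D (XX c) y z)"
        by (elim exE)
      have C: "\<And>i. i \<in> {1..DIM('c)} \<Longrightarrow>
          tangent_conn euclidean_tangent M (frame_around M p i p) (frame_around M p i) p = D (XX c) y (C i)"
        "\<And>i z. i \<in> {1..DIM('c)} \<Longrightarrow> g y (C i) z = D (\<lambda>x. D (XX c) x (E i x)) y (E i y) \<bullet> D (XX c) y z"
        by (rule conjunct1[OF bspec[OF C']], assumption) (rule spec[OF conjunct2[OF bspec[OF C']]], assumption)
      define N where "N = (\<lambda>x. plane_proj (\<nu> x) (\<eta> x))"
      define L where "L = (\<lambda>x. h x *\<^sub>R \<nu> x)"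
      have KL: "K = L" unfolding L_def using h\<nu> by blast
      have projN: "orth_proj (nspace p) w = N y w" for w
        unfolding N_def plane_proj_def by (rule proj[OF p yT])
      have nc: "nconn (D (XX c) x u) H q = N x (D L x u)" if q: "q \<in> fst c" "x = snd c q" "x \<in> T" for q x u
      proof -
        have "x \<in> dom c" using q T T1 by blast
        then have "in_chart c H differentiable at (snd c q)"
          using smooth_on_differentiable[OF smooth_H[OF c]] q by simp
        from normal_conn_chart[OF c q(1) this, of u] show ?thesis
          unfolding q(2)[symmetric] proj[OF q] N_def plane_proj_def K_def[symmetric] KL .
      qed
      have nc2: "nconn (frame_around M p i p)
          (\<lambda>q. nconn (frame_around M p i q) H q) p = N y (D (\<lambda>x. N x (D L x (E i x))) y (E i y))"
        if i: "i \<in> {1..DIM('c)}" for i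
      proof -
        let ?F = "\<lambda>q. nconn (frame_around M p i q) H q"
        have sL: "smooth_on R L"
          unfolding L_def
          by (intro smooth_on_scaleR R smooth_on_subset[OF s\<nu>] smooth_on_subset[OF sh]) (use R T in auto)
        have "smooth_on R (\<lambda>x. N x (D L x (E i x)))"
          unfolding N_def plane_proj_def
          by (intro smooth_on_add smooth_on_scaleR smooth_on_inner smooth_on_D R sL sER i
              smooth_on_subset[OF s\<nu>] smooth_on_subset[OF s\<eta>]) (use R T in auto)
        then have d: "(\<lambda>x. N x (D L x (E i x))) differentiable at y"
          by (rule smooth_on_differentiable[OF _ R(2)])
        have F: "N x (D L x (E i x)) = in_chart c ?F x" if x: "x \<in> R" for x
        proof -
          obtain q where q: "q \<in> fst c" "x = snd c q" using inR[OF x] by blast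
          have "x \<in> T" using x R by blast
          have "frame_around M p i q = D (XX c) x (E i x)"
            using e[OF i q(1)] x R(4) q by blast
          then show ?thesis
            using nc[OF q \<open>x \<in> T\<close>] by (simp add: q(2) in_chart_at[OF c q(1)])
        qed
        note dF = D_cong[OF d R(1,2) F]
        have "nconn (dX c p (E i y)) ?F p = orth_proj (nspace p) (D (in_chart c ?F) (snd c p) (E i y))"
          by (rule normal_conn_chart[OF c p(1)]) (use dF(1) p in simp)
        then have "nconn (frame_around M p i p) ?F p = N y (D (in_chart c ?F) y (E i y))"
          unfolding p(2)[symmetric] ep[OF i, symmetric] projN .
        also have "\<dots> = N y (D (\<lambda>x. N x (D L x (E i x))) y (E i y))"
          by (rule arg_cong[OF fun_cong[OF dF(2)]])
        finally show ?thesis .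
      qed
      have "(\<Sum>i=1..DIM('c). N y (D (\<lambda>x. N x (D L x (E i x))) y (E i y)) - N y (D L y (C i)))
          = normal_laplacian euclidean_tangent M H p"
        unfolding normal_laplacian_def Let_def
        by (intro sum.cong refl) (simp add: nc2 C(1) nc[OF p yT])
      also have "\<dots> = ((real DIM('c) * (h y)\<^sup>2 + lam) * h y) *\<^sub>R \<nu> y"
        unfolding normal_laplacian_H[OF pM] nHp unfolding Hp by simp
      finally have lap: "(\<Sum>i=1..DIM('c). N y (D (\<lambda>x. N x (D L x (E i x))) y (E i y)) - N y (D L y (C i)))
          = ((real DIM('c) * (h y)\<^sup>2 + lam) * h y) *\<^sub>R \<nu> y" .
      show "\<exists>T E C. open T \<and> y \<in> T \<and> T \<subseteq> S \<and> immersed_patch.frame_on (XX c) T E \<and>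
        (\<forall>i\<in>{1..DIM('c)}. \<forall>z. immersed_patch.g (XX c) y (C i) z = D (\<lambda>p. D (XX c) p (E i p)) y (E i y) \<bullet> D (XX c) y z) \<and>
        (\<Sum>i=1..DIM('c).
          plane_proj (\<nu> y) (\<eta> y) (D (\<lambda>p. plane_proj (\<nu> p) (\<eta> p) (D (\<lambda>p. h p *\<^sub>R \<nu> p) p (E i p))) y (E i y))
          - plane_proj (\<nu> y) (\<eta> y) (D (\<lambda>p. h p *\<^sub>R \<nu> p) y (C i)))
        = ((real DIM('c) * (h y)\<^sup>2 + lam) * h y) *\<^sub>R \<nu> y"
        using R(1,2,3) frR C(2) lap[unfolded N_def L_def] by blast
    qed
  qed
  then show ?thesis
    unfolding h_def K_def .
qed

section \<open>From local to global\<close>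

definition centre :: "'a \<Rightarrow> 'e" where
  "centre p = imm M p + inverse ((norm (H p))\<^sup>2) *\<^sub>R H p"

text \<open>If some directional derivative of \<open>h\<close> were nonzero at a point, the open set
  where it is nonzero would be a \<open>gradient_patch\<close>, which is impossible. So dh = 0 on
  \<open>T\<close>, and the centre, having zero derivative on a ball in the chart, is constant
  there.\<close>

lemma locally_spherical:
  assumes p: "p \<in> topspace (mtop M)" and H0: "H p \<noteq> 0"
  shows "\<exists>W. openin (mtop M) W \<and> p \<in> W \<and>
    (\<forall>q\<in>W. H q \<noteq> 0 \<and> real DIM('c) * (norm (H q))\<^sup>2 + lam = 0 \<and> centre q = centre p)"
proof -
  obtain c where c: "c \<in> atlas M" "p \<in> fst c" using chart_cover[OF p] by blast
  define h where "h = (\<lambda>y. norm (in_chart c H y))"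
  obtain T \<nu> \<eta> where T: "open T" "snd c p \<in> T" "T \<subseteq> dom c" "\<forall>y\<in>T. in_chart c H y = h y *\<^sub>R \<nu> y"
    and S: "\<forall>S. open S \<longrightarrow> S \<subseteq> T \<longrightarrow> normal_patch S (XX c) \<nu> \<eta> h lam"
    using normal_patch_exists[OF c H0] unfolding h_def by (elim exE conjE)
  have patch: "normal_patch S (XX c) \<nu> \<eta> h lam" if "open S" "S \<subseteq> T" for S
    using S that by blast
  interpret normal_patch T "XX c" \<nu> \<eta> h lam by (rule patch[OF T(1) subset_refl])
  have dh: "D h y u = 0" if y: "y \<in> T" for y u
  proof (rule ccontr)
    assume ne: "D h y u \<noteq> 0"
    define S where "S = {x \<in> T. D h x u \<noteq> 0}"
    have oS: "open S"
      unfolding S_def using continuous_open_preimage[OF smooth_on_continuous[OF smooth_on_D_const[OF smooth_h]] T(1), of "- {0}" u]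
      by (simp add: vimage_def Int_def open_Compl)
    have "gradient_patch S (XX c) \<nu> \<eta> h lam"
      using patch[OF oS] y ne by (intro gradient_patch.intro gradient_patch_axioms.intro) (auto simp: S_def)
    then show False by (rule gradient_patch.inconsistent)
  qed
  obtain r where r: "r > 0" "ball (snd c p) r \<subseteq> T" using T openE by blast
  let ?c = "\<lambda>y. XX c y + inverse (h y) *\<^sub>R \<nu> y"
  have "\<exists>k. \<forall>y\<in>ball (snd c p) r. ?c y = k"
  proof (rule has_derivative_zero_constant[OF convex_ball])
    fix y assume "y \<in> ball (snd c p) r"
    then have y: "y \<in> T" using r by blast
    have rt: "has_rate ?c y u 0" for u by (rule D_centre[OF dh y])
    have "?c differentiable at y" by (rule has_rate_differentiable[OF rt])
    then have "(?c has_derivative D ?c y) (at y)" by (rule D_works)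
    moreover have "D ?c y = (\<lambda>h. 0)" by (rule ext) (rule D_has_rate[OF rt])
    ultimately have "(?c has_derivative (\<lambda>h. 0)) (at y)" by simp
    then show "(?c has_derivative (\<lambda>h. 0)) (at y within ball (snd c p) r)"
      by (rule has_derivative_at_withinI)
  qed
  then obtain k where k: "\<And>y. y \<in> ball (snd c p) r \<Longrightarrow> ?c y = k" by blast
  define W where "W = {q \<in> fst c. snd c q \<in> ball (snd c p) r}"
  have cq: "centre q = k" if q: "q \<in> W" for q
  proof -
    have q': "q \<in> fst c" "snd c q \<in> ball (snd c p) r" "snd c q \<in> T" using q r by (auto simp: W_def)
    have Hq: "H q = h (snd c q) *\<^sub>R \<nu> (snd c q)" and nH: "norm (H q) = h (snd c q)"
      using bspec[OF T(4) q'(3)] by (simp_all add: in_chart_at[OF c(1) q'(1)] h_def)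
    have "inverse ((h (snd c q))\<^sup>2) * h (snd c q) = inverse (h (snd c q))"
      using h_nonzero[OF q'(3)] by (simp add: power2_eq_square field_simps)
    then show ?thesis
      using k[OF q'(2)] unfolding centre_def nH unfolding Hq by (simp add: in_chart_at[OF c(1) q'(1)])
  qed
  show ?thesis
  proof (intro exI[of _ W] conjI ballI)
    show "openin (mtop M) W" unfolding W_def by (rule open_chart_vimage[OF c(1)]) simp
    show pW: "p \<in> W" using c r by (simp add: W_def)
    fix q assume q: "q \<in> W"
    then have q': "q \<in> fst c" "snd c q \<in> T" using r by (auto simp: W_def)
    have "norm (H q) = h (snd c q)" by (simp add: h_def in_chart_at[OF c(1) q'(1)])
    then show "H q \<noteq> 0" "real DIM('c) * (norm (H q))\<^sup>2 + lam = 0" "centre q = centre p"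
      using h_square[OF dh q'(2)] h_nonzero[OF q'(2)] cq[OF q] cq[OF pW] by auto
  qed
qed

lemma norm_H:
  assumes "p \<in> topspace (mtop M)" "H p \<noteq> 0"
  shows "(norm (H p))\<^sup>2 = - lam / real DIM('c)"
proof -
  have "real DIM('c) * (norm (H p))\<^sup>2 + lam = 0"
    using locally_spherical[OF assms] by blast
  then show ?thesis by (simp add: field_simps)
qed

lemma minimal_if_nonneg: "lam \<ge> 0 \<Longrightarrow> p \<in> topspace (mtop M) \<Longrightarrow> H p = 0"
proof (rule ccontr)
  assume *: "lam \<ge> 0" "p \<in> topspace (mtop M)" "H p \<noteq> 0"
  have "(norm (H p))\<^sup>2 > 0" using *(3) by simp
  moreover have "- lam / real DIM('c) \<le> 0" using *(1) by (simp add: divide_nonpos_nonneg)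
  ultimately show False using norm_H[OF *(2,3)] by simp
qed

text \<open>By \<open>norm_H\<close> the length of \<open>H\<close> is either 0 or the positive
  number \<open>d\<close> below; near a zero of \<open>H\<close> continuity keeps it under
  \<open>d\<close>.\<close>

lemma open_zero_set:
  assumes lam: "lam < 0"
  shows "openin (mtop M) {p \<in> topspace (mtop M). H p = 0}"
proof (subst openin_subopen, intro ballI)
  fix p assume "p \<in> {p \<in> topspace (mtop M). H p = 0}"
  then have p: "p \<in> topspace (mtop M)" "H p = 0" by auto
  obtain c where c: "c \<in> atlas M" "p \<in> fst c" using chart_cover[OF p(1)] by blast
  define d where "d = sqrt (- lam / real DIM('c))"
  have d: "d > 0" using lam by (simp add: d_def divide_neg_pos)
  define T where "T = {y \<in> dom c. norm (in_chart c H y) < d}"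
  have "continuous_on (dom c) (\<lambda>y. norm (in_chart c H y))"
    by (intro continuous_on_norm smooth_on_continuous smooth_H c)
  from continuous_open_preimage[OF this open_dom[OF c(1)], of "{..<d}"]
  have "open T" by (simp add: T_def vimage_def Int_def)
  from open_chart_vimage[OF c(1) this] have "openin (mtop M) {q \<in> fst c. snd c q \<in> T}" .
  moreover have "p \<in> {q \<in> fst c. snd c q \<in> T}"
    using c p d by (simp add: T_def in_chart_at snd_in_dom)
  moreover have "{q \<in> fst c. snd c q \<in> T} \<subseteq> {p \<in> topspace (mtop M). H p = 0}"
  proof
    fix q assume "q \<in> {q \<in> fst c. snd c q \<in> T}"
    then have q: "q \<in> fst c" "norm (H q) < d" by (auto simp: T_def in_chart_at[OF c(1)])
    have qM: "q \<in> topspace (mtop M)" using q chart_subset[OF c(1)] by blast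
    have "H q = 0"
    proof (rule ccontr)
      assume "H q \<noteq> 0"
      from norm_H[OF qM this] have "norm (H q) = d"
        unfolding d_def by (metis norm_ge_zero real_sqrt_unique)
      then show False using q by simp
    qed
    then show "q \<in> {p \<in> topspace (mtop M). H p = 0}" using qM by simp
  qed
  ultimately show "\<exists>U. openin (mtop M) U \<and> p \<in> U \<and> U \<subseteq> {p \<in> topspace (mtop M). H p = 0}" by blast
qed

text \<open>The predicate \<open>P\<close> lets one lemma serve for the set where \<open>H\<close>
  is nonzero and for the two sets that separate one value of \<open>centre\<close> from the
  others.\<close>

lemma open_nonzero_set: "openin (mtop M) {p \<in> topspace (mtop M). H p \<noteq> 0 \<and> P (centre p)}"
proof (subst openin_subopen, intro ballI)
  fix p assume "p \<in> {p \<in> topspace (mtop M). H p \<noteq> 0 \<and> P (centre p)}"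
  then have p: "p \<in> topspace (mtop M)" "H p \<noteq> 0" "P (centre p)" by auto
  obtain W where W: "openin (mtop M) W" "p \<in> W"
    "\<forall>q\<in>W. H q \<noteq> 0 \<and> real DIM('c) * (norm (H q))\<^sup>2 + lam = 0 \<and> centre q = centre p"
    using locally_spherical[OF p(1,2)] by (elim exE conjE)
  have "W \<subseteq> {p \<in> topspace (mtop M). H p \<noteq> 0 \<and> P (centre p)}"
  proof
    fix q assume q: "q \<in> W"
    then have "q \<in> topspace (mtop M)" using openin_subset[OF W(1)] by blast
    moreover have "H q \<noteq> 0" "centre q = centre p" using bspec[OF W(3) q] by blast+
    ultimately show "q \<in> {p \<in> topspace (mtop M). H p \<noteq> 0 \<and> P (centre p)}" using p(3) by simp
  qed
  with W(1,2) show "\<exists>U. openin (mtop M) U \<and> p \<in> U \<and> U \<subseteq> {p \<in> topspace (mtop M). H p \<noteq> 0 \<and> P (centre p)}" by blast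
qed

lemma nowhere_zero:
  assumes conn: "connected_space (mtop M)" and q: "q \<in> topspace (mtop M)" "H q \<noteq> 0" and p: "p \<in> topspace (mtop M)"
  shows "H p \<noteq> 0"
proof
  assume "H p = 0"
  have "lam < 0" using minimal_if_nonneg[OF _ q(1)] q(2) by force
  note o = open_zero_set[OF this] open_nonzero_set[of "\<lambda>_. True"]
  have "topspace (mtop M) \<subseteq> {p \<in> topspace (mtop M). H p = 0} \<union> {p \<in> topspace (mtop M). H p \<noteq> 0 \<and> True}" by blast
  moreover have "{p \<in> topspace (mtop M). H p = 0} \<inter> {p \<in> topspace (mtop M). H p \<noteq> 0 \<and> True} = {}" by blast
  moreover have "{p \<in> topspace (mtop M). H p = 0} \<noteq> {}" "{p \<in> topspace (mtop M). H p \<noteq> 0 \<and> True} \<noteq> {}"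
    using p q \<open>H p = 0\<close> by blast+
  ultimately show False
    using conn o unfolding connected_space_def by blast
qed

lemma centre_constant:
  assumes conn: "connected_space (mtop M)" and q: "q \<in> topspace (mtop M)" "H q \<noteq> 0" and p: "p \<in> topspace (mtop M)"
  shows "centre p = centre q"
proof (rule ccontr)
  assume ne: "centre p \<noteq> centre q"
  let ?A = "{p \<in> topspace (mtop M). H p \<noteq> 0 \<and> centre p = centre q}"
  let ?B = "{p \<in> topspace (mtop M). H p \<noteq> 0 \<and> centre p \<noteq> centre q}"
  note nz = nowhere_zero[OF conn q]
  have "openin (mtop M) ?A" "openin (mtop M) ?B"
    by (rule open_nonzero_set)+
  moreover have "topspace (mtop M) \<subseteq> ?A \<union> ?B" "?A \<inter> ?B = {}" "?A \<noteq> {}" "?B \<noteq> {}"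
    using nz p q ne by blast+
  ultimately show False
    using conn unfolding connected_space_def by blast
qed

text \<open>The normals inside the sphere are the Euclidean normals orthogonal to
  \<open>imm M p - centre p\<close>, a nonzero multiple of \<open>H p\<close>; the trace of the
  second fundamental form in such a direction n is m n \<bullet> H = 0.\<close>

lemma mean_curvature_sphere:
  assumes p: "p \<in> topspace (mtop M)" and H0: "H p \<noteq> 0"
  shows "mean_curvature (sphere_tangent (centre p)) M p = 0"
proof -
  let ?TN = "sphere_tangent (centre p)"
  have TN: "subspace (?TN (imm M p))" unfolding sphere_tangent_def by (rule subspace_orthogonal_comp)
  obtain c where c: "c \<in> atlas M" "p \<in> fst c" using chart_cover[OF p] by blast
  interpret immersed_patch "dom c" "XX c" by (rule patch[OF c(1)])
  obtain E where "frame_on (dom c) E" by (rule frame_exists)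
  then have on: "orthonormal DIM('c) (\<lambda>i. dX c p (E i (snd c p)))"
    using snd_in_dom[OF c(2)] by (simp add: frame_on_def)
  have "orth_proj (normal_space ?TN M p) (\<Sum>i=1..DIM('c). d2X c p (E i (snd c p)) (E i (snd c p))) = 0"
  proof (rule orth_projI)
    show "subspace (normal_space ?TN M p)" by (rule subspace_normal[where TN = ?TN, OF TN])
    then show "0 \<in> normal_space ?TN M p" by (rule subspace_0)
    fix n assume n: "n \<in> normal_space ?TN M p"
    then have nN: "n \<in> nspace p" by (simp add: normal_space_def euclidean_tangent_def)
    have "(imm M p - centre p) \<bullet> n = 0"
      using n unfolding normal_space_def sphere_tangent_def orthogonal_comp_iff Int_iff by blast
    moreover have "imm M p - centre p = - (inverse ((norm (H p))\<^sup>2) *\<^sub>R H p)" by (simp add: centre_def)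
    ultimately have "inverse ((norm (H p))\<^sup>2) * (H p \<bullet> n) = 0" by simp
    then have "n \<bullet> H p = 0" using H0 by (simp add: inner_commute)
    then show "n \<bullet> (\<Sum>i=1..DIM('c). d2X c p (E i (snd c p)) (E i (snd c p))) = n \<bullet> 0"
      using H_trace[OF c on nN] by (simp add: inner_sum_right)
  qed
  then show ?thesis
    using mean_curvature_chart[where TN = ?TN, OF c TN on] by simp
qed

end

theorem theorem1p2:
  fixes M :: "('a, 'c::euclidean_space, 'e::euclidean_space) submfd"
    and m :: nat and lam :: real
  assumes "m \<ge> 3" and "DIM('c) = m" and "DIM('e) = m + 2"
    and "immersed_submanifold M"
    and "connected_space (mtop M)"
    and "pseudo_umbilical euclidean_tangent M"
    and "biminimal euclidean_tangent M 0 lam"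
  shows "(\<lambda>p. norm (mean_curvature euclidean_tangent M p)) constant_on topspace (mtop M)
    \<and> (lam \<ge> 0 \<longrightarrow> minimal euclidean_tangent M)
    \<and> (lam < 0 \<and> \<not> minimal euclidean_tangent M \<longrightarrow>
         (\<forall>p\<in>topspace (mtop M). (norm (mean_curvature euclidean_tangent M p))\<^sup>2 = - lam / real m)
         \<and> (\<exists>c. minimal_in_sphere c (sqrt (- real m / lam)) M))"
proof -
  interpret pseudo_umbilical_biminimal M lam
    using assms by unfold_locales auto
  note conn = \<open>connected_space (mtop M)\<close>
  have const: "(\<lambda>p. norm (H p)) constant_on topspace (mtop M)"
  proof (cases "\<exists>q\<in>topspace (mtop M). H q \<noteq> 0")
    case True
    then obtain q where q: "q \<in> topspace (mtop M)" "H q \<noteq> 0" by blast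
    have "norm (H p) = sqrt (- lam / real DIM('c))" if "p \<in> topspace (mtop M)" for p
      using norm_H[OF that nowhere_zero[OF conn q that]] by (metis norm_ge_zero real_sqrt_unique)
    then show ?thesis unfolding constant_on_def by blast
  next
    case False
    then show ?thesis unfolding constant_on_def by (intro exI[of _ 0]) simp
  qed
  have "(\<forall>p\<in>topspace (mtop M). (norm (H p))\<^sup>2 = - lam / real m)
         \<and> (\<exists>c. minimal_in_sphere c (sqrt (- real m / lam)) M)"
    if lam: "lam < 0" and "\<not> minimal euclidean_tangent M"
  proof -
    obtain q where q: "q \<in> topspace (mtop M)" "H q \<noteq> 0"
      using \<open>\<not> minimal euclidean_tangent M\<close> unfolding minimal_def by blast
    note nz = nowhere_zero[OF conn q] and cc = centre_constant[OF conn q]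
    have n: "(norm (H p))\<^sup>2 = - lam / real m" if "p \<in> topspace (mtop M)" for p
      using norm_H[OF that nz[OF that]] assms(2) by simp
    have "dist (centre q) (imm M p) = sqrt (- real m / lam)" if p: "p \<in> topspace (mtop M)" for p
    proof -
      have "dist (centre q) (imm M p) = norm (inverse ((norm (H p))\<^sup>2) *\<^sub>R H p)"
        unfolding cc[OF p, symmetric] by (simp add: centre_def dist_norm)
      also have "\<dots> = inverse (norm (H p))"
        using nz[OF p] by (simp add: power2_eq_square)
      also have "\<dots> = sqrt (inverse ((norm (H p))\<^sup>2))"
        by (simp add: real_sqrt_inverse)
      also have "\<dots> = sqrt (- real m / lam)"
        unfolding n[OF p] by (simp add: divide_inverse mult.commute)
      finally show ?thesis .
    qed
    then have "imm M ` topspace (mtop M) \<subseteq> sphere (centre q) (sqrt (- real m / lam))"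
      by auto
    moreover have "minimal (sphere_tangent (centre q)) M"
      unfolding minimal_def using mean_curvature_sphere nz cc by metis
    ultimately show ?thesis
      using n unfolding minimal_in_sphere_def by blast
  qed
  with const minimal_if_nonneg show ?thesis
    unfolding minimal_def by blast
qed

end
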